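(* There is a randomized algorithm that, given a directed graph $G$ with a set $V^{\infty}(G)$ of distinguished vertices, a set of terminals $T\subseteq V^{\infty}(G)$ and an integer $p$, runs in time $4^{p}\cdot |V(G)|^{O(1)}$ and outputs a random set $Z\subseteq V(G)\setminus T$ with the following property, for some absolute constant $c$: for every thin set $S$ with $|S|\le p$ and every set $Y$ such that for every $v\in Y$ there is an important $v-T$ separator $S'\subseteq S$, the probability that both $S\cap Z=\emptyset$ and $Y\subseteq Z$ hold is at least $2^{-2^{cp}}$.
   Context: For disjoint nonempty $X,Y\subseteq V(G)$, a set $S\subseteq V(G)\setminus(X\cup Y\cup V^{\infty}(G))$ is an $X-Y$ separator if $G\setminus S$ has no directed path from $X$ to $Y$; it is minimal if no proper subset is an $X-Y$ separator. $R^{+}_{H}(X)$ is the set of vertices reachable from $X$ in $H$. A minimal $X-Y$ separator $S$ is important if there is no $X-Y$ separator $S'$ with $|S'|\le |S|$ and $R^{+}_{G\setminus S}(X)\subsetneq R^{+}_{G\setminus S'}(X)$. We write $v-T$ for $\{v\}-T$. The reverse shadow $r(S)$ of a set $S\subseteq V(G)\setminus V^{\infty}(G)$ (with respect to $T$) is the set of vertices $v$ such that $S$ is a $v-T$ separator. A set $S\subseteq V(G)$ is thin if there is no $v\in S$ that belongs to the reverse shadow of $S\setminus\{v\}$ with respect to $T$. *)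

theory Defs
  imports
    "Graph_Theory.Pair_Digraph"
    "Graph_Theory.Digraph_Component"
    "HOL-Probability.Probability_Mass_Function"
begin

section \<open>Separators and reverse shadows\<close>

definition delete_verts :: "('a, 'b) pre_digraph \<Rightarrow> 'a set \<Rightarrow> ('a, 'b) pre_digraph"
  where "delete_verts G S = G \<restriction> (verts G - S)"

definition reach_from :: "('a, 'b) pre_digraph \<Rightarrow> 'a set \<Rightarrow> 'a set"
  where "reach_from H X = {v. \<exists>x\<in>X. x \<rightarrow>\<^sup>*\<^bsub>H\<^esub> v}"

text \<open>In the following, \<open>U\<close> is the set of distinguished (undeletable) vertices of the graph.\<close>

definition separator ::
    "('a, 'b) pre_digraph \<Rightarrow> 'a set \<Rightarrow> 'a set \<Rightarrow> 'a set \<Rightarrow> 'a set \<Rightarrow> bool"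
  where "separator G U X Y S \<longleftrightarrow>
    X \<noteq> {} \<and> Y \<noteq> {} \<and> X \<inter> Y = {} \<and> X \<subseteq> verts G \<and> Y \<subseteq> verts G \<and>
    S \<subseteq> verts G - (X \<union> Y \<union> U) \<and>
    \<not> (\<exists>x\<in>X. \<exists>y\<in>Y. x \<rightarrow>\<^sup>*\<^bsub>delete_verts G S\<^esub> y)"

definition minimal_separator ::
    "('a, 'b) pre_digraph \<Rightarrow> 'a set \<Rightarrow> 'a set \<Rightarrow> 'a set \<Rightarrow> 'a set \<Rightarrow> bool"
  where "minimal_separator G U X Y S \<longleftrightarrow>
    separator G U X Y S \<and> \<not> (\<exists>S'. S' \<subset> S \<and> separator G U X Y S')"

definition important_separator ::
    "('a, 'b) pre_digraph \<Rightarrow> 'a set \<Rightarrow> 'a set \<Rightarrow> 'a set \<Rightarrow> 'a set \<Rightarrow> bool"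
  where "important_separator G U X Y S \<longleftrightarrow>
    minimal_separator G U X Y S \<and>
    \<not> (\<exists>S'. separator G U X Y S' \<and> card S' \<le> card S \<and>
          reach_from (delete_verts G S) X \<subset> reach_from (delete_verts G S') X)"

definition reverse_shadow :: "('a, 'b) pre_digraph \<Rightarrow> 'a set \<Rightarrow> 'a set \<Rightarrow> 'a set \<Rightarrow> 'a set"
  where "reverse_shadow G U T S = {v \<in> verts G. separator G U {v} T S}"

text \<open>
  The reverse shadow is a notion for sets of deletable vertices only; as a total function it
  returns the empty set on any other argument.  Hence \<open>thin\<close> has to require that every
  \<open>S - {v}\<close> is such a set.  Otherwise each set with two undeletable vertices
  would be thin for no good reason.
\<close>

definition thin :: "('a, 'b) pre_digraph \<Rightarrow> 'a set \<Rightarrow> 'a set \<Rightarrow> 'a set \<Rightarrow> bool"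
  where "thin G U T S \<longleftrightarrow>
    S \<subseteq> verts G \<and>
    (\<forall>v\<in>S. S - {v} \<subseteq> verts G - U \<and> v \<notin> reverse_shadow G U T (S - {v}))"


section \<open>Randomized programs and their running time\<close>

text \<open>
  The machine model is Jones's WHILE language with fair coin tosses: finitely many variables
  hold binary trees, and the only operations are pairing, projections, and the test for being
  a leaf.  Pairing shares its arguments, so each step below, for a fixed program, takes a
  bounded number of pointer operations; a RAM simulates \<open>t\<close> steps in time \<open>O(t)\<close>.
\<close>

datatype tree = Leaf | Branch (left: tree) (right: tree)
  where "left Leaf = Leaf" | "right Leaf = Leaf"

datatype expr = Var nat | LeafE | BranchE expr expr | LeftE expr | RightE expr

datatype com =
    Assign nat expr
  | Toss nat
  | Seq com com
  | Cond nat com com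
  | While nat com

type_synonym store = "nat \<Rightarrow> tree"

fun eval_expr :: "expr \<Rightarrow> store \<Rightarrow> tree" where
  "eval_expr (Var x) s = s x"
| "eval_expr LeafE s = Leaf"
| "eval_expr (BranchE a b) s = Branch (eval_expr a s) (eval_expr b s)"
| "eval_expr (LeftE a) s = left (eval_expr a s)"
| "eval_expr (RightE a) s = right (eval_expr a s)"

definition enc_bool :: "bool \<Rightarrow> tree"
  where "enc_bool b = (if b then Branch Leaf Leaf else Leaf)"

text \<open>
  A configuration consists of the stack of commands still to be executed and the store;
  the program has halted when the stack is empty.
\<close>

type_synonym config = "com list \<times> store"

fun step :: "config \<Rightarrow> config pmf" where
  "step ([], s) = return_pmf ([], s)"
| "step (Assign x e # cs, s) = return_pmf (cs, s(x := eval_expr e s))"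
| "step (Toss x # cs, s) = map_pmf (\<lambda>b. (cs, s(x := enc_bool b))) (bernoulli_pmf (1 / 2))"
| "step (Seq c d # cs, s) = return_pmf (c # d # cs, s)"
| "step (Cond x c d # cs, s) = return_pmf ((if s x \<noteq> Leaf then c else d) # cs, s)"
| "step (While x c # cs, s) =
     return_pmf (if s x \<noteq> Leaf then c # While x c # cs else cs, s)"

primrec run :: "nat \<Rightarrow> config \<Rightarrow> config pmf" where
  "run 0 c = return_pmf c"
| "run (Suc t) c = bind_pmf (step c) (run t)"

lemma run_halted: "run t ([], s) = return_pmf ([], s)"
  by (induction t) (simp_all add: bind_return_pmf)

definition init_config :: "com \<Rightarrow> tree \<Rightarrow> config"
  where "init_config P i = ([P], (\<lambda>_. Leaf)(0 := i))"

text \<open>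
  On input \<open>i\<close>, the program \<open>P\<close> halts after at most \<open>t\<close> steps whatever the coin tosses are,
  and its output, found in variable 0, has distribution \<open>D\<close>.
\<close>

definition outputs_within :: "com \<Rightarrow> tree \<Rightarrow> nat \<Rightarrow> tree pmf \<Rightarrow> bool"
  where "outputs_within P i t D \<longleftrightarrow>
    (\<forall>c \<in> set_pmf (run t (init_config P i)). fst c = []) \<and>
    D = map_pmf (\<lambda>c. snd c 0) (run t (init_config P i))"


section \<open>Encoding of instances\<close>

text \<open>
  A graph is presented by its adjacency matrix and a set of vertices by its characteristic
  vector, both with respect to an enumeration \<open>vs\<close> of the vertices.  The parameter is given in
  unary; producing this from binary takes time \<open>O(p)\<close>, which \<open>4 ^ p\<close> absorbs.
\<close>

definition enc_list :: "tree list \<Rightarrow> tree"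
  where "enc_list ts = foldr Branch ts Leaf"

definition enc_nat :: "nat \<Rightarrow> tree"
  where "enc_nat n = enc_list (replicate n Leaf)"

definition enc_set :: "'a list \<Rightarrow> 'a set \<Rightarrow> tree"
  where "enc_set vs A = enc_list (map (\<lambda>v. enc_bool (v \<in> A)) vs)"

definition enc_graph :: "'a list \<Rightarrow> 'a pair_pre_digraph \<Rightarrow> tree"
  where "enc_graph vs G = enc_list (map (\<lambda>u. enc_set vs {v. (u, v) \<in> parcs G}) vs)"

definition enc_instance ::
    "'a list \<Rightarrow> 'a pair_pre_digraph \<Rightarrow> 'a set \<Rightarrow> 'a set \<Rightarrow> nat \<Rightarrow> tree"
  where "enc_instance vs G U T p =
    enc_list [enc_graph vs G, enc_set vs U, enc_set vs T, enc_nat p]"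

end

theory Submission
  imports Defs "HOL-Real_Asymp.Real_Asymp"
begin

text \<open>
  Every vertex tosses a fair coin; let \<open>R\<close> be the set of heads.  For a vertex \<open>v\<close> start with
  \<open>X = {v}\<close> and repeat \<open>p + 1\<close> times: let \<open>C\<close> be the minimum cut between \<open>X\<close> and \<open>T\<close> that is
  furthest from \<open>X\<close>, and add \<open>C - R\<close> to \<open>X\<close>.  The vertex \<open>v\<close> is put into \<open>Z\<close> iff the final cut
  is contained in \<open>R\<close> and has at most \<open>p\<close> elements.  Since \<open>C\<close> is furthest, adding any
  of its vertices to \<open>X\<close> increases the size of the minimum cut.

  If \<open>S'\<close> is an important \<open>v - T\<close> separator of size at most \<open>p\<close> contained in \<open>R\<close>, then by
  submodularity each \<open>C\<close> lies in \<open>S'\<close> together with the vertices reachable from \<open>v\<close> without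
  \<open>S'\<close>, so \<open>X\<close> never leaves that reachable set, the cuts stay of size at most \<open>p\<close>, and \<open>v\<close> is
  accepted.  If \<open>s \<in> S\<close> and \<open>S\<close> is thin, consider the run for \<open>s\<close> with \<open>R = S\<close>: its cuts contain at
  most \<open>(p + 2) p\<close> vertices outside \<open>S\<close>.  Whenever \<open>R\<close> contains \<open>S\<close> and avoids these, the run
  for \<open>R\<close> is the same, and acceptance would give an \<open>s - T\<close> separator inside \<open>S - {s}\<close>.  So only
  \<open>O(p\<^sup>3)\<close> coins have to come out right, and the algorithm is in fact polynomial.
\<close>

section \<open>Furthest minimum cuts\<close>

text \<open>Undeletable vertices are awkward for uncrossing, because the side of a cut would have to
  be closed under them. The torso removes them: a path through \<open>U\<close> becomes one arc,
  cuts become boundaries \<open>bd L\<close> of sets of deletable vertices, and for fixed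
  \<open>X\<close> the valid sets are closed under union and intersection. The torso has a loop at
  each deletable vertex, so disjoint paths turn into a matching between two copies of these
  vertices, and augmenting paths are plain alternating paths.

  The size of \<open>Y\<close> does not enter the probability: once \<open>R\<close> contains the
  deletable part of \<open>S\<close>, all vertices of \<open>Y\<close> are accepted at once. Only
  the at most \<open>p\<close> vertices of \<open>S\<close> need guards, at most (p + 2) p each,
  which makes p + p (p + 2) p = p (p + 1)^2 prescribed coins; with p + 1 <= 2^p this gives the
  constant 3.

  Running time is not counted for a whole program. Each list function gets its program and its
  polynomial from closure rules, with a size parameter that stands for n + p.\<close>

locale cut_graph =
  fixes V :: "'a set" and E :: "('a \<times> 'a) set" and U T :: "'a set"
  assumes fin: "finite V" and arcs: "E \<subseteq> V \<times> V" and und: "U \<subseteq> V" and trm: "T \<subseteq> U"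
begin

definition reach :: "'a set \<Rightarrow> 'a \<Rightarrow> 'a set"
  where "reach S v = {w. (v, w) \<in> (Restr E (V - S))\<^sup>*}"

definition sep :: "'a \<Rightarrow> 'a set \<Rightarrow> bool"
  where "sep v S \<longleftrightarrow> v \<in> V \<and> v \<notin> T \<and> T \<noteq> {} \<and> S \<subseteq> V - ({v} \<union> T \<union> U) \<and> reach S v \<inter> T = {}"

definition important :: "'a \<Rightarrow> 'a set \<Rightarrow> bool"
  where "important v S \<longleftrightarrow> sep v S \<and>
    \<not> (\<exists>S'. sep v S' \<and> card S' \<le> card S \<and> reach S v \<subset> reach S' v)"

section \<open>Cuts as vertex boundaries in the torso\<close>

definition hop :: "('a \<times> 'a) set"
  where "hop = E O (E \<inter> U \<times> V)\<^sup>*"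

text \<open>A torso arc stands for a path of \<open>E\<close> whose inner vertices are all
  undeletable. The loops let a vertex that no path uses be matched to itself later on.\<close>

definition torso :: "('a \<times> 'a) set"
  where "torso = {(l, r). r \<in> V - U \<and> (l = r \<or> (l, r) \<in> hop)}"

text \<open>From an exit, \<open>T\<close> can be reached without meeting another deletable vertex,
  so no boundary can protect a set that contains one.\<close>

definition exits :: "'a set"
  where "exits = {l. \<exists>t\<in>T. (l, t) \<in> hop}"

definition bd :: "'a set \<Rightarrow> 'a set"
  where "bd L = torso `` L - L"

text \<open>The source set \<open>X\<close> may contain undeletable vertices because the start
  vertex may be one; every other vertex of \<open>L\<close> is deletable.\<close>

definition valid :: "'a set \<Rightarrow> 'a set \<Rightarrow> bool"
  where "valid X L \<longleftrightarrow> X \<subseteq> L \<and> L \<subseteq> (V - U) \<union> X \<and> L \<inter> exits = {}"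

text \<open>Being furthest means containing every other minimiser. Existence is not derived from
  submodularity but from a maximum flow, in \<open>flow_best\<close>.\<close>

definition best :: "'a set \<Rightarrow> 'a set \<Rightarrow> bool"
  where "best X L \<longleftrightarrow> valid X L \<and> (\<forall>L'. valid X L' \<longrightarrow>
    card (bd L) \<le> card (bd L') \<and> (card (bd L') = card (bd L) \<longrightarrow> L' \<subseteq> L))"

lemma bd_sub: "bd L \<subseteq> V - U"
  by (auto simp: bd_def torso_def)

lemma finite_bd: "finite (bd L)"
  using bd_sub fin by (meson finite_Diff finite_subset)

lemma hop_step: "(l, w) \<in> hop \<Longrightarrow> w \<in> U \<Longrightarrow> (w, x) \<in> E \<Longrightarrow> (l, x) \<in> hop"
proof -
  assume a: "(l, w) \<in> hop" "w \<in> U" "(w, x) \<in> E"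
  then obtain y where y: "(l, y) \<in> E" "(y, w) \<in> (E \<inter> U \<times> V)\<^sup>*"
    unfolding hop_def by blast
  have "(w, x) \<in> E \<inter> U \<times> V" using a arcs by auto
  with y have "(y, x) \<in> (E \<inter> U \<times> V)\<^sup>*" by (meson rtrancl.rtrancl_into_rtrancl)
  with y show ?thesis unfolding hop_def by blast
qed

lemma hop_arc: "(l, x) \<in> E \<Longrightarrow> (l, x) \<in> hop"
  unfolding hop_def by blast

lemma reach_step: "w \<in> reach S v \<Longrightarrow> (w, x) \<in> E \<Longrightarrow> w \<notin> S \<Longrightarrow> x \<notin> S \<Longrightarrow> x \<in> reach S v"
  unfolding reach_def using arcs by (auto intro: rtrancl_into_rtrancl)

lemma reach_refl: "v \<in> reach S v"
  by (simp add: reach_def)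

lemma reach_not_sep: "w \<in> reach S v \<Longrightarrow> v \<notin> S \<Longrightarrow> w \<notin> S"
  unfolding reach_def by (auto elim: rtranclE)

lemma reach_sub: "w \<in> reach S v \<Longrightarrow> v \<in> V \<Longrightarrow> w \<in> V"
  unfolding reach_def by (auto elim: rtranclE)

text \<open>The inner vertices of a hop are undeletable and hence outside \<open>S\<close>, so a
  walk that avoids \<open>S\<close> can follow it and can be stopped only at its last
  vertex.\<close>

lemma reach_hop:
  assumes "l \<in> reach S v" "v \<notin> S" "S \<inter> U = {}" "(l, w) \<in> hop"
  shows "w \<in> reach S v \<union> S"
proof -
  obtain y where y: "(l, y) \<in> E" "(y, w) \<in> (E \<inter> U \<times> V)\<^sup>*"
    using assms unfolding hop_def by blast
  from y(2) show ?thesis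
  proof (induction rule: rtrancl_induct)
    case base
    then show ?case using reach_step[OF assms(1) y(1)] reach_not_sep assms by auto
  next
    case (step x z)
    then have "x \<notin> S" "x \<in> U" using assms by auto
    then show ?case using step reach_step[of x S v z] by auto
  qed
qed

text \<open>A walk avoiding \<open>bd L\<close> can leave \<open>L\<close> only into undeletable
  vertices, and is then in the middle of a hop from \<open>L\<close>. The next deletable vertex is a
  torso neighbour of \<open>L\<close> outside \<open>bd L\<close>, so it lies in \<open>L\<close>
  again.\<close>

lemma reach_bd:
  assumes "valid X L" "v \<in> L" "w \<in> reach (bd L) v"
  shows "w \<in> L \<or> (w \<in> U \<and> (\<exists>l\<in>L. (l, w) \<in> hop))"
  using assms(3) unfolding reach_def mem_Collect_eq
proof (induction rule: rtrancl_induct)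
  case base
  then show ?case using assms by blast
next
  case (step y z)
  obtain l where l: "l \<in> L" "(l, z) \<in> hop"
    using step hop_arc hop_step by auto
  show ?case
  proof (cases "z \<in> U")
    case False
    then have "(l, z) \<in> torso" using l step arcs by (auto simp: torso_def)
    then show ?thesis using step l by (auto simp: bd_def)
  qed (use l in auto)
qed

lemma valid_sep:
  assumes "valid X L" "X \<subseteq> V" "X \<inter> T = {}" "v \<in> X" "T \<noteq> {}"
  shows "sep v (bd L)"
proof -
  have "reach (bd L) v \<inter> T = {}"
  proof (rule ccontr)
    assume "reach (bd L) v \<inter> T \<noteq> {}"
    then obtain t where t: "t \<in> reach (bd L) v" "t \<in> T" by auto
    have "v \<in> L" using assms by (auto simp: valid_def)
    from reach_bd[OF assms(1) this t(1)] assms t trm show False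
      unfolding valid_def exits_def by blast
  qed
  moreover have "bd L \<subseteq> V - ({v} \<union> T \<union> U)"
    using bd_sub[of L] trm assms unfolding bd_def valid_def by blast
  ultimately show ?thesis using assms unfolding sep_def by auto
qed

text \<open>Undeletable vertices of the reachable set are dropped to obtain a valid set for
  \<open>{v}\<close>; \<open>v\<close> is put back because it may itself be undeletable.\<close>

definition side :: "'a \<Rightarrow> 'a set \<Rightarrow> 'a set"
  where "side v S = insert v (reach S v - U)"

lemma side_reach: "side v S \<subseteq> reach S v"
  by (auto simp: side_def reach_refl)

lemma sep_side:
  assumes "sep v S"
  shows "valid {v} (side v S)" "bd (side v S) \<subseteq> S"
proof -
  have v: "v \<in> V" "v \<notin> S" "S \<inter> U = {}" "S \<inter> T = {}" "reach S v \<inter> T = {}"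
    using assms by (auto simp: sep_def)
  have *: "w \<in> reach S v \<union> S" if "l \<in> side v S" "(l, w) \<in> hop" for l w
    using reach_hop[of l S v w] that side_reach v by auto
  have "side v S \<inter> exits = {}"
    unfolding exits_def using * v by blast
  then show "valid {v} (side v S)"
    unfolding valid_def using reach_sub[of _ S v] v by (auto simp: side_def)
  show "bd (side v S) \<subseteq> S"
    using * unfolding bd_def torso_def by (auto simp: side_def)
qed

text \<open>The union of the two boundaries on the left lies in the union of those on the right, and
  likewise for the intersections, so no vertex is counted more often on the left.\<close>

lemma bd_submodular:
  "card (bd (L \<union> M)) + card (bd (L \<inter> M)) \<le> card (bd L) + card (bd M)"
proof -
  have "card (bd (L \<union> M)) + card (bd (L \<inter> M))
      = card (bd (L \<union> M) \<union> bd (L \<inter> M)) + card (bd (L \<union> M) \<inter> bd (L \<inter> M))"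
    by (rule card_Un_Int) (auto simp: finite_bd)
  also have "\<dots> \<le> card (bd L \<union> bd M) + card (bd L \<inter> bd M)"
    by (intro add_mono card_mono) (simp_all add: finite_bd, auto simp: bd_def)
  also have "\<dots> = card (bd L) + card (bd M)"
    by (rule card_Un_Int[symmetric]) (auto simp: finite_bd)
  finally show ?thesis .
qed

text \<open>Uncrossing of \<open>L\<close> with \<open>side v S\<close>: minimality of
  \<open>L\<close> pays for the intersection, so the union has a boundary of size at most
  \<open>card S\<close>, and importance of \<open>S\<close> forbids that this boundary lets
  \<open>v\<close> reach more. Then the part of \<open>L\<close> inside the reachable set has its
  boundary within \<open>bd L\<close>, and minimality makes the two boundaries equal.\<close>

lemma important_push:
  assumes imp: "important v S" and X: "v \<in> X" "X \<subseteq> side v S" and L: "best X L"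
  shows "bd L \<subseteq> side v S \<union> S" "card (bd L) \<le> card S"
proof -
  let ?M = "side v S"
  have sep: "sep v S" using imp by (simp add: important_def)
  then have v: "v \<in> V" "v \<notin> S" "v \<notin> T" "T \<noteq> {}" "S \<inter> U = {}" "finite S" "reach S v \<inter> T = {}"
    using fin by (auto simp: sep_def intro: finite_subset)
  have M: "valid X ?M"
    using sep_side(1)[OF sep] X unfolding valid_def by auto
  have vL: "valid X L" using L by (simp add: best_def)
  have cM: "card (bd ?M) \<le> card S"
    using sep_side(2)[OF sep] v by (simp add: card_mono)
  show "card (bd L) \<le> card S" using L M cM unfolding best_def by fastforce
  have "valid X (L \<inter> ?M)" using M vL unfolding valid_def by auto
  then have "card (bd L) \<le> card (bd (L \<inter> ?M))" using L by (simp add: best_def)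
  with bd_submodular[of L ?M] cM have cU: "card (bd (L \<union> ?M)) \<le> card S" by linarith
  have vU: "valid X (L \<union> ?M)" using M vL unfolding valid_def by auto
  have XV: "X \<subseteq> V" "X \<inter> T = {}"
    using X(2) side_reach[of v S] v reach_sub[of _ S v] by auto
  let ?S = "bd (L \<union> ?M)"
  have sepU: "sep v ?S" by (rule valid_sep[OF vU XV X(1)]) (use v in auto)
  \<comment> \<open>The deletable vertices of a walk that avoids \<open>S\<close> lie in
    \<open>side v S\<close>, hence outside the boundary of the larger set.\<close>
  have "reach S v \<subseteq> reach ?S v"
  proof
    fix w assume "w \<in> reach S v"
    then have "(v, w) \<in> (Restr E (V - S))\<^sup>*" by (simp add: reach_def)
    then show "w \<in> reach ?S v"
    proof (induction rule: rtrancl_induct)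
      case base then show ?case by (rule reach_refl)
    next
      case (step y z)
      have "y \<in> reach S v" "z \<in> reach S v"
        using step(1,2) by (auto simp: reach_def intro: rtrancl_into_rtrancl)
      then have "y \<notin> ?S" "z \<notin> ?S"
        using bd_sub[of "L \<union> ?M"] by (auto simp: bd_def side_def)
      then show ?case using step reach_step by auto
    qed
  qed
  with imp sepU cU have eq: "reach ?S v = reach S v" unfolding important_def by blast
  \<comment> \<open>A furthest cut may contain vertices that \<open>v\<close> cannot reach; they are
    removed before boundaries are compared.\<close>
  define L' where "L' = {l \<in> L. l \<in> reach S v}"
  have "valid X L'" using vL X side_reach[of v S] unfolding valid_def L'_def by auto
  moreover have key: "bd L' \<subseteq> bd L \<inter> (?M \<union> S)"
  proof
    fix r assume r: "r \<in> bd L'"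
    then obtain l where l: "l \<in> L'" "(l, r) \<in> torso" "r \<notin> L'" "r \<in> V - U"
      unfolding bd_def torso_def by auto
    then have "(l, r) \<in> hop" by (auto simp: torso_def)
    then have rs: "r \<in> reach S v \<union> S" using reach_hop[of l S v r] l v by (auto simp: L'_def)
    have "r \<notin> L"
    proof
      assume "r \<in> L"
      then have "r \<notin> ?S" by (simp add: bd_def)
      have "v \<notin> ?S" using X vL by (auto simp: bd_def valid_def)
      moreover have "?S \<inter> U = {}" using bd_sub by auto
      ultimately have "r \<in> reach ?S v \<union> ?S"
        using reach_hop[of l ?S v r] l(1) eq \<open>(l, r) \<in> hop\<close> by (auto simp: L'_def)
      then show False using \<open>r \<notin> ?S\<close> eq \<open>r \<in> L\<close> l by (auto simp: L'_def)
    qed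
    moreover have "l \<in> L" using l by (simp add: L'_def)
    ultimately show "r \<in> bd L \<inter> (?M \<union> S)" using l rs by (auto simp: bd_def side_def)
  qed
  ultimately have "card (bd L) \<le> card (bd L')" using L by (simp add: best_def)
  then have "bd L' = bd L" using key finite_bd by (metis card_subset_eq card_mono le_antisym le_inf_iff)
  then show "bd L \<subseteq> ?M \<union> S" using key by auto
qed


section \<open>Disjoint paths as matchings and their duality with cuts\<close>

definition slots :: "'a set \<Rightarrow> 'a set"
  where "slots X = V - U - X"

text \<open>
  Disjoint paths from \<open>X\<close> to the exits are encoded by the function \<open>m\<close> that sends each deletable
  vertex outside \<open>X\<close> to its predecessor in the torso on the path through it, or to itself if no
  path uses it; this is a matching in which the vertices of \<open>X\<close> have infinite capacity and the
  unmatched ones are the path ends.  During an augmentation, \<open>A\<close> holds the vertex that is still to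
  be matched.
\<close>

definition pre_flow :: "'a set \<Rightarrow> 'a set \<Rightarrow> ('a \<Rightarrow> 'a) \<Rightarrow> bool"
  where "pre_flow X A m \<longleftrightarrow>
    (\<forall>r\<in>slots X. m r \<in> slots X \<union> X \<and> (m r, r) \<in> torso) \<and>
    inj_on m {r \<in> slots X. m r \<notin> X} \<and>
    (\<forall>l\<in>slots X - m ` slots X. l \<in> exits \<or> l \<in> A) \<and>
    A \<subseteq> X \<union> (slots X - m ` slots X)"

text \<open>A path is counted at its first slot, the one whose predecessor lies in
  \<open>X\<close>.\<close>

definition flow_val :: "'a set \<Rightarrow> ('a \<Rightarrow> 'a) \<Rightarrow> nat"
  where "flow_val X m = card {r \<in> slots X. m r \<in> X}"

text \<open>Only the values on \<open>slots X\<close> carry meaning. This allows the lists of the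
  algorithm to be compared with functions on all vertices.\<close>

lemma pre_flow_cong:
  assumes "\<And>r. r \<in> slots X \<Longrightarrow> m r = m' r"
  shows "pre_flow X A m \<longleftrightarrow> pre_flow X A m'" "flow_val X m = flow_val X m'"
proof -
  have s: "{r \<in> slots X. m r \<notin> X} = {r \<in> slots X. m' r \<notin> X}"
    "{r \<in> slots X. m r \<in> X} = {r \<in> slots X. m' r \<in> X}"
    by (rule Collect_cong, rule conj_cong[OF refl], simp add: assms)+
  have "m ` slots X = m' ` slots X" by (rule image_cong) (simp_all add: assms)
  note s = s this
  have "inj_on m {r \<in> slots X. m' r \<notin> X} = inj_on m' {r \<in> slots X. m' r \<notin> X}"
    by (rule inj_on_cong) (use assms in auto)
  moreover have "(\<forall>r\<in>slots X. m r \<in> slots X \<union> X \<and> (m r, r) \<in> torso) \<longleftrightarrow>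
    (\<forall>r\<in>slots X. m' r \<in> slots X \<union> X \<and> (m' r, r) \<in> torso)"
    by (rule ball_cong) (simp_all add: assms)
  ultimately show "pre_flow X A m \<longleftrightarrow> pre_flow X A m'"
    unfolding pre_flow_def s(1,3) by (simp only:)
  show "flow_val X m = flow_val X m'" unfolding flow_val_def s(2) ..
qed

lemma finite_slots: "finite (slots X)"
  using fin by (simp add: slots_def)

lemma pre_flow_id: "pre_flow X {} (\<lambda>r. r)" "flow_val X (\<lambda>r. r) = 0"
  by (auto simp: pre_flow_def flow_val_def torso_def slots_def)

text \<open>Matching \<open>r\<close> to the open vertex \<open>a\<close> frees the old partner
  \<open>m r\<close>, which becomes the open vertex. The two \<open>of_bool\<close> terms telescope
  along a path, so a path that returns to \<open>X\<close> needs no separate treatment.\<close>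

lemma pre_flow_step:
  assumes m: "pre_flow X {a} m" and r: "r \<in> slots X" "(a, r) \<in> torso"
  shows "pre_flow X {m r} (m(r := a))"
    "flow_val X (m(r := a)) + of_bool (m r \<in> X) = flow_val X m + of_bool (a \<in> X)"
proof -
  let ?m = "m(r := a)"
  have a: "a \<in> slots X \<union> X" "a \<notin> X \<Longrightarrow> a \<notin> m ` slots X" using m by (auto simp: pre_flow_def)
  have mr: "m r \<in> slots X \<union> X" using m r by (auto simp: pre_flow_def)
  have inj: "inj_on m {r \<in> slots X. m r \<notin> X}" using m by (simp add: pre_flow_def)
  have sX: "x \<notin> X" if "x \<in> slots X" for x using that by (simp add: slots_def)
  have free: "m r \<notin> ?m ` slots X" if "m r \<notin> X"
    using a inj r that unfolding inj_on_def by (auto split: if_splits)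
  have 1: "\<forall>r\<in>slots X. ?m r \<in> slots X \<union> X \<and> (?m r, r) \<in> torso"
    using m a r by (auto simp: pre_flow_def)
  have 2: "inj_on ?m {r \<in> slots X. ?m r \<notin> X}"
    using inj a unfolding inj_on_def by (auto split: if_splits) 
  have 3: "\<forall>l\<in>slots X - ?m ` slots X. l \<in> exits \<or> l \<in> {m r}"
  proof
    fix l assume l: "l \<in> slots X - ?m ` slots X"
    then have "l \<noteq> a" using r by auto
    moreover have "l \<notin> m ` slots X" if "l \<noteq> m r" using that l by (auto split: if_splits)
    ultimately show "l \<in> exits \<or> l \<in> {m r}" using m l unfolding pre_flow_def by auto
  qed
  have 4: "{m r} \<subseteq> X \<union> (slots X - ?m ` slots X)"
    using free mr by (cases "m r \<in> X") (simp_all only: insert_subset Un_iff Diff_iff simp_thms empty_subsetI)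
  show "pre_flow X {m r} ?m" unfolding pre_flow_def
    by (rule conjI[OF 1 conjI[OF 2 conjI[OF 3 4]]])
  have "{s \<in> slots X. ?m s \<in> X} = {s \<in> slots X - {r}. m s \<in> X} \<union> (if a \<in> X then {r} else {})"
    "{s \<in> slots X. m s \<in> X} = {s \<in> slots X - {r}. m s \<in> X} \<union> (if m r \<in> X then {r} else {})"
    using r by auto
  then show "flow_val X ?m + of_bool (m r \<in> X) = flow_val X m + of_bool (a \<in> X)"
    unfolding flow_val_def using finite_slots[of X] by auto
qed

text \<open>An alternating path recorded by its updates: the pair \<open>(r, l)\<close> says that
  slot \<open>r\<close> is to be matched to \<open>l\<close> instead of \<open>m r\<close>, after
  which the path goes on from \<open>m r\<close>.\<close>

inductive aug_path :: "'a set \<Rightarrow> ('a \<Rightarrow> 'a) \<Rightarrow> 'a \<Rightarrow> ('a \<times> 'a) list \<Rightarrow> bool" for X m where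
  "l \<in> exits \<Longrightarrow> aug_path X m l []"
| "r \<in> slots X \<Longrightarrow> (l, r) \<in> torso \<Longrightarrow> aug_path X m (m r) q \<Longrightarrow> aug_path X m l ((r, l) # q)"

lemma aug_path_cong:
  assumes "aug_path X m l q" "\<And>r. r \<in> fst ` set q \<Longrightarrow> m' r = m r"
  shows "aug_path X m' l q"
  using assms
proof (induction rule: aug_path.induct)
  case (2 r l q)
  then show ?case using aug_path.intros(2)[of r X l m' q] by auto
qed (rule aug_path.intros)

definition shift :: "('a \<Rightarrow> 'a) \<Rightarrow> ('a \<times> 'a) list \<Rightarrow> 'a \<Rightarrow> 'a"
  where "shift = foldl (\<lambda>m (r, l). m(r := l))"

lemma shift_Cons: "shift m ((r, l) # q) = shift (m(r := l)) q"
  by (simp add: shift_def)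

lemma shift_cong: "f j = g j \<Longrightarrow> shift f q j = shift g q j"
proof (induction q arbitrary: f g)
  case (Cons x q)
  obtain r l where x: "x = (r, l)" by (cases x)
  show ?case unfolding x shift_Cons by (rule Cons.IH) (simp add: Cons.prems)
qed (simp add: shift_def)

lemma augment:
  assumes "aug_path X m a q" "distinct (map fst q)" "pre_flow X {a} m" "X \<inter> exits = {}"
  shows "pre_flow X {} (shift m q) \<and> flow_val X (shift m q) = flow_val X m + of_bool (a \<in> X)"
  using assms
proof (induction q arbitrary: m a rule: list.induct)
  case Nil
  \<comment> \<open>An exit may stay unmatched, and it is not in \<open>X\<close>, so the value does
    not change here.\<close>
  then have "a \<in> exits" by (auto elim: aug_path.cases)
  then show ?case using Nil by (auto simp: shift_def pre_flow_def)
next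
  case (Cons x q)
  then obtain r where x: "x = (r, a)" "r \<in> slots X" "(a, r) \<in> torso" "aug_path X m (m r) q"
    by (auto elim: aug_path.cases)
  \<comment> \<open>The slots of the path are distinct, so the update at \<open>r\<close> does not
    disturb the rest of it.\<close>
  have "aug_path X (m(r := a)) (m r) q"
    using x Cons(3) by (intro aug_path_cong[OF x(4)]) auto
  moreover have "distinct (map fst q)" using Cons.prems(2) by simp
  ultimately have "pre_flow X {} (shift (m(r := a)) q)"
    "flow_val X (shift (m(r := a)) q) = flow_val X (m(r := a)) + of_bool (m r \<in> X)"
    using Cons.IH pre_flow_step(1)[OF Cons.prems(3) x(2,3)] Cons.prems(4) by blast+
  moreover have "shift m (x # q) = shift (m(r := a)) q" by (simp add: x shift_def)
  ultimately show ?case using pre_flow_step(2)[OF Cons.prems(3) x(2,3)] by simp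
qed

lemma augment_flow:
  assumes "pre_flow X {} m" "X \<inter> exits = {}" "a \<in> X" "aug_path X m a q" "distinct (map fst q)"
  shows "pre_flow X {} (shift m q)" "flow_val X (shift m q) = Suc (flow_val X m)"
proof -
  have "pre_flow X {a} m" using assms by (auto simp: pre_flow_def)
  from augment[OF assms(4,5) this assms(2)] assms(3)
  show "pre_flow X {} (shift m q)" "flow_val X (shift m q) = Suc (flow_val X m)" by auto
qed

lemma finite_valid: "valid X L \<Longrightarrow> finite X \<Longrightarrow> finite L"
  using fin by (auto simp: valid_def intro: finite_subset)

text \<open>As \<open>L\<close> has no exits, each vertex of \<open>L - X\<close> must be the
  predecessor of some slot, and of exactly one by injectivity. The remaining slots matched into
  \<open>L\<close> are the first slots of the paths.\<close>

lemma flow_inside: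
  assumes m: "pre_flow X {} m" and L: "valid X L" and X: "finite X"
  shows "card {r \<in> slots X. m r \<in> L} = flow_val X m + card (L - X)"
proof -
  have sX: "L - X \<subseteq> slots X" using L by (auto simp: valid_def slots_def)
  have "L - X \<subseteq> m ` slots X" using m L sX unfolding pre_flow_def valid_def by blast
  then have img: "m ` {r \<in> slots X. m r \<in> L - X} = L - X" by auto
  have "inj_on m {r \<in> slots X. m r \<in> L - X}"
    using m unfolding pre_flow_def by (auto intro: inj_on_subset)
  then have "card {r \<in> slots X. m r \<in> L - X} = card (L - X)"
    using img card_image by fastforce
  moreover have "{r \<in> slots X. m r \<in> L}
      = {r \<in> slots X. m r \<in> X} \<union> {r \<in> slots X. m r \<in> L - X}"
    using L by (auto simp: valid_def)
  moreover have "card ({r \<in> slots X. m r \<in> X} \<union> {r \<in> slots X. m r \<in> L - X})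
      = card {r \<in> slots X. m r \<in> X} + card {r \<in> slots X. m r \<in> L - X}"
    by (rule card_Un_disjoint) (auto simp: finite_slots)
  ultimately show ?thesis by (simp add: flow_val_def)
qed

lemma torso_side:
  assumes "valid X L"
  shows "torso `` L - X = bd L \<union> (L - X)"
proof -
  \<comment> \<open>This is where the loops of \<open>torso\<close> enter.\<close>
  have "l \<in> torso `` L" if "l \<in> L - X" for l
    using that assms by (auto simp: valid_def torso_def)
  then show ?thesis using assms by (auto simp: bd_def valid_def)
qed

lemma card_torso_side:
  assumes "valid X L" "finite X"
  shows "card (torso `` L - X) = card (bd L) + card (L - X)"
proof -
  have "card (bd L \<union> (L - X)) = card (bd L) + card (L - X)"
    by (rule card_Un_disjoint) (use assms finite_valid finite_bd in \<open>auto simp: bd_def\<close>)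
  then show ?thesis using torso_side[OF assms(1)] by simp
qed

text \<open>Weak duality by counting slots matched into \<open>L\<close>: they are torso successors
  of \<open>L\<close> outside \<open>X\<close>, of which there are
  \<open>card (bd L) + card (L - X)\<close>. In the tight case every such successor is matched into
  \<open>L\<close>.\<close>

lemma flow_le:
  assumes m: "pre_flow X {} m" and L: "valid X L" and X: "finite X"
  shows "flow_val X m \<le> card (bd L)"
    "card (bd L) = flow_val X m \<Longrightarrow> {r \<in> slots X. m r \<in> L} = torso `` L - X"
proof -
  have sub: "{r \<in> slots X. m r \<in> L} \<subseteq> torso `` L - X"
    using m unfolding pre_flow_def by (auto simp: slots_def)
  have f: "finite (torso `` L - X)"
    using torso_side[OF L] finite_bd finite_valid[OF L X] by simp
  show "flow_val X m \<le> card (bd L)"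
    using card_mono[OF f sub] flow_inside[OF m L X] card_torso_side[OF L X] by simp
  show "card (bd L) = flow_val X m \<Longrightarrow> {r \<in> slots X. m r \<in> L} = torso `` L - X"
    using card_subset_eq[OF f sub] flow_inside[OF m L X] card_torso_side[OF L X] by simp
qed

text \<open>In the tight case an alternating path that starts in \<open>L\<close> never gets out,
  since each slot it moves to is again matched into \<open>L\<close>. It would have to end at an
  exit inside \<open>L\<close>.\<close>

lemma aug_path_leaves:
  assumes "aug_path X m l q" "valid X L" "{r \<in> slots X. m r \<in> L} = torso `` L - X"
  shows "l \<notin> L"
  using assms
proof (induction rule: aug_path.induct)
  case (1 l) then show ?case by (auto simp: valid_def)
next
  case (2 r l q)
  then show ?case by (auto simp: slots_def)
qed

text \<open>Max-flow min-cut with \<open>Q\<close> as the set of vertices that start an augmenting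
  path. Closure of \<open>Q\<close> makes the complement tight; by \<open>aug_path_leaves\<close>
  every minimum cut side avoids \<open>Q\<close>, so the complement is the largest one.\<close>

lemma flow_best:
  assumes m: "pre_flow X {} m" and X: "finite X" "X \<inter> Q = {}"
    and Q: "\<And>l. l \<in> slots X \<union> X \<Longrightarrow> l \<in> exits \<Longrightarrow> l \<in> Q"
    "\<And>l r. l \<in> slots X \<union> X \<Longrightarrow> r \<in> slots X \<Longrightarrow> (l, r) \<in> torso \<Longrightarrow> m r \<in> Q \<Longrightarrow> l \<in> Q"
    and path: "\<And>l. l \<in> Q \<Longrightarrow> \<exists>q. aug_path X m l q"
  shows "best X (slots X \<union> X - Q)" "card (bd (slots X \<union> X - Q)) = flow_val X m"
proof -
  let ?L = "slots X \<union> X - Q"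
  have v: "valid X ?L" using X Q by (auto simp: valid_def slots_def)
  have "torso `` ?L - X \<subseteq> {r \<in> slots X. m r \<in> ?L}"
    using m Q(2) by (auto simp: slots_def torso_def pre_flow_def)
  from card_mono[OF _ this] finite_slots
  have "card (torso `` ?L - X) \<le> card {r \<in> slots X. m r \<in> ?L}" by simp
  then show c: "card (bd ?L) = flow_val X m"
    using flow_inside[OF m v X(1)] card_torso_side[OF v X(1)] flow_le(1)[OF m v X(1)] by simp
  show "best X ?L" unfolding best_def
  proof (intro conjI v allI impI)
    fix L' assume L': "valid X L'"
    show "card (bd ?L) \<le> card (bd L')" using c flow_le(1)[OF m L' X(1)] by simp
    assume "card (bd L') = card (bd ?L)"
    then have "{r \<in> slots X. m r \<in> L'} = torso `` L' - X"
      using c flow_le(2)[OF m L' X(1)] by simp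
    then have "L' \<inter> Q = {}" using aug_path_leaves[OF _ L'] path by blast
    then show "L' \<subseteq> ?L" using L' by (auto simp: valid_def slots_def)
  qed
qed

end

section \<open>Absorption rounds over an abstract cut procedure\<close>

lemma (in cut_graph) best_grow:
  assumes "best X L" "best (X \<union> Y) L'" "Y \<subseteq> bd L" "Y \<noteq> {}"
  shows "card (bd L) < card (bd L')"
proof -
  have v: "valid (X \<union> Y) L'" using assms(2) by (simp add: best_def)
  \<comment> \<open>The vertices of \<open>Y\<close> are deletable, so validity for the enlarged
    source set implies validity for \<open>X\<close>. Since \<open>L'\<close> contains vertices of
    \<open>bd L\<close>, it is not inside the furthest minimiser \<open>L\<close>.\<close>
  have "valid X L'" using v assms(3) bd_sub[of L] unfolding valid_def by blast
  then have "card (bd L) \<le> card (bd L')" "card (bd L') = card (bd L) \<Longrightarrow> L' \<subseteq> L"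
    using assms(1) by (simp_all add: best_def)
  moreover have "\<not> L' \<subseteq> L" using v assms(3,4) unfolding valid_def bd_def by blast
  ultimately show ?thesis by linarith
qed

text \<open>All that the analysis of the rounds has to know about the computation of cuts: a
  rejection certifies that every cut exceeds \<open>p\<close>, and otherwise a furthest minimum cut
  is returned. The list program is plugged in later.\<close>

locale cut_rounds = cut_graph +
  fixes p :: nat and rej :: "'a set \<Rightarrow> bool" and C :: "'a set \<Rightarrow> 'a set"
  assumes rej: "X \<subseteq> V - T \<Longrightarrow> rej X \<Longrightarrow> valid X L \<Longrightarrow> p < card (bd L)"
    and cut: "X \<subseteq> V - T \<Longrightarrow> \<not> rej X \<Longrightarrow> \<exists>L. best X L \<and> C X = bd L \<and> card (bd L) \<le> p"
begin

definition absorb :: "'a set \<Rightarrow> 'a set \<Rightarrow> 'a set"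
  where "absorb R X = (if rej X then X else X \<union> (C X - R))"

definition accepts :: "'a set \<Rightarrow> 'a \<Rightarrow> bool"
  where "accepts R v \<longleftrightarrow> (let X = (absorb R ^^ Suc p) {v} in \<not> rej X \<and> C X \<subseteq> R)"

text \<open>As long as the cut is not inside \<open>R\<close>, each round enlarges it by
  \<open>best_grow\<close>. After \<open>p + 1\<close> rounds it would exceed \<open>p\<close>, but
  sets between \<open>v\<close> and \<open>side v S\<close> are never rejected.\<close>

lemma accepts_important:
  assumes imp: "important v S" and S: "S \<subseteq> R" "card S \<le> p"
  shows "accepts R v"
proof -
  have sep: "sep v S" using imp by (simp add: important_def)
  have sub: "side v S \<subseteq> V - T"
    using side_reach[of v S] reach_sub[of _ S v] sep by (auto simp: sep_def)
  \<comment> \<open>For each such \<open>X\<close>, \<open>side v S\<close> is a valid set whose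
    boundary has at most \<open>p\<close> vertices.\<close>
  have nrej: "\<not> rej X" if X: "v \<in> X" "X \<subseteq> side v S" for X
  proof
    assume "rej X"
    moreover have "valid X (side v S)"
      using sep_side(1)[OF sep] X unfolding valid_def by auto
    ultimately have "p < card (bd (side v S))" using rej[of X] X sub by blast
    moreover have "finite S" using sep fin by (auto simp: sep_def intro: finite_subset)
    ultimately show False using card_mono[OF _ sep_side(2)[OF sep]] S(2) by simp
  qed
  have "v \<in> (absorb R ^^ i) {v} \<and> (absorb R ^^ i) {v} \<subseteq> side v S \<and>
      (i \<le> card (C ((absorb R ^^ i) {v})) \<or> C ((absorb R ^^ i) {v}) \<subseteq> R)" for i
  proof (induction i)
    case 0 then show ?case by (simp add: side_def)
  next
    case (Suc i)
    define X where "X = (absorb R ^^ i) {v}"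
    have X: "v \<in> X" "X \<subseteq> side v S" "i \<le> card (C X) \<or> C X \<subseteq> R"
      using Suc by (auto simp: X_def)
    obtain L where L: "best X L" "C X = bd L" using cut[of X] nrej X sub by blast
    have a: "absorb R X = X \<union> (C X - R)" using nrej X by (simp add: absorb_def)
    \<comment> \<open>The cut lies in \<open>side v S\<close> together with \<open>S\<close>, and
      \<open>S\<close> is contained in \<open>R\<close>, so only vertices of \<open>side v S\<close>
      are absorbed.\<close>
    have aX: "v \<in> absorb R X" "absorb R X \<subseteq> side v S"
      using important_push(1)[OF imp X(1,2) L(1)] S X(1,2) unfolding a L(2) by blast+
    have "Suc i \<le> card (C (absorb R X)) \<or> C (absorb R X) \<subseteq> R"
    proof (cases "C X \<subseteq> R")
      case True
      then have "absorb R X = X" using a by auto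
      then show ?thesis using True by simp
    next
      case False
      obtain L' where L': "best (absorb R X) L'" "C (absorb R X) = bd L'"
        using cut[of "absorb R X"] nrej aX sub by blast
      have "card (bd L) < card (bd L')"
        using best_grow[of X L "C X - R" L'] L(1) L'(1) False unfolding a L(2) by blast
      then show ?thesis using X(3) False L(2) L'(2) by simp
    qed
    then show ?case using aX unfolding X_def funpow.simps o_apply by blast
  qed
  note run = this[of "Suc p"]
  define X where "X = (absorb R ^^ Suc p) {v}"
  have X: "v \<in> X" "X \<subseteq> side v S" "Suc p \<le> card (C X) \<or> C X \<subseteq> R"
    using run unfolding X_def by blast+
  have r: "\<not> rej X" using nrej X by blast
  then obtain L where "C X = bd L" "card (bd L) \<le> p" using cut[of X] X(2) sub by blast
  then have "C X \<subseteq> R" using X(3) by simp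
  then show ?thesis using r unfolding accepts_def Let_def X_def by blast
qed

text \<open>The coins that must show tails if the run at \<open>s\<close> is to look as though
  \<open>R\<close> were \<open>S\<close>. Besides the cuts of the \<open>p + 1\<close> rounds there
  is the final one, which gives the factor \<open>p + 2\<close> in
  \<open>card_guard\<close>.\<close>

definition guard :: "'a set \<Rightarrow> 'a \<Rightarrow> 'a set"
  where "guard S s = (\<Union>i\<in>{i. i \<le> Suc p \<and> \<not> rej ((absorb S ^^ i) {s})}. C ((absorb S ^^ i) {s}) - S)"

lemma absorb_sub: "X \<subseteq> V - T \<Longrightarrow> absorb R X \<subseteq> V - T"
proof -
  assume X: "X \<subseteq> V - T"
  show ?thesis
  proof (cases "rej X")
    case False
    then obtain L where "C X = bd L" using cut[OF X] by blast
    then show ?thesis using X False bd_sub[of L] trm by (auto simp: absorb_def)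
  qed (use X in \<open>simp add: absorb_def\<close>)
qed

lemma run_sub: "s \<in> V - T \<Longrightarrow> (absorb R ^^ i) {s} \<subseteq> V - T"
  by (induction i) (simp_all add: absorb_sub)

lemma card_guard:
  assumes "s \<in> V - T"
  shows "card (guard S s) \<le> (p + 2) * p"
proof -
  let ?I = "{i. i \<le> Suc p \<and> \<not> rej ((absorb S ^^ i) {s})}"
  have "card (guard S s) \<le> (\<Sum>i\<in>?I. card (C ((absorb S ^^ i) {s}) - S))"
    unfolding guard_def by (rule card_UN_le) simp
  also have "\<dots> \<le> (\<Sum>i\<in>?I. p)"
  proof (rule sum_mono)
    fix i assume "i \<in> ?I"
    then obtain L where "C ((absorb S ^^ i) {s}) = bd L" "card (bd L) \<le> p"
      using cut[OF run_sub[OF assms, where R=S and i=i]] by blast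
    then show "card (C ((absorb S ^^ i) {s}) - S) \<le> p"
      by (metis card_mono Diff_subset finite_bd order_trans)
  qed
  also have "\<dots> = card ?I * p" by simp
  also have "\<dots> \<le> card {..Suc p} * p" by (intro mult_right_mono card_mono) auto
  finally show ?thesis by simp
qed

lemma guard_sub: "s \<in> V - T \<Longrightarrow> guard S s \<subseteq> V - U - S"
proof -
  assume s: "s \<in> V - T"
  have "C ((absorb S ^^ i) {s}) \<subseteq> V - U" if "\<not> rej ((absorb S ^^ i) {s})" for i
    using cut[OF run_sub[OF s] that] bd_sub by auto
  then show ?thesis unfolding guard_def by blast
qed

text \<open>Cuts contain deletable vertices only, so \<open>R\<close> need not contain more of
  \<open>S\<close> than \<open>S - U\<close>; a thin set can consist of one undeletable vertex. The
  final cut misses \<open>s\<close> because it separates \<open>s\<close> from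
  \<open>T\<close>.\<close>

lemma accepts_guard:
  assumes s: "s \<in> V - T" and T: "T \<noteq> {}"
    and R: "S - U \<subseteq> R" "R \<inter> guard S s = {}" and acc: "accepts R s"
  shows "\<exists>C. C \<subseteq> S - {s} \<and> sep s C"
proof -
  have C: "C ((absorb S ^^ i) {s}) \<inter> R \<subseteq> S \<and> C ((absorb S ^^ i) {s}) - R = C ((absorb S ^^ i) {s}) - S"
    if i: "i \<le> Suc p" "\<not> rej ((absorb S ^^ i) {s})" for i
  proof -
    have "C ((absorb S ^^ i) {s}) - S \<subseteq> guard S s" unfolding guard_def using i by blast
    moreover obtain L where "C ((absorb S ^^ i) {s}) = bd L"
      using cut[OF run_sub[OF s, where R=S and i=i]] i by blast
    ultimately show ?thesis using R bd_sub[of L] by auto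
  qed
  have run: "i \<le> Suc p \<Longrightarrow> (absorb R ^^ i) {s} = (absorb S ^^ i) {s}" for i
  proof (induction i)
    case (Suc i)
    then show ?case using C[of i] by (cases "rej ((absorb S ^^ i) {s})") (simp_all add: absorb_def[of R "(absorb S ^^ i) {s}"] absorb_def[of S "(absorb S ^^ i) {s}"])
  qed simp
  let ?X = "(absorb S ^^ Suc p) {s}"
  have X: "\<not> rej ?X" "C ?X \<subseteq> R"
    using acc run[of "Suc p"] unfolding accepts_def Let_def by auto
  have V: "?X \<subseteq> V - T" by (rule run_sub[OF s])
  obtain L where L: "best ?X L" "C ?X = bd L" using cut[OF V X(1)] by blast
  have "s \<in> (absorb S ^^ i) {s}" for i
    by (induction i) (auto simp: absorb_def)
  then have "s \<in> ?X" .
  have "sep s (bd L)"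
    using L(1) V T \<open>s \<in> ?X\<close> by (intro valid_sep[of ?X]) (auto simp: best_def)
  moreover have "bd L \<subseteq> S - {s}"
    using C[of "Suc p"] X L(2) \<open>sep s (bd L)\<close> by (auto simp: sep_def)
  ultimately show ?thesis by blast
qed

end

section \<open>Subroutines of the machine\<close>

text \<open>A computation whose effect does not depend on coins. Quantifying over the remaining
  stack \<open>cs\<close> and the remaining time \<open>u\<close> allows it to be used inside a
  randomized program.\<close>

definition exec :: "com \<Rightarrow> store \<Rightarrow> nat \<Rightarrow> store \<Rightarrow> bool"
  where "exec c s t s' \<longleftrightarrow> (\<forall>cs u. run (t + u) (c # cs, s) = run u (cs, s'))"

lemma exec_Assign: "exec (Assign x e) s 1 (s(x := eval_expr e s))"
  by (simp add: exec_def bind_return_pmf)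

lemma exec_Seq:
  assumes "exec c s t s'" "exec d s' t' s''"
  shows "exec (Seq c d) s (1 + t + t') s''"
  using assms by (simp add: exec_def bind_return_pmf add.assoc)

lemma exec_Cond:
  assumes "exec (if s x \<noteq> Leaf then c else d) s t s'"
  shows "exec (Cond x c d) s (1 + t) s'"
  using assms by (simp add: exec_def bind_return_pmf)

lemma exec_While_Leaf: "s x = Leaf \<Longrightarrow> exec (While x c) s 1 s"
  by (simp add: exec_def bind_return_pmf)

lemma exec_While_step:
  assumes "s x \<noteq> Leaf" "exec c s t s'" "exec (While x c) s' t' s''"
  shows "exec (While x c) s (1 + t + t') s''"
  using assms by (simp add: exec_def bind_return_pmf add.assoc)

text \<open>
  A subroutine is compiled relative to the first free variable \<open>k\<close>, which carries argument and
  result; the variables below \<open>k\<close> are preserved and those above are scratch.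
\<close>

definition computes :: "(nat \<Rightarrow> com) \<Rightarrow> tree \<Rightarrow> tree \<Rightarrow> nat \<Rightarrow> bool"
  where "computes F x y t \<longleftrightarrow> (\<forall>k s. s k = x \<longrightarrow>
    (\<exists>s' u. u \<le> t \<and> exec (F k) s u s' \<and> s' k = y \<and> (\<forall>j<k. s' j = s j)))"

lemma computesD:
  assumes "computes F x y t" "s k = x"
  shows "\<exists>s' u. u \<le> t \<and> exec (F k) s u s' \<and> s' k = y \<and> (\<forall>j<k. s' j = s j)"
  using assms unfolding computes_def by blast

lemma computes_mono: "computes F x y t \<Longrightarrow> t \<le> t' \<Longrightarrow> computes F x y t'"
  unfolding computes_def by (metis order_trans)

lemma computes_Assign:
  assumes "\<And>k s. s k = x \<Longrightarrow> eval_expr (e k) s = y"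
  shows "computes (\<lambda>k. Assign k (e k)) x y 1"
  unfolding computes_def
proof (intro allI impI exI conjI)
  fix k and s :: store assume "s k = x"
  show "exec (Assign k (e k)) s 1 (s(k := eval_expr (e k) s))" by (rule exec_Assign)
qed (use assms in auto)

lemma computes_Seq:
  assumes "computes F x y t" "computes G y z u"
  shows "computes (\<lambda>k. Seq (F k) (G k)) x z (1 + t + u)"
  unfolding computes_def
proof (intro allI impI)
  fix k and s :: store assume s: "s k = x"
  obtain s1 t1 where 1: "t1 \<le> t" "exec (F k) s t1 s1" "s1 k = y" "\<forall>j<k. s1 j = s j"
    using computesD[OF assms(1), of s k, OF s] by (elim exE conjE) (rule that)
  obtain s2 t2 where 2: "t2 \<le> u" "exec (G k) s1 t2 s2" "s2 k = z" "\<forall>j<k. s2 j = s1 j"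
    using computesD[OF assms(2), of s1 k, OF 1(3)] by (elim exE conjE) (rule that)
  show "\<exists>s' v. v \<le> 1 + t + u \<and> exec (Seq (F k) (G k)) s v s' \<and> s' k = z \<and> (\<forall>j<k. s' j = s j)"
    using exec_Seq[OF 1(2) 2(2)] 1 2 by (intro exI[of _ s2] exI[of _ "1 + t1 + t2"]) auto
qed

text \<open>Running \<open>F\<close> in the higher frame \<open>k + i\<close> keeps the argument in
  \<open>k\<close>, so several results can be collected in successive frames.\<close>

definition call :: "(nat \<Rightarrow> com) \<Rightarrow> nat \<Rightarrow> nat \<Rightarrow> com"
  where "call F i k = Seq (Assign (k + i) (Var k)) (F (k + i))"

lemma exec_call:
  assumes "computes F x y t" "s k = x" "0 < i"
  shows "\<exists>s' u. u \<le> t + 2 \<and> exec (call F i k) s u s' \<and> s' (k + i) = y \<and> (\<forall>j<k + i. s' j = s j)"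
proof -
  let ?s = "s(k + i := x)"
  have "?s (k + i) = x" by simp
  from computesD[OF assms(1), of ?s "k + i", OF this]
  obtain s' u where 1: "u \<le> t" "exec (F (k + i)) ?s u s'" "s' (k + i) = y" "\<forall>j<k + i. s' j = ?s j"
    by (elim exE conjE) (rule that)
  have "exec (call F i k) s (1 + 1 + u) s'"
    unfolding call_def
    by (rule exec_Seq[OF _ 1(2)]) (use exec_Assign[of "k + i" "Var k" s] assms(2) in simp)
  moreover have "\<forall>j<k + i. s' j = s j" using 1(4) by simp
  moreover have "1 + 1 + u \<le> t + 2" using 1(1) by simp
  ultimately show ?thesis using 1(3) by blast
qed

lemma computes_Branch:
  assumes "computes F x y t" "computes G x z u"
  shows "computes (\<lambda>k. Seq (call F 1 k) (Seq (call G 2 k) (Assign k (BranchE (Var (k + 1)) (Var (k + 2))))))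
    x (Branch y z) (t + u + 7)"
  unfolding computes_def
proof (intro allI impI)
  fix k and s :: store assume s: "s k = x"
  obtain s1 t1 where 1: "t1 \<le> t + 2" "exec (call F 1 k) s t1 s1" "s1 (k + 1) = y"
    "\<forall>j<k + 1. s1 j = s j"
    using exec_call[OF assms(1), of s k 1, OF s zero_less_one] by (elim exE conjE) (rule that)
  have s1: "s1 k = x" using 1(4) s by simp
  obtain s2 t2 where 2: "t2 \<le> u + 2" "exec (call G 2 k) s1 t2 s2" "s2 (k + 2) = z"
    "\<forall>j<k + 2. s2 j = s1 j"
    using exec_call[OF assms(2), of s1 k 2, OF s1 zero_less_numeral] by (elim exE conjE) (rule that)
  let ?s = "s2(k := Branch (s2 (k + 1)) (s2 (k + 2)))"
  have "exec (Seq (call F 1 k) (Seq (call G 2 k) (Assign k (BranchE (Var (k + 1)) (Var (k + 2))))))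
      s (1 + t1 + (1 + t2 + 1)) ?s"
    using exec_Assign[of k "BranchE (Var (k + 1)) (Var (k + 2))" s2]
    by (intro exec_Seq[OF 1(2)] exec_Seq[OF 2(2)]) simp
  then show "\<exists>s' v. v \<le> t + u + 7 \<and> exec (Seq (call F 1 k) (Seq (call G 2 k)
      (Assign k (BranchE (Var (k + 1)) (Var (k + 2)))))) s v s' \<and> s' k = Branch y z \<and> (\<forall>j<k. s' j = s j)"
    using 1 2 by (intro exI[of _ ?s] exI[of _ "1 + t1 + (1 + t2 + 1)"]) auto
qed

lemma computes_Cond:
  assumes "computes B x b t" "computes (if b \<noteq> Leaf then F else G) x y u"
  shows "computes (\<lambda>k. Seq (call B 1 k) (Cond (k + 1) (F k) (G k))) x y (t + u + 4)"
  unfolding computes_def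
proof (intro allI impI)
  fix k and s :: store assume s: "s k = x"
  obtain s1 t1 where 1: "t1 \<le> t + 2" "exec (call B 1 k) s t1 s1" "s1 (k + 1) = b"
    "\<forall>j<k + 1. s1 j = s j"
    using exec_call[OF assms(1), of s k 1, OF s zero_less_one] by (elim exE conjE) (rule that)
  have s1: "s1 k = x" using 1(4) s by simp
  obtain s2 t2 where 2: "t2 \<le> u" "exec ((if b \<noteq> Leaf then F else G) k) s1 t2 s2" "s2 k = y"
    "\<forall>j<k. s2 j = s1 j"
    using computesD[OF assms(2), of s1 k, OF s1] by (elim exE conjE) (rule that)
  have "exec (Cond (k + 1) (F k) (G k)) s1 (1 + t2) s2"
    using 2(2) 1(3) by (intro exec_Cond) (auto split: if_splits)
  from exec_Seq[OF 1(2) this]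
  show "\<exists>s' v. v \<le> t + u + 4 \<and> exec (Seq (call B 1 k) (Cond (k + 1) (F k) (G k))) s v s' \<and> s' k = y \<and> (\<forall>j<k. s' j = s j)"
    using 1 2 by (intro exI[of _ s2] exI[of _ "1 + t1 + (1 + t2)"]) auto
qed

text \<open>Frame layout: \<open>k\<close> holds a fixed context, \<open>k + 1\<close> the
  accumulator, \<open>k + 2\<close> the rest of the list; \<open>k + 3\<close> is the frame of the
  subroutine, which receives context, accumulator and head as nested pairs.\<close>

definition fold_body :: "(nat \<Rightarrow> com) \<Rightarrow> nat \<Rightarrow> com"
  where "fold_body F k =
    Seq (Assign (k + 3) (BranchE (Var k) (BranchE (Var (k + 1)) (LeftE (Var (k + 2))))))
    (Seq (F (k + 3)) (Seq (Assign (k + 1) (Var (k + 3))) (Assign (k + 2) (RightE (Var (k + 2))))))"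

text \<open>The subroutine has to be correct only on accumulators that occur, the folds over
  prefixes of \<open>xs\<close>. The overhead 7 per element is the loop test, three sequencing steps
  and three assignments.\<close>

lemma exec_fold:
  assumes "\<And>i. i < length xs \<Longrightarrow>
      computes F (Branch x (Branch (ca (foldl h a (take i xs))) (cx (xs ! i)))) (ca (h (foldl h a (take i xs)) (xs ! i))) t"
    and "s k = x" "s (k + 1) = ca a" "s (k + 2) = enc_list (map cx xs)"
  shows "\<exists>s' u. u \<le> length xs * (t + 7) + 1 \<and> exec (While (k + 2) (fold_body F k)) s u s' \<and>
    s' (k + 1) = ca (foldl h a xs) \<and> (\<forall>j\<le>k. s' j = s j)"
  using assms
proof (induction xs arbitrary: s a)
  case Nil
  then show ?case
    using exec_While_Leaf[of s "k + 2" "fold_body F k"]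
    by (intro exI[of _ s] exI[of _ 1]) (auto simp: enc_list_def)
next
  case (Cons y ys)
  let ?s1 = "s(k + 3 := Branch x (Branch (ca a) (cx y)))"
  have e1: "exec (Assign (k + 3) (BranchE (Var k) (BranchE (Var (k + 1)) (LeftE (Var (k + 2)))))) s 1 ?s1"
    using exec_Assign[of "k + 3" "BranchE (Var k) (BranchE (Var (k + 1)) (LeftE (Var (k + 2))))" s] Cons.prems
    by (simp add: enc_list_def)
  have c: "computes F (Branch x (Branch (ca a) (cx y))) (ca (h a y)) t" using Cons.prems(1)[of 0] by simp
  have "?s1 (k + 3) = Branch x (Branch (ca a) (cx y))" by simp
  with c have "\<exists>s' u. u \<le> t \<and> exec (F (k + 3)) ?s1 u s' \<and> s' (k + 3) = ca (h a y) \<and> (\<forall>j<k + 3. s' j = ?s1 j)"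
    unfolding computes_def by blast
  then obtain s2 u where 2: "u \<le> t" "exec (F (k + 3)) ?s1 u s2" "s2 (k + 3) = ca (h a y)"
      "\<forall>j<k + 3. s2 j = ?s1 j"
    by blast
  let ?s3 = "s2(k + 1 := ca (h a y))"
  let ?s4 = "?s3(k + 2 := enc_list (map cx ys))"
  have e3: "exec (Assign (k + 1) (Var (k + 3))) s2 1 ?s3"
    using exec_Assign[of "k + 1" "Var (k + 3)" s2] 2 by simp
  have e4: "exec (Assign (k + 2) (RightE (Var (k + 2)))) ?s3 1 ?s4"
    using exec_Assign[of "k + 2" "RightE (Var (k + 2))" ?s3] 2 Cons.prems by (simp add: enc_list_def)
  have body: "exec (fold_body F k) s (1 + 1 + (1 + u + (1 + 1 + 1))) ?s4"
    unfolding fold_body_def by (intro exec_Seq[OF e1] exec_Seq[OF 2(2)] exec_Seq[OF e3] e4)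
  have "\<exists>s' v. v \<le> length ys * (t + 7) + 1 \<and> exec (While (k + 2) (fold_body F k)) ?s4 v s' \<and>
    s' (k + 1) = ca (foldl h (h a y) ys) \<and> (\<forall>j\<le>k. s' j = ?s4 j)"
  proof (rule Cons.IH)
    fix i assume "i < length ys"
    then show "computes F (Branch x (Branch (ca (foldl h (h a y) (take i ys))) (cx (ys ! i))))
        (ca (h (foldl h (h a y) (take i ys)) (ys ! i))) t"
      using Cons.prems(1)[of "Suc i"] by simp
  qed (use 2 Cons.prems in auto)
  then obtain s' v where v: "v \<le> length ys * (t + 7) + 1" "exec (While (k + 2) (fold_body F k)) ?s4 v s'"
      "s' (k + 1) = ca (foldl h (h a y) ys)" "\<forall>j\<le>k. s' j = ?s4 j" by auto
  have "exec (While (k + 2) (fold_body F k)) s (1 + (1 + 1 + (1 + u + (1 + 1 + 1))) + v) s'"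
    by (rule exec_While_step[OF _ body v(2)]) (use Cons.prems in \<open>simp add: enc_list_def\<close>)
  moreover have "1 + (1 + 1 + (1 + u + (1 + 1 + 1))) + v \<le> length (y # ys) * (t + 7) + 1"
    using v(1) 2(1) by simp
  moreover have "\<forall>j\<le>k. s' j = s j"
  proof (intro allI impI)
    fix j assume "j \<le> k"
    then show "s' j = s j" using v(4) 2(4) by simp
  qed
  ultimately show ?case using v(3) unfolding foldl_Cons by blast
qed

definition fold_com :: "(nat \<Rightarrow> com) \<Rightarrow> (nat \<Rightarrow> com) \<Rightarrow> (nat \<Rightarrow> com) \<Rightarrow> nat \<Rightarrow> com"
  where "fold_com A L F k = Seq (call A 1 k) (Seq (call L 2 k)
    (Seq (While (k + 2) (fold_body F k)) (Assign k (Var (k + 1)))))"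

lemma computes_fold:
  assumes "computes A x (ca a) ta" "computes L x (enc_list (map cx xs)) tb"
    and "\<And>i. i < length xs \<Longrightarrow>
      computes F (Branch x (Branch (ca (foldl h a (take i xs))) (cx (xs ! i)))) (ca (h (foldl h a (take i xs)) (xs ! i))) t"
  shows "computes (fold_com A L F) x (ca (foldl h a xs)) (ta + tb + length xs * (t + 7) + 9)"
  unfolding computes_def
proof (intro allI impI)
  fix k and s :: store assume s: "s k = x"
  obtain s1 t1 where 1: "t1 \<le> ta + 2" "exec (call A 1 k) s t1 s1" "s1 (k + 1) = ca a"
    "\<forall>j<k + 1. s1 j = s j"
    using exec_call[OF assms(1), of s k 1, OF s zero_less_one] by (elim exE conjE) (rule that)
  have s1: "s1 k = x" using 1(4) s by simp
  obtain s2 t2 where 2: "t2 \<le> tb + 2" "exec (call L 2 k) s1 t2 s2" "s2 (k + 2) = enc_list (map cx xs)"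
    "\<forall>j<k + 2. s2 j = s1 j"
    using exec_call[OF assms(2), of s1 k 2, OF s1 zero_less_numeral] by (elim exE conjE) (rule that)
  have s2: "s2 k = x" "s2 (k + 1) = ca a" using 1(3) 2(4) s1 by simp_all
  have "\<exists>s' u. u \<le> length xs * (t + 7) + 1 \<and> exec (While (k + 2) (fold_body F k)) s2 u s' \<and>
    s' (k + 1) = ca (foldl h a xs) \<and> (\<forall>j\<le>k. s' j = s2 j)"
    using assms(3) s2 2(3) by (rule exec_fold[where ca = ca and cx = cx and h = h and a = a and xs = xs])
  then obtain s3 t3 where 3: "t3 \<le> length xs * (t + 7) + 1" "exec (While (k + 2) (fold_body F k)) s2 t3 s3"
    "s3 (k + 1) = ca (foldl h a xs)" "\<forall>j\<le>k. s3 j = s2 j" by blast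
  let ?s = "s3(k := ca (foldl h a xs))"
  have "exec (Assign k (Var (k + 1))) s3 1 ?s" using exec_Assign[of k "Var (k + 1)" s3] 3 by simp
  then have "exec (fold_com A L F k) s (1 + t1 + (1 + t2 + (1 + t3 + 1))) ?s"
    unfolding fold_com_def by (intro exec_Seq[OF 1(2)] exec_Seq[OF 2(2)] exec_Seq[OF 3(2)])
  moreover have "1 + t1 + (1 + t2 + (1 + t3 + 1)) \<le> ta + tb + length xs * (t + 7) + 9"
    using 1(1) 2(1) 3(1) by linarith
  moreover have "\<forall>j<k. ?s j = s j"
  proof (intro allI impI)
    fix j assume "j < k"
    then show "?s j = s j" using 1(4) 2(4) 3(4) by simp
  qed
  ultimately show "\<exists>s' v. v \<le> ta + tb + length xs * (t + 7) + 9 \<and> exec (fold_com A L F k) s v s' \<and>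
      s' k = ca (foldl h a xs) \<and> (\<forall>j<k. s' j = s j)"
    by (metis fun_upd_same)
qed

section \<open>Polynomial time\<close>

class encodable = fixes tree_of :: "'a \<Rightarrow> tree"

instantiation unit :: encodable
begin
definition "tree_of (u :: unit) = Leaf"
instance ..
end

instantiation bool :: encodable
begin
definition "tree_of b = enc_bool b"
instance ..
end

instantiation nat :: encodable
begin
definition "tree_of n = enc_nat n"
instance ..
end

instantiation list :: (encodable) encodable
begin
definition "tree_of xs = enc_list (map tree_of xs)"
instance ..
end

instantiation prod :: (encodable, encodable) encodable
begin
definition "tree_of x = Branch (tree_of (fst x)) (tree_of (snd x))"
instance ..
end

lemma tree_of_simps [simp]:
  "tree_of (x, y) = Branch (tree_of x) (tree_of y)"
  "tree_of (Nil :: 'a :: encodable list) = Leaf"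
  "tree_of (z # zs) = Branch (tree_of z) (tree_of (zs :: 'a :: encodable list))"
  "tree_of (0 :: nat) = Leaf"
  "tree_of (Suc n) = Branch Leaf (tree_of n)"
  "tree_of True = Branch Leaf Leaf"
  "tree_of False = Leaf"
  by (simp_all add: tree_of_prod_def tree_of_list_def tree_of_nat_def tree_of_bool_def
      enc_list_def enc_nat_def enc_bool_def)

text \<open>A unary number and a list of units are the same tree, so a counted loop is a fold and
  needs no conversion.\<close>

lemma tree_of_replicate: "tree_of (replicate n ()) = tree_of n"
  by (simp add: tree_of_list_def tree_of_nat_def enc_nat_def tree_of_unit_def)

definition poly_bounded :: "(nat \<Rightarrow> nat) \<Rightarrow> bool"
  where "poly_bounded t \<longleftrightarrow> (\<exists>K d. \<forall>N. t N \<le> K * (N + 1) ^ d)"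

lemma poly_bounded_const: "poly_bounded (\<lambda>_. k)"
  unfolding poly_bounded_def by (intro exI[of _ k] exI[of _ 0]) simp

lemma poly_bounded_Suc: "poly_bounded Suc"
  unfolding poly_bounded_def by (intro exI[of _ 1]) simp

lemma poly_bounded_add:
  assumes "poly_bounded t" "poly_bounded u"
  shows "poly_bounded (\<lambda>N. t N + u N)"
proof -
  obtain K d L e where b: "\<And>N. t N \<le> K * (N + 1) ^ d" "\<And>N. u N \<le> L * (N + 1) ^ e"
    using assms unfolding poly_bounded_def by blast
  have "t N + u N \<le> (K + L) * (N + 1) ^ (d + e)" for N
  proof -
    have "(N + 1) ^ d \<le> (N + 1) ^ (d + e)" "(N + 1) ^ e \<le> (N + 1) ^ (d + e)"
      by (intro power_increasing; simp)+
    then have "K * (N + 1) ^ d + L * (N + 1) ^ e \<le> (K + L) * (N + 1) ^ (d + e)"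
      unfolding add_mult_distrib by (intro add_mono mult_left_mono) auto
    then show ?thesis using b[of N] by linarith
  qed
  then show ?thesis unfolding poly_bounded_def by blast
qed

lemma poly_bounded_mult:
  assumes "poly_bounded t" "poly_bounded u"
  shows "poly_bounded (\<lambda>N. t N * u N)"
proof -
  obtain K d L e where b: "\<And>N. t N \<le> K * (N + 1) ^ d" "\<And>N. u N \<le> L * (N + 1) ^ e"
    using assms unfolding poly_bounded_def by blast
  have "t N * u N \<le> (K * L) * (N + 1) ^ (d + e)" for N
    using mult_mono[OF b(1)[of N] b(2)[of N]] by (simp add: power_add mult_ac)
  then show ?thesis unfolding poly_bounded_def by blast
qed

lemmas poly_bounded_intros = poly_bounded_const poly_bounded_Suc poly_bounded_add poly_bounded_mult

text \<open>\<open>D N\<close> collects the inputs with size parameter \<open>N\<close>. One program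
  serves all \<open>N\<close>, and its time depends on \<open>N\<close> alone, not on the size of
  the input tree. Domains also carry facts about bound variables, such as membership in the list
  being traversed.\<close>

definition ptime :: "(nat \<Rightarrow> 'a :: encodable set) \<Rightarrow> ('a \<Rightarrow> 'b :: encodable) \<Rightarrow> bool"
  where "ptime D f \<longleftrightarrow> (\<exists>F t. poly_bounded t \<and>
    (\<forall>N. \<forall>x\<in>D N. computes F (tree_of x) (tree_of (f x)) (t N)))"

lemma ptimeI:
  assumes "poly_bounded t" "\<And>N x. x \<in> D N \<Longrightarrow> computes F (tree_of x) (tree_of (f x)) (t N)"
  shows "ptime D f"
  using assms unfolding ptime_def by blast

lemma ptimeE:
  assumes "ptime D f"
  shows "\<exists>F t. poly_bounded t \<and> (\<forall>N. \<forall>x\<in>D N. computes F (tree_of x) (tree_of (f x)) (t N))"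
  using assms unfolding ptime_def .

lemma ptime_comp:
  assumes "ptime E g" "ptime D f" "\<And>N x. x \<in> D N \<Longrightarrow> f x \<in> E N"
  shows "ptime D (\<lambda>x. g (f x))"
proof -
  obtain G u where G: "poly_bounded u" "\<forall>N. \<forall>x\<in>E N. computes G (tree_of x) (tree_of (g x)) (u N)"
    using ptimeE[OF assms(1)] by (elim exE conjE) (rule that)
  obtain F t where F: "poly_bounded t" "\<forall>N. \<forall>x\<in>D N. computes F (tree_of x) (tree_of (f x)) (t N)"
    using ptimeE[OF assms(2)] by (elim exE conjE) (rule that)
  show ?thesis
    by (rule ptimeI[where t = "\<lambda>N. 1 + t N + u N"])
      (intro poly_bounded_intros F(1) G(1),
        rule computes_Seq[OF F(2)[rule_format] G(2)[rule_format, OF assms(3)]])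
qed

lemma ptime_expr:
  assumes "\<And>k s x. s k = tree_of x \<Longrightarrow> eval_expr (e k) s = tree_of (f x)"
  shows "ptime D f"
proof (rule ptimeI[OF poly_bounded_const])
  fix N x assume "x \<in> D N"
  show "computes (\<lambda>k. Assign k (e k)) (tree_of x) (tree_of (f x)) 1"
    by (rule computes_Assign) (rule assms)
qed

lemma ptime_expr_comp:
  assumes "ptime D f" "\<And>k s x. s k = tree_of x \<Longrightarrow> eval_expr (e k) s = tree_of (g x)"
  shows "ptime D (\<lambda>x. g (f x))"
  by (rule ptime_comp[of "\<lambda>_. UNIV", OF ptime_expr[OF assms(2)] assms(1)]) simp_all

lemma ptime_id: "ptime D (\<lambda>x. x)"
  by (rule ptime_expr[where e = Var]) simp

lemma ptime_const: "ptime D (\<lambda>x. y)"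
proof -
  have "\<exists>e. \<forall>s. eval_expr e s = t" for t
  proof (induction t)
    case Leaf
    then show ?case by (intro exI[of _ LeafE]) simp
  next
    case (Branch a b)
    then obtain e f where "\<forall>s. eval_expr e s = a" "\<forall>s. eval_expr f s = b" by blast
    then show ?case by (intro exI[of _ "BranchE e f"]) simp
  qed
  then obtain e where "\<And>s. eval_expr e s = tree_of y" by blast
  then show ?thesis by (rule ptime_expr[where e = "\<lambda>_. e"])
qed

lemma ptime_fst: "ptime D f \<Longrightarrow> ptime D (\<lambda>x. fst (f x))"
  by (erule ptime_expr_comp[where e = "\<lambda>k. LeftE (Var k)"]) (simp add: tree_of_prod_def)

lemma ptime_snd: "ptime D f \<Longrightarrow> ptime D (\<lambda>x. snd (f x))"
  by (erule ptime_expr_comp[where e = "\<lambda>k. RightE (Var k)"]) (simp add: tree_of_prod_def)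

text \<open>The convention \<open>right Leaf = Leaf\<close> matches truncated subtraction at
  0.\<close>

lemma ptime_pred: "ptime D f \<Longrightarrow> ptime D (\<lambda>x. f x - Suc 0)"
proof (erule ptime_expr_comp[where e = "\<lambda>k. RightE (Var k)"])
  fix k :: nat and s and n :: nat assume "s k = tree_of n"
  then show "eval_expr (RightE (Var k)) s = tree_of (n - Suc 0)" by (cases n) simp_all
qed

lemma ptime_Suc: "ptime D f \<Longrightarrow> ptime D (\<lambda>x. Suc (f x))"
  by (erule ptime_expr_comp[where e = "\<lambda>k. BranchE LeafE (Var k)"]) simp

lemma ptime_replicate_unit: "ptime D f \<Longrightarrow> ptime D (\<lambda>x. replicate (f x) ())"
  by (erule ptime_expr_comp[where e = Var]) (simp add: tree_of_replicate)

lemma ptime_Pair: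
  assumes "ptime D f" "ptime D g"
  shows "ptime D (\<lambda>x. (f x, g x))"
proof -
  obtain G u where G: "poly_bounded u" "\<forall>N. \<forall>x\<in>D N. computes G (tree_of x) (tree_of (g x)) (u N)"
    using ptimeE[OF assms(2)] by (elim exE conjE) (rule that)
  obtain F t where F: "poly_bounded t" "\<forall>N. \<forall>x\<in>D N. computes F (tree_of x) (tree_of (f x)) (t N)"
    using ptimeE[OF assms(1)] by (elim exE conjE) (rule that)
  have "computes (\<lambda>k. Seq (call F 1 k) (Seq (call G 2 k) (Assign k (BranchE (Var (k + 1)) (Var (k + 2))))))
    (tree_of x) (tree_of (f x, g x)) (t N + u N + 7)" if "x \<in> D N" for N x
    using computes_Branch[OF F(2)[rule_format, OF that] G(2)[rule_format, OF that]] by simp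
  note c = this
  show ?thesis
    by (rule ptimeI[rotated], erule c) (intro poly_bounded_intros F(1) G(1))
qed

text \<open>A nonempty list and the pair of its head and tail have the same encoding.\<close>

lemma ptime_Cons:
  assumes "ptime D f" "ptime D g"
  shows "ptime D (\<lambda>x. f x # g x)"
  using ptime_expr_comp[OF ptime_Pair[OF assms], where e = Var and g = "\<lambda>z. fst z # snd z"]
  by (simp add: tree_of_prod_def)

lemma ptime_if_Leaf:
  assumes "ptime D b" "ptime D f" "ptime D g"
  shows "ptime D (\<lambda>x. if tree_of (b x) \<noteq> Leaf then f x else g x)"
proof -
  obtain B v where B: "poly_bounded v" "\<forall>N. \<forall>x\<in>D N. computes B (tree_of x) (tree_of (b x)) (v N)"
    using ptimeE[OF assms(1)] by (elim exE conjE) (rule that)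
  obtain F t where F: "poly_bounded t" "\<forall>N. \<forall>x\<in>D N. computes F (tree_of x) (tree_of (f x)) (t N)"
    using ptimeE[OF assms(2)] by (elim exE conjE) (rule that)
  obtain G u where G: "poly_bounded u" "\<forall>N. \<forall>x\<in>D N. computes G (tree_of x) (tree_of (g x)) (u N)"
    using ptimeE[OF assms(3)] by (elim exE conjE) (rule that)
  have "computes (\<lambda>k. Seq (call B 1 k) (Cond (k + 1) (F k) (G k))) (tree_of x)
      (tree_of (if tree_of (b x) \<noteq> Leaf then f x else g x)) (v N + (t N + u N) + 4)" if x: "x \<in> D N" for N x
  proof (rule computes_Cond[OF B(2)[rule_format, OF x]])
    show "computes (if tree_of (b x) \<noteq> Leaf then F else G) (tree_of x)
      (tree_of (if tree_of (b x) \<noteq> Leaf then f x else g x)) (t N + u N)"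
      using computes_mono[OF F(2)[rule_format, OF x], of "t N + u N"] computes_mono[OF G(2)[rule_format, OF x], of "t N + u N"] by simp
  qed
  note c = this
  show ?thesis
    by (rule ptimeI[rotated], erule c) (intro poly_bounded_intros F(1) G(1) B(1))
qed

lemma tree_of_bool_Leaf: "tree_of b = Leaf \<longleftrightarrow> \<not> b"
  by (cases b) simp_all

lemma tree_of_list_Leaf: "tree_of (xs :: 'a :: encodable list) = Leaf \<longleftrightarrow> xs = []"
  by (cases xs) simp_all

lemma tree_of_nat_Leaf: "tree_of (n :: nat) = Leaf \<longleftrightarrow> n = 0"
  by (cases n) simp_all

lemma ptime_cong: "ptime D g \<Longrightarrow> (\<And>x. f x = g x) \<Longrightarrow> ptime D f"
  by presburger

lemma ptime_if: "ptime D b \<Longrightarrow> ptime D f \<Longrightarrow> ptime D g \<Longrightarrow> ptime D (\<lambda>x. if b x then f x else g x)"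
  by (rule ptime_cong[OF ptime_if_Leaf[of D b f g]]) (simp_all add: tree_of_bool_Leaf)

lemma ptime_not: "ptime D b \<Longrightarrow> ptime D (\<lambda>x. \<not> b x)"
  by (rule ptime_cong[OF ptime_if[of D b "\<lambda>_. False" "\<lambda>_. True"]]) (simp_all add: ptime_const)

lemma ptime_conj: "ptime D a \<Longrightarrow> ptime D b \<Longrightarrow> ptime D (\<lambda>x. a x \<and> b x)"
  by (rule ptime_cong[OF ptime_if[of D a b "\<lambda>_. False"]]) (simp_all add: ptime_const)

lemma ptime_disj: "ptime D a \<Longrightarrow> ptime D b \<Longrightarrow> ptime D (\<lambda>x. a x \<or> b x)"
  by (rule ptime_cong[OF ptime_if[of D a "\<lambda>_. True" b]]) (simp_all add: ptime_const)

lemma ptime_imp: "ptime D a \<Longrightarrow> ptime D b \<Longrightarrow> ptime D (\<lambda>x. a x \<longrightarrow> b x)"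
  by (rule ptime_cong[OF ptime_if[of D a b "\<lambda>_. True"]]) (simp_all add: ptime_const)

lemma ptime_Nil_eq: "ptime D xs \<Longrightarrow> ptime D (\<lambda>x. xs x = [])"
  by (rule ptime_cong[OF ptime_if_Leaf[of D xs "\<lambda>_. False" "\<lambda>_. True"]])
    (simp_all add: ptime_const tree_of_list_Leaf)

lemma ptime_0_eq: "ptime D n \<Longrightarrow> ptime D (\<lambda>x. n x = (0 :: nat))"
  by (rule ptime_cong[OF ptime_if_Leaf[of D n "\<lambda>_. False" "\<lambda>_. True"]])
    (simp_all add: ptime_const tree_of_nat_Leaf)

text \<open>The pair of \<open>x\<close> and a nonempty list \<open>xs x\<close> already encodes the
  triple of \<open>x\<close>, head and tail, so the branch program runs on it directly.\<close>

lemma ptime_case_list: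
  assumes "ptime D xs" "ptime D a"
    and b: "ptime (\<lambda>N. {(x, y, ys) | x y ys. x \<in> D N \<and> xs x = y # ys}) (\<lambda>z. b (fst z) (fst (snd z)) (snd (snd z)))"
  shows "ptime D (\<lambda>x. case xs x of [] \<Rightarrow> a x | y # ys \<Rightarrow> b x y ys)"
proof -
  obtain X v where X: "poly_bounded v" "\<forall>N. \<forall>x\<in>D N. computes X (tree_of x) (tree_of (xs x)) (v N)"
    using ptimeE[OF assms(1)] by (elim exE conjE) (rule that)
  obtain A u where A: "poly_bounded u" "\<forall>N. \<forall>x\<in>D N. computes A (tree_of x) (tree_of (a x)) (u N)"
    using ptimeE[OF assms(2)] by (elim exE conjE) (rule that)
  obtain B t where B: "poly_bounded t"
    "\<forall>N. \<forall>z\<in>{(x, y, ys) | x y ys. x \<in> D N \<and> xs x = y # ys}.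
      computes B (tree_of z) (tree_of (b (fst z) (fst (snd z)) (snd (snd z)))) (t N)"
    using ptimeE[OF b] by (elim exE conjE) (rule that)
  let ?P = "\<lambda>k. Seq (call (\<lambda>k. Assign k (Var k)) 1 k) (Seq (call X 2 k) (Assign k (BranchE (Var (k + 1)) (Var (k + 2)))))"
  let ?F = "\<lambda>k. Seq (?P k) (B k)"
  have "computes (\<lambda>k. Seq (call X 1 k) (Cond (k + 1) (?F k) (A k))) (tree_of x)
      (tree_of (case xs x of [] \<Rightarrow> a x | y # ys \<Rightarrow> b x y ys)) (v N + (1 + (1 + v N + 7) + t N + u N) + 4)"
    if x: "x \<in> D N" for N x
  proof (rule computes_Cond[OF X(2)[rule_format, OF x]])
    have P: "computes ?P (tree_of x) (Branch (tree_of x) (tree_of (xs x))) (1 + v N + 7)"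
      by (intro computes_Branch computes_Assign X(2)[rule_format, OF x]) simp
    show "computes (if tree_of (xs x) \<noteq> Leaf then ?F else A) (tree_of x)
      (tree_of (case xs x of [] \<Rightarrow> a x | y # ys \<Rightarrow> b x y ys)) (1 + (1 + v N + 7) + t N + u N)"
    proof (cases "xs x")
      case Nil
      then show ?thesis using computes_mono[OF A(2)[rule_format, OF x]] by simp
    next
      case (Cons y ys)
      have "computes ?F (tree_of x) (tree_of (b x y ys)) (1 + (1 + v N + 7) + t N)"
        by (rule computes_Seq[OF P]) (use B(2)[rule_format, of "(x, y, ys)" N] x Cons in simp)
      then show ?thesis using Cons computes_mono by simp
    qed
  qed
  note c = this
  show ?thesis
    by (rule ptimeI[rotated], erule c) (intro poly_bounded_intros X(1) A(1) B(1))
qed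

lemma ptime_let:
  assumes "ptime D a" "ptime (\<lambda>N. {(x, y) | x y. x \<in> D N \<and> y = a x}) (\<lambda>z. f (fst z) (snd z))"
  shows "ptime D (\<lambda>x. let y = a x in f x y)"
  using ptime_comp[OF assms(2) ptime_Pair[OF ptime_id assms(1)]] by (simp add: Let_def)

text \<open>The step must run within its time on arbitrary accumulators. The length bound is
  \<open>Suc N\<close> because the absorption loop has \<open>p + 1\<close> rounds.\<close>

lemma ptime_foldl:
  assumes a: "ptime D a" and xs: "ptime D xs" and len: "\<And>N x. x \<in> D N \<Longrightarrow> length (xs x) \<le> Suc N"
    and h: "ptime (\<lambda>N. {(x, acc, y) | x acc y. x \<in> D N \<and> y \<in> set (xs x)})
      (\<lambda>z. h (fst z) (fst (snd z)) (snd (snd z)))"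
  shows "ptime D (\<lambda>x. foldl (h x) (a x) (xs x))"
proof -
  obtain A ta where A: "poly_bounded ta" "\<forall>N. \<forall>x\<in>D N. computes A (tree_of x) (tree_of (a x)) (ta N)"
    using ptimeE[OF a] by (elim exE conjE) (rule that)
  obtain L tb where L: "poly_bounded tb" "\<forall>N. \<forall>x\<in>D N. computes L (tree_of x) (tree_of (xs x)) (tb N)"
    using ptimeE[OF xs] by (elim exE conjE) (rule that)
  obtain F t where F: "poly_bounded t"
    "\<forall>N. \<forall>z\<in>{(x, acc, y) | x acc y. x \<in> D N \<and> y \<in> set (xs x)}.
      computes F (tree_of z) (tree_of (h (fst z) (fst (snd z)) (snd (snd z)))) (t N)"
    using ptimeE[OF h] by (elim exE conjE) (rule that)
  have "computes (fold_com A L F) (tree_of x) (tree_of (foldl (h x) (a x) (xs x)))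
      (ta N + tb N + Suc N * (t N + 7) + 9)" if x: "x \<in> D N" for N x
  proof -
    have "computes L (tree_of x) (enc_list (map tree_of (xs x))) (tb N)"
      using L(2)[rule_format, OF x] by (simp add: tree_of_list_def)
    moreover have "computes F (Branch (tree_of x) (Branch (tree_of acc) (tree_of y)))
        (tree_of (h x acc y)) (t N)" if "y \<in> set (xs x)" for acc y
      using F(2)[rule_format, of "(x, acc, y)" N] x that by simp
    ultimately have "computes (fold_com A L F) (tree_of x) (tree_of (foldl (h x) (a x) (xs x)))
      (ta N + tb N + length (xs x) * (t N + 7) + 9)"
      using computes_fold[where ca = tree_of and cx = tree_of and h = "h x" and a = "a x" and xs = "xs x"
          and A = A and L = L and F = F and x = "tree_of x" and t = "t N" and ta = "ta N" and tb = "tb N",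
          OF A(2)[rule_format, OF x]] nth_mem by blast
    then show ?thesis
    proof (rule computes_mono)
      have "length (xs x) * (t N + 7) \<le> Suc N * (t N + 7)"
        using len[OF x] by (intro mult_right_mono) auto
      then show "ta N + tb N + length (xs x) * (t N + 7) + 9 \<le> ta N + tb N + Suc N * (t N + 7) + 9"
        by linarith
    qed
  qed
  note c = this
  show ?thesis
    by (rule ptimeI[rotated], erule c) (intro poly_bounded_intros A(1) L(1) F(1))
qed

lemmas ptime_base = ptime_id ptime_const ptime_fst ptime_snd ptime_pred ptime_Suc
  ptime_replicate_unit ptime_Pair ptime_Cons ptime_if ptime_not ptime_conj ptime_disj ptime_imp
  ptime_Nil_eq ptime_0_eq ptime_case_list ptime_let ptime_foldl

lemma ptime_rev:
  assumes "ptime D xs" "\<And>N x. x \<in> D N \<Longrightarrow> length (xs x) \<le> Suc N"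
  shows "ptime D (\<lambda>x. rev (xs x))"
proof -
  have "foldl (\<lambda>acc y. y # acc) zs ys = rev ys @ zs" for ys zs :: "'b list"
    by (induction ys arbitrary: zs) simp_all
  then have "rev (xs x) = foldl (\<lambda>acc y. y # acc) [] (xs x)" for x by simp
  moreover have "ptime D (\<lambda>x. foldl (\<lambda>acc y. y # acc) [] (xs x))"
    by (intro ptime_base assms)
  ultimately show ?thesis by simp
qed

lemma ptime_map:
  assumes "ptime D xs" "\<And>N x. x \<in> D N \<Longrightarrow> length (xs x) \<le> Suc N"
    and f: "ptime (\<lambda>N. {(x, y) | x y. x \<in> D N \<and> y \<in> set (xs x)}) (\<lambda>z. f (fst z) (snd z))"
  shows "ptime D (\<lambda>x. map (f x) (xs x))"
proof -
  have len: "length (foldl (\<lambda>acc y. g y # acc) zs ys) = length zs + length ys"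
    and eq: "foldl (\<lambda>acc y. g y # acc) zs ys = rev (map g ys) @ zs" for g :: "'b \<Rightarrow> 'c" and zs ys
    by (induction ys arbitrary: zs) simp_all
  have h: "ptime (\<lambda>N. {(x, acc, y) | x acc y. x \<in> D N \<and> y \<in> set (xs x)})
      (\<lambda>z. f (fst (fst z, snd (snd z))) (snd (fst z, snd (snd z))))"
    by (rule ptime_comp[OF f], intro ptime_base) auto
  then have "ptime (\<lambda>N. {(x, acc, y) | x acc y. x \<in> D N \<and> y \<in> set (xs x)})
      (\<lambda>z. f (fst z) (snd (snd z)))" by simp
  then have "ptime D (\<lambda>x. rev (foldl (\<lambda>acc y. f x y # acc) [] (xs x)))"
    by (intro ptime_rev ptime_base assms(1,2)) (simp_all add: len assms(2))
  moreover have "map (f x) (xs x) = rev (foldl (\<lambda>acc y. f x y # acc) [] (xs x))" for x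
    by (simp add: eq)
  ultimately show ?thesis by simp
qed

lemma ptime_list_ex:
  assumes "ptime D xs" "\<And>N x. x \<in> D N \<Longrightarrow> length (xs x) \<le> Suc N"
    and f: "ptime (\<lambda>N. {(x, y) | x y. x \<in> D N \<and> y \<in> set (xs x)}) (\<lambda>z. f (fst z) (snd z))"
  shows "ptime D (\<lambda>x. list_ex (f x) (xs x))"
proof -
  have eq: "foldl (\<lambda>acc y. acc \<or> y) b ys = (b \<or> list_ex id ys)" for b ys
    by (induction ys arbitrary: b) auto
  have "list_ex (f x) (xs x) = foldl (\<lambda>acc y. acc \<or> y) False (map (f x) (xs x))" for x
    by (simp add: eq list_ex_iff)
  moreover have "ptime D (\<lambda>x. foldl (\<lambda>acc y. acc \<or> y) False (map (f x) (xs x)))"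
    by (intro ptime_base ptime_map assms) (simp_all add: assms(2))
  ultimately show ?thesis by simp
qed

lemma ptime_list_all:
  assumes "ptime D xs" "\<And>N x. x \<in> D N \<Longrightarrow> length (xs x) \<le> Suc N"
    and f: "ptime (\<lambda>N. {(x, y) | x y. x \<in> D N \<and> y \<in> set (xs x)}) (\<lambda>z. f (fst z) (snd z))"
  shows "ptime D (\<lambda>x. list_all (f x) (xs x))"
  by (rule ptime_cong[OF ptime_not[OF ptime_list_ex[OF assms(1,2) ptime_not[OF f]]]])
    (auto simp: list_all_iff list_ex_iff)

lemma ptime_funpow:
  fixes f :: "'a :: encodable \<Rightarrow> 'b :: encodable \<Rightarrow> 'b"
  assumes "ptime D k" "ptime D a" "\<And>N x. x \<in> D N \<Longrightarrow> k x \<le> Suc N"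
    and f: "ptime (\<lambda>N. {(x, y) | x y. x \<in> D N}) (\<lambda>z. f (fst z) (snd z))"
  shows "ptime D (\<lambda>x. (f x ^^ k x) (a x))"
proof -
  have eq: "foldl (\<lambda>acc _. g acc) b (replicate m ()) = (g ^^ m) b" for g :: "'b \<Rightarrow> 'b" and m b
    by (induction m arbitrary: b) (simp_all add: funpow_swap1)
  have "ptime (\<lambda>N. {(x, acc, y) | x acc y. x \<in> D N \<and> y \<in> set (replicate (k x) ())})
      (\<lambda>z. f (fst (fst z, fst (snd z))) (snd (fst z, fst (snd z))))"
    by (rule ptime_comp[OF f], intro ptime_base) auto
  then have "ptime (\<lambda>N. {(x, acc, y) | x acc y. x \<in> D N \<and> y \<in> set (replicate (k x) ())})
      (\<lambda>z. f (fst z) (fst (snd z)))" by simp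
  then have "ptime D (\<lambda>x. foldl (\<lambda>acc _. f x acc) (a x) (replicate (k x) ()))"
    by (intro ptime_foldl ptime_replicate_unit assms(1,2)) (simp_all add: assms(3))
  then show ?thesis by (simp add: eq)
qed

lemma ptime_upt:
  assumes "ptime D n" "\<And>N x. x \<in> D N \<Longrightarrow> n x \<le> Suc N"
  shows "ptime D (\<lambda>x. [0..<n x])"
proof -
  \<comment> \<open>Counting down while adding in front produces the increasing order without a
    reversal.\<close>
  have eq: "m \<le> k \<Longrightarrow> ((\<lambda>s. (fst s - Suc 0, (fst s - Suc 0) # snd s)) ^^ m) (k, []) = (k - m, [k - m..<k])" for k m
  proof (induction m)
    case (Suc m)
    have "[k - Suc m..<k] = (k - Suc m) # [k - m..<k]"
      using Suc.prems by (subst upt_conv_Cons) (auto simp: Suc_diff_Suc)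
    then show ?case using Suc by simp
  qed simp
  have "ptime D (\<lambda>x. snd (((\<lambda>s. (fst s - Suc 0, (fst s - Suc 0) # snd s)) ^^ n x) (n x, [])))"
    by (intro ptime_base ptime_funpow assms)
  then show ?thesis by (simp add: eq)
qed

text \<open>Two truncated subtractions of \<open>j\<close>: the first tests \<open>i <= j\<close>,
  the second \<open>j <= i\<close>. Both loops are bounded by \<open>j\<close>, so \<open>i\<close>
  may be arbitrarily large.\<close>

lemma ptime_nat_eq:
  assumes "ptime D i" "ptime D j" "\<And>N x. x \<in> D N \<Longrightarrow> j x \<le> Suc N"
  shows "ptime D (\<lambda>x. i x = (j x :: nat))"
proof -
  have sub: "((\<lambda>a. a - Suc 0) ^^ k) l = l - k" for k l
    by (induction k) simp_all
  have "ptime D (\<lambda>x. ((\<lambda>a. a - Suc 0) ^^ j x) (i x) = 0 \<and> ((\<lambda>a. a - Suc 0) ^^ j x) (Suc (i x)) \<noteq> 0)"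
    by (intro ptime_base ptime_funpow assms)
  then show ?thesis by (rule ptime_cong) (auto simp: sub)
qed

lemma ptime_length:
  assumes "ptime D xs" "\<And>N x. x \<in> D N \<Longrightarrow> length (xs x) \<le> Suc N"
  shows "ptime D (\<lambda>x. length (xs x))"
proof -
  have eq: "foldl (\<lambda>a _. Suc a) k ys = k + length ys" for k and ys :: "'b list"
    by (induction ys arbitrary: k) simp_all
  have "ptime D (\<lambda>x. foldl (\<lambda>a _. Suc a) 0 (xs x))"
    by (intro ptime_base assms)
  then show ?thesis by (simp add: eq)
qed

text \<open>
  List access gives up after \<open>n\<close> steps.  As all loops of the algorithm run over explicitly bounded
  ranges, running times then depend on these bounds only, and no size invariant is needed for data
  carried through a loop.
\<close>

definition get :: "nat \<Rightarrow> 'a \<Rightarrow> 'a list \<Rightarrow> nat \<Rightarrow> 'a"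
  where "get n d xs i = (if i < n \<and> i < length xs then xs ! i else d)"

lemma ptime_get:
  assumes "ptime D n" "ptime D d" "ptime D xs" "ptime D i" "\<And>N x. x \<in> D N \<Longrightarrow> n x \<le> Suc N"
  shows "ptime D (\<lambda>x. get (n x) (d x) (xs x) (i x))"
proof -
  \<comment> \<open>The state is a countdown, the rest of the list and the answer. The entry is
    taken when the countdown passes from 1 to 0, hence the start at \<open>Suc (i x)\<close>; later
    steps no longer touch the answer.\<close>
  define f :: "nat \<times> 'b list \<times> 'b \<Rightarrow> nat \<times> 'b list \<times> 'b" where
    "f = (\<lambda>s. case fst (snd s) of [] \<Rightarrow> s
      | y # ys \<Rightarrow> (fst s - Suc 0, ys, if fst s \<noteq> 0 \<and> fst s - Suc 0 = 0 then y else snd (snd s)))"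
  have eq: "snd (snd ((f ^^ m) (k, ys, r))) = (if 0 < k \<and> k \<le> m \<and> k \<le> length ys then ys ! (k - 1) else r)"
    for m k ys r
  proof (induction m arbitrary: k ys r)
    case (Suc m)
    have "(f ^^ Suc m) (k, ys, r) = (f ^^ m) (f (k, ys, r))" by (simp add: funpow_swap1)
    then show ?case
      by (cases ys; cases "k = 1") (auto simp: f_def Suc.IH[unfolded f_def] nth_Cons' split: nat.splits)
  qed auto
  have "ptime D (\<lambda>x. snd (snd ((f ^^ n x) (Suc (i x), xs x, d x))))"
    unfolding f_def by (intro ptime_base ptime_funpow assms)
  then show ?thesis by (rule ptime_cong) (auto simp: eq get_def)
qed

section \<open>The algorithm on lists\<close>

definition arc :: "nat \<Rightarrow> bool list list \<Rightarrow> nat \<Rightarrow> nat \<Rightarrow> bool"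
  where "arc n A i j = get n False (get n [] A i) j"

definition hop_step :: "nat \<Rightarrow> bool list list \<Rightarrow> bool list \<Rightarrow> bool list \<Rightarrow> bool list"
  where "hop_step n A U w = map (\<lambda>j. get n False w j \<or>
    list_ex (\<lambda>i. get n False w i \<and> get n False U i \<and> arc n A i j) [0..<n]) [0..<n]"

text \<open>\<open>n\<close> rounds suffice since every round that changes a row adds a vertex to
  it.\<close>

definition hop_table :: "nat \<Rightarrow> bool list list \<Rightarrow> bool list \<Rightarrow> bool list list"
  where "hop_table n A U = map (\<lambda>l. (hop_step n A U ^^ n) (map (\<lambda>j. arc n A l j) [0..<n])) [0..<n]"

definition torso_table :: "nat \<Rightarrow> bool list \<Rightarrow> bool list list \<Rightarrow> bool list list"
  where "torso_table n U H = map (\<lambda>l. map (\<lambda>r. \<not> get n True U r \<and> (l = r \<or> arc n H l r)) [0..<n]) [0..<n]"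

definition exit_list :: "nat \<Rightarrow> bool list \<Rightarrow> bool list list \<Rightarrow> bool list"
  where "exit_list n T H = map (\<lambda>l. list_ex (\<lambda>t. get n False T t \<and> arc n H l t) [0..<n]) [0..<n]"

text \<open>
  A table of augmenting paths holds at most one path per left vertex, as a list of length at
  most one.
\<close>

definition extend_path :: "nat \<Rightarrow> bool list list \<Rightarrow> bool list \<Rightarrow> nat list \<Rightarrow> (nat \<times> nat) list list list \<Rightarrow>
    nat \<Rightarrow> (nat \<times> nat) list list"
  where "extend_path n M X m P l = foldl (\<lambda>acc r. if acc \<noteq> [] then acc else
      if arc n M l r \<and> \<not> get n True X r then
        case get n [] P (get n 0 m r) of [] \<Rightarrow> [] | q # _ \<Rightarrow> [(r, l) # q]
      else []) (get n [] P l) [0..<n]"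

definition sweep :: "nat \<Rightarrow> bool list list \<Rightarrow> bool list \<Rightarrow> nat list \<Rightarrow> (nat \<times> nat) list list list \<Rightarrow>
    (nat \<times> nat) list list list"
  where "sweep n M X m P = map (\<lambda>l. extend_path n M X m P l) [0..<n]"

text \<open>Each sweep extends alternating paths backwards from the exits. A filled entry is never
  overwritten, which keeps the recorded paths simple.\<close>

definition paths :: "nat \<Rightarrow> bool list list \<Rightarrow> bool list \<Rightarrow> bool list \<Rightarrow> nat list \<Rightarrow> (nat \<times> nat) list list list"
  where "paths n M ex X m = (sweep n M X m ^^ n) (map (\<lambda>l. if get n False ex l then [[]] else []) [0..<n])"

definition source_path :: "nat \<Rightarrow> bool list \<Rightarrow> (nat \<times> nat) list list list \<Rightarrow> (nat \<times> nat) list list"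
  where "source_path n X P = foldl (\<lambda>acc x. if acc \<noteq> [] then acc else
    if get n False X x then get n [] P x else []) [] [0..<n]"

definition assign :: "nat \<Rightarrow> nat list \<Rightarrow> nat \<Rightarrow> nat \<Rightarrow> nat list"
  where "assign n m r l = map (\<lambda>j. if r = j then l else get n 0 m j) [0..<n]"

definition shift_step :: "nat \<Rightarrow> nat list \<times> (nat \<times> nat) list \<Rightarrow> nat list \<times> (nat \<times> nat) list"
  where "shift_step n s = (case snd s of [] \<Rightarrow> s | x # q \<Rightarrow> (assign n (fst s) (fst x) (snd x), q))"

definition augment_step :: "nat \<Rightarrow> bool list list \<Rightarrow> bool list \<Rightarrow> bool list \<Rightarrow> nat list \<Rightarrow> nat list"
  where "augment_step n M ex X m = (case source_path n X (paths n M ex X m) of [] \<Rightarrow> m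
    | q # _ \<Rightarrow> fst ((shift_step n ^^ n) (m, q)))"

text \<open>The start \<open>[0..<n]\<close> is the empty flow, with every slot matched to itself.
  No more than \<open>p\<close> augmentations are made: an augmenting path that is left after them
  already shows that all cuts exceed \<open>p\<close>.\<close>

definition max_flow :: "nat \<Rightarrow> bool list list \<Rightarrow> bool list \<Rightarrow> nat \<Rightarrow> bool list \<Rightarrow> nat list"
  where "max_flow n M ex p X = (augment_step n M ex X ^^ p) [0..<n]"

text \<open>The boundary of the set in \<open>flow_best\<close>, with \<open>Q\<close> the vertices
  that have an entry in the table \<open>P\<close>.\<close>

definition cut_list :: "nat \<Rightarrow> bool list \<Rightarrow> bool list list \<Rightarrow> bool list \<Rightarrow> (nat \<times> nat) list list list \<Rightarrow> bool list"
  where "cut_list n U M X P = map (\<lambda>r. \<not> get n True U r \<and> \<not> get n True X r \<and> get n [] P r \<noteq> [] \<and>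
    list_ex (\<lambda>l. (\<not> get n True U l \<or> get n False X l) \<and> get n [] P l = [] \<and> arc n M l r) [0..<n]) [0..<n]"

definition min_cut :: "nat \<Rightarrow> bool list \<Rightarrow> bool list list \<Rightarrow> bool list \<Rightarrow> nat \<Rightarrow> bool list \<Rightarrow> bool \<times> bool list"
  where "min_cut n U M ex p X = (let P = paths n M ex X (max_flow n M ex p X) in
    (source_path n X P \<noteq> [], cut_list n U M X P))"

definition absorb_step :: "nat \<Rightarrow> bool list \<Rightarrow> bool list list \<Rightarrow> bool list \<Rightarrow> nat \<Rightarrow> bool list \<Rightarrow> bool list \<Rightarrow> bool list"
  where "absorb_step n U M ex p R X = (let c = min_cut n U M ex p X in if fst c then X
    else map (\<lambda>r. get n False X r \<or> (get n False (snd c) r \<and> \<not> get n False R r)) [0..<n])"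

definition accept :: "nat \<Rightarrow> bool list \<Rightarrow> bool list list \<Rightarrow> bool list \<Rightarrow> nat \<Rightarrow> bool list \<Rightarrow> nat \<Rightarrow> bool"
  where "accept n U M ex p R v = (let X = (absorb_step n U M ex p R ^^ Suc p) (map (\<lambda>j. v = j) [0..<n]);
      c = min_cut n U M ex p X
    in \<not> fst c \<and> list_all (\<lambda>r. get n False (snd c) r \<longrightarrow> get n False R r) [0..<n])"

text \<open>The final \<open>unit\<close> is the \<open>Leaf\<close> that closes the list in
  \<open>enc_instance\<close>, so the nested pairs encode exactly the given input.\<close>

type_synonym inst = "bool list list \<times> bool list \<times> bool list \<times> nat \<times> unit"

text \<open>An empty \<open>T\<close> is excluded explicitly: the cut would then be empty and every
  vertex accepted, including those of \<open>S\<close>.\<close>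

definition shadow :: "bool list \<times> inst \<Rightarrow> bool list"
  where "shadow = (\<lambda>z. let R = fst z; A = fst (snd z); U = fst (snd (snd z)); T = fst (snd (snd (snd z)));
      p = fst (snd (snd (snd (snd z)))); n = length U; H = hop_table n A U;
      M = torso_table n U H; ex = exit_list n T H
    in map (\<lambda>v. \<not> get n True T v \<and> list_ex (\<lambda>b. get n False T b) [0..<n] \<and> accept n U M ex p R v) [0..<n])"

section \<open>Polynomial running time of the list functions\<close>

lemmas ptime_loops = ptime_base ptime_map ptime_list_ex ptime_list_all ptime_funpow ptime_upt ptime_nat_eq ptime_get

text \<open>Each function is analysed once on the tuple of its arguments and then carried to
  arbitrary argument expressions by \<open>ptime_comp\<close>, so that its callers need not unfold
  it.\<close>

lemma ptime_arc0: "ptime (\<lambda>N. {z. fst z \<le> Suc N})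
    (\<lambda>z. arc (fst z) (fst (snd z)) (fst (snd (snd z))) (snd (snd (snd z))))"
  unfolding arc_def by (intro ptime_base ptime_get) auto

lemma ptime_arc:
  assumes "ptime D n" "ptime D A" "ptime D i" "ptime D j" "\<And>N x. x \<in> D N \<Longrightarrow> n x \<le> Suc N"
  shows "ptime D (\<lambda>x. arc (n x) (A x) (i x) (j x))"
  using ptime_comp[OF ptime_arc0 ptime_Pair[OF assms(1) ptime_Pair[OF assms(2) ptime_Pair[OF assms(3,4)]]]] assms(5)
  by simp

lemma ptime_hop_table0: "ptime (\<lambda>N. {z. fst z \<le> Suc N}) (\<lambda>z. hop_table (fst z) (fst (snd z)) (snd (snd z)))"
  unfolding hop_table_def hop_step_def by (intro ptime_loops ptime_arc) auto

lemma ptime_hop_table: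
  assumes "ptime D n" "ptime D A" "ptime D U" "\<And>N x. x \<in> D N \<Longrightarrow> n x \<le> Suc N"
  shows "ptime D (\<lambda>x. hop_table (n x) (A x) (U x))"
  using ptime_comp[OF ptime_hop_table0 ptime_Pair[OF assms(1) ptime_Pair[OF assms(2,3)]]] assms(4) by simp

lemma ptime_sweep0: "ptime (\<lambda>N. {z. fst z \<le> Suc N})
    (\<lambda>z. sweep (fst z) (fst (snd z)) (fst (snd (snd z))) (fst (snd (snd (snd z)))) (snd (snd (snd (snd z)))))"
  unfolding sweep_def extend_path_def by (intro ptime_loops ptime_arc) auto

lemma ptime_sweep:
  assumes "ptime D n" "ptime D M" "ptime D X" "ptime D m" "ptime D P"
    "\<And>N x. x \<in> D N \<Longrightarrow> n x \<le> Suc N"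
  shows "ptime D (\<lambda>x. sweep (n x) (M x) (X x) (m x) (P x))"
  using ptime_comp[OF ptime_sweep0 ptime_Pair[OF assms(1) ptime_Pair[OF assms(2) ptime_Pair[OF assms(3) ptime_Pair[OF assms(4) assms(5)]]]]] assms(6) by simp

lemma ptime_torso_table0: "ptime (\<lambda>N. {z. fst z \<le> Suc N}) (\<lambda>z. torso_table (fst z) (fst (snd z)) (snd (snd z)))"
  unfolding torso_table_def by (intro ptime_loops ptime_arc) auto

lemma ptime_torso_table:
  assumes "ptime D n" "ptime D U" "ptime D H"
    "\<And>N x. x \<in> D N \<Longrightarrow> n x \<le> Suc N"
  shows "ptime D (\<lambda>x. torso_table (n x) (U x) (H x))"
  using ptime_comp[OF ptime_torso_table0 ptime_Pair[OF assms(1) ptime_Pair[OF assms(2) assms(3)]]] assms(4) by simp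

lemma ptime_exit_list0: "ptime (\<lambda>N. {z. fst z \<le> Suc N}) (\<lambda>z. exit_list (fst z) (fst (snd z)) (snd (snd z)))"
  unfolding exit_list_def by (intro ptime_loops ptime_arc) auto

lemma ptime_exit_list:
  assumes "ptime D n" "ptime D T" "ptime D H"
    "\<And>N x. x \<in> D N \<Longrightarrow> n x \<le> Suc N"
  shows "ptime D (\<lambda>x. exit_list (n x) (T x) (H x))"
  using ptime_comp[OF ptime_exit_list0 ptime_Pair[OF assms(1) ptime_Pair[OF assms(2) assms(3)]]] assms(4) by simp

lemma ptime_paths0: "ptime (\<lambda>N. {z. fst z \<le> Suc N}) (\<lambda>z. paths (fst z) (fst (snd z)) (fst (snd (snd z))) (fst (snd (snd (snd z)))) (snd (snd (snd (snd z)))))"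
  unfolding paths_def by (intro ptime_loops ptime_sweep) auto

lemma ptime_paths:
  assumes "ptime D n" "ptime D M" "ptime D ex" "ptime D X" "ptime D m"
    "\<And>N x. x \<in> D N \<Longrightarrow> n x \<le> Suc N"
  shows "ptime D (\<lambda>x. paths (n x) (M x) (ex x) (X x) (m x))"
  using ptime_comp[OF ptime_paths0 ptime_Pair[OF assms(1) ptime_Pair[OF assms(2) ptime_Pair[OF assms(3) ptime_Pair[OF assms(4) assms(5)]]]]] assms(6) by simp

lemma ptime_source_path0: "ptime (\<lambda>N. {z. fst z \<le> Suc N}) (\<lambda>z. source_path (fst z) (fst (snd z)) (snd (snd z)))"
  unfolding source_path_def by (intro ptime_loops) auto

lemma ptime_source_path:
  assumes "ptime D n" "ptime D X" "ptime D P"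
    "\<And>N x. x \<in> D N \<Longrightarrow> n x \<le> Suc N"
  shows "ptime D (\<lambda>x. source_path (n x) (X x) (P x))"
  using ptime_comp[OF ptime_source_path0 ptime_Pair[OF assms(1) ptime_Pair[OF assms(2) assms(3)]]] assms(4) by simp

lemma ptime_assign0: "ptime (\<lambda>N. {z. fst z \<le> Suc N}) (\<lambda>z. assign (fst z) (fst (snd z)) (fst (snd (snd z))) (snd (snd (snd z))))"
  unfolding assign_def by (intro ptime_loops) auto

lemma ptime_assign:
  assumes "ptime D n" "ptime D m" "ptime D r" "ptime D l"
    "\<And>N x. x \<in> D N \<Longrightarrow> n x \<le> Suc N"
  shows "ptime D (\<lambda>x. assign (n x) (m x) (r x) (l x))"
  using ptime_comp[OF ptime_assign0 ptime_Pair[OF assms(1) ptime_Pair[OF assms(2) ptime_Pair[OF assms(3) assms(4)]]]] assms(5) by simp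

lemma ptime_augment_step0: "ptime (\<lambda>N. {z. fst z \<le> Suc N}) (\<lambda>z. augment_step (fst z) (fst (snd z)) (fst (snd (snd z))) (fst (snd (snd (snd z)))) (snd (snd (snd (snd z)))))"
  unfolding augment_step_def shift_step_def by (intro ptime_loops ptime_source_path ptime_paths ptime_assign) auto

lemma ptime_augment_step:
  assumes "ptime D n" "ptime D M" "ptime D ex" "ptime D X" "ptime D m"
    "\<And>N x. x \<in> D N \<Longrightarrow> n x \<le> Suc N"
  shows "ptime D (\<lambda>x. augment_step (n x) (M x) (ex x) (X x) (m x))"
  using ptime_comp[OF ptime_augment_step0 ptime_Pair[OF assms(1) ptime_Pair[OF assms(2) ptime_Pair[OF assms(3) ptime_Pair[OF assms(4) assms(5)]]]]] assms(6) by simp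

text \<open>The bound on \<open>p\<close> is phrased with \<open>Suc\<close> because the same form
  has to serve the loop of \<open>p + 1\<close> rounds in \<open>accept\<close>.\<close>

lemma ptime_max_flow0: "ptime (\<lambda>N. {z. fst z \<le> Suc N \<and> Suc (fst (snd (snd (snd z)))) \<le> Suc N}) (\<lambda>z. max_flow (fst z) (fst (snd z)) (fst (snd (snd z))) (fst (snd (snd (snd z)))) (snd (snd (snd (snd z)))))"
  unfolding max_flow_def by (intro ptime_loops ptime_augment_step) auto

lemma ptime_max_flow:
  assumes "ptime D n" "ptime D M" "ptime D ex" "ptime D p" "ptime D X"
    "\<And>N x. x \<in> D N \<Longrightarrow> n x \<le> Suc N" "\<And>N x. x \<in> D N \<Longrightarrow> Suc (p x) \<le> Suc N"
  shows "ptime D (\<lambda>x. max_flow (n x) (M x) (ex x) (p x) (X x))"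
  using ptime_comp[OF ptime_max_flow0 ptime_Pair[OF assms(1) ptime_Pair[OF assms(2) ptime_Pair[OF assms(3) ptime_Pair[OF assms(4) assms(5)]]]]] assms(6,7) by simp

lemma ptime_cut_list0: "ptime (\<lambda>N. {z. fst z \<le> Suc N}) (\<lambda>z. cut_list (fst z) (fst (snd z)) (fst (snd (snd z))) (fst (snd (snd (snd z)))) (snd (snd (snd (snd z)))))"
  unfolding cut_list_def by (intro ptime_loops ptime_arc) auto

lemma ptime_cut_list:
  assumes "ptime D n" "ptime D U" "ptime D M" "ptime D X" "ptime D P"
    "\<And>N x. x \<in> D N \<Longrightarrow> n x \<le> Suc N"
  shows "ptime D (\<lambda>x. cut_list (n x) (U x) (M x) (X x) (P x))"
  using ptime_comp[OF ptime_cut_list0 ptime_Pair[OF assms(1) ptime_Pair[OF assms(2) ptime_Pair[OF assms(3) ptime_Pair[OF assms(4) assms(5)]]]]] assms(6) by simp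

lemma ptime_min_cut0: "ptime (\<lambda>N. {z. fst z \<le> Suc N \<and> Suc (fst (snd (snd (snd (snd z))))) \<le> Suc N}) (\<lambda>z. min_cut (fst z) (fst (snd z)) (fst (snd (snd z))) (fst (snd (snd (snd z)))) (fst (snd (snd (snd (snd z))))) (snd (snd (snd (snd (snd z))))))"
  unfolding min_cut_def by (intro ptime_loops ptime_paths ptime_max_flow ptime_source_path ptime_cut_list) auto

lemma ptime_min_cut:
  assumes "ptime D n" "ptime D U" "ptime D M" "ptime D ex" "ptime D p" "ptime D X"
    "\<And>N x. x \<in> D N \<Longrightarrow> n x \<le> Suc N" "\<And>N x. x \<in> D N \<Longrightarrow> Suc (p x) \<le> Suc N"
  shows "ptime D (\<lambda>x. min_cut (n x) (U x) (M x) (ex x) (p x) (X x))"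
  using ptime_comp[OF ptime_min_cut0 ptime_Pair[OF assms(1) ptime_Pair[OF assms(2) ptime_Pair[OF assms(3) ptime_Pair[OF assms(4) ptime_Pair[OF assms(5) assms(6)]]]]]] assms(7,8) by simp

lemma ptime_absorb_step0: "ptime (\<lambda>N. {z. fst z \<le> Suc N \<and> Suc (fst (snd (snd (snd (snd z))))) \<le> Suc N}) (\<lambda>z. absorb_step (fst z) (fst (snd z)) (fst (snd (snd z))) (fst (snd (snd (snd z)))) (fst (snd (snd (snd (snd z))))) (fst (snd (snd (snd (snd (snd z)))))) (snd (snd (snd (snd (snd (snd z)))))))"
  unfolding absorb_step_def by (intro ptime_loops ptime_min_cut) auto

lemma ptime_absorb_step:
  assumes "ptime D n" "ptime D U" "ptime D M" "ptime D ex" "ptime D p" "ptime D R" "ptime D X"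
    "\<And>N x. x \<in> D N \<Longrightarrow> n x \<le> Suc N" "\<And>N x. x \<in> D N \<Longrightarrow> Suc (p x) \<le> Suc N"
  shows "ptime D (\<lambda>x. absorb_step (n x) (U x) (M x) (ex x) (p x) (R x) (X x))"
  using ptime_comp[OF ptime_absorb_step0 ptime_Pair[OF assms(1) ptime_Pair[OF assms(2) ptime_Pair[OF assms(3) ptime_Pair[OF assms(4) ptime_Pair[OF assms(5) ptime_Pair[OF assms(6) assms(7)]]]]]]] assms(8,9) by simp

lemma ptime_accept0: "ptime (\<lambda>N. {z. fst z \<le> Suc N \<and> Suc (fst (snd (snd (snd (snd z))))) \<le> Suc N}) (\<lambda>z. accept (fst z) (fst (snd z)) (fst (snd (snd z))) (fst (snd (snd (snd z)))) (fst (snd (snd (snd (snd z))))) (fst (snd (snd (snd (snd (snd z)))))) (snd (snd (snd (snd (snd (snd z)))))))"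
  unfolding accept_def by (intro ptime_loops ptime_min_cut ptime_absorb_step) auto

lemma ptime_accept:
  assumes "ptime D n" "ptime D U" "ptime D M" "ptime D ex" "ptime D p" "ptime D R" "ptime D v"
    "\<And>N x. x \<in> D N \<Longrightarrow> n x \<le> Suc N" "\<And>N x. x \<in> D N \<Longrightarrow> Suc (p x) \<le> Suc N"
  shows "ptime D (\<lambda>x. accept (n x) (U x) (M x) (ex x) (p x) (R x) (v x))"
  using ptime_comp[OF ptime_accept0 ptime_Pair[OF assms(1) ptime_Pair[OF assms(2) ptime_Pair[OF assms(3) ptime_Pair[OF assms(4) ptime_Pair[OF assms(5) ptime_Pair[OF assms(6) assms(7)]]]]]]] assms(8,9) by simp

lemma ptime_shadow: "ptime (\<lambda>N. {z. length (fst (snd (snd z))) \<le> N \<and> fst (snd (snd (snd (snd z)))) \<le> N}) shadow"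
  unfolding shadow_def
  by (intro ptime_loops ptime_length ptime_hop_table ptime_torso_table ptime_exit_list ptime_accept) auto

section \<open>Correctness of the algorithm\<close>

text \<open>Every step that moves raises the measure, so if step \<open>n\<close> still moved, the
  measure would exceed its bound \<open>n\<close>.\<close>

lemma funpow_fixpoint:
  assumes "I x" "\<And>x. I x \<Longrightarrow> I (f x) \<and> (f x = x \<or> \<mu> x < \<mu> (f x)) \<and> \<mu> x \<le> (n :: nat)"
  shows "f ((f ^^ n) x) = (f ^^ n) x"
proof -
  have I: "I ((f ^^ k) x)" for k by (induction k) (use assms in auto)
  have "f ((f ^^ k) x) = (f ^^ k) x \<or> k < \<mu> ((f ^^ Suc k) x)" for k
  proof (induction k)
    case 0
    then show ?case using assms(2)[OF assms(1)] by auto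
  next
    case (Suc k)
    then show ?case using assms(2)[OF I[of "Suc k"]] by auto
  qed
  from this[of n] show ?thesis using assms(2)[OF I[of "Suc n"]] by auto
qed

lemma foldl_first_keep: "a \<noteq> [] \<Longrightarrow> foldl (\<lambda>acc r. if acc \<noteq> [] then acc else g r) a xs = a"
  by (induction xs) simp_all

lemma foldl_first_cases:
  "(\<forall>r\<in>set xs. g r = []) \<and> foldl (\<lambda>acc r. if acc \<noteq> [] then acc else g r) [] xs = [] \<or>
   (\<exists>r\<in>set xs. g r \<noteq> [] \<and> foldl (\<lambda>acc r. if acc \<noteq> [] then acc else g r) [] xs = g r)"
proof (induction xs)
  case (Cons x xs)
  then show ?case by (cases "g x = []") (simp_all add: foldl_first_keep)
qed simp

lemma get_map [simp]: "i < n \<Longrightarrow> get n d (map f [0..<n]) i = f i"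
  by (simp add: get_def)

lemma get_nth: "length xs = n \<Longrightarrow> i < n \<Longrightarrow> get n d xs i = xs ! i"
  by (simp add: get_def)

lemma get_False_less: "get n False xs i \<Longrightarrow> i < n"
  by (simp add: get_def split: if_splits)

locale list_graph =
  fixes n :: nat and A :: "bool list list" and U T :: "bool list" and p :: nat
  assumes len: "length U = n" and term_und: "\<And>i. get n False T i \<Longrightarrow> get n False U i"
begin

definition V where "V = {..<n}"
definition E where "E = {(i, j). i < n \<and> j < n \<and> arc n A i j}"
definition set_of :: "bool list \<Rightarrow> nat set" where "set_of xs = {i. get n False xs i}"

sublocale cut_graph V E "set_of U" "set_of T"
  by unfold_locales (auto simp: V_def E_def set_of_def get_False_less term_und)

lemma in_V: "x \<in> V \<longleftrightarrow> x < n"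
  by (simp add: V_def)

lemma set_of_sub: "set_of xs \<subseteq> V"
  by (auto simp: set_of_def V_def get_False_less)

lemma in_set_of: "length xs = n \<Longrightarrow> i < n \<Longrightarrow> i \<in> set_of xs \<longleftrightarrow> xs ! i"
  by (simp add: set_of_def get_nth)

lemma get_True: "length xs = n \<Longrightarrow> i < n \<Longrightarrow> get n True xs i \<longleftrightarrow> i \<in> set_of xs"
  by (simp add: in_set_of get_nth)

lemma get_False: "get n False xs i \<longleftrightarrow> i \<in> set_of xs"
  by (simp add: set_of_def)

lemma set_of_map: "set_of (map f [0..<n]) = {i. i < n \<and> f i}"
  by (auto simp: set_of_def get_def)

lemma set_of_inj: "length xs = n \<Longrightarrow> length ys = n \<Longrightarrow> set_of xs = set_of ys \<Longrightarrow> xs = ys"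
proof (rule nth_equalityI)
  fix i assume *: "length xs = n" "length ys = n" "set_of xs = set_of ys" "i < length xs"
  then show "xs ! i = ys ! i" using in_set_of[of xs i] in_set_of[of ys i] by simp
qed simp

lemma card_set_of: "card (set_of xs) \<le> n"
  using card_mono[OF _ set_of_sub[of xs]] by (simp add: V_def)

lemma hop_step_set: "set_of (hop_step n A U w) = set_of w \<union> (E \<inter> set_of U \<times> V) `` set_of w"
proof -
  have "j < n" if "j \<in> set_of w" for j using that by (simp add: set_of_def get_False_less)
  then show ?thesis
    unfolding hop_step_def set_of_map get_False list_ex_iff by (auto simp: E_def V_def)
qed

text \<open>The row is closed under arcs out of undeletable vertices: soundness holds for every
  iterate, and the fixpoint reached after \<open>n\<close> rounds absorbs each hop arc by
  arc.\<close>

lemma hop_table: "l < n \<Longrightarrow> set_of (get n [] (hop_table n A U) l) = {w. (l, w) \<in> hop}"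
proof -
  assume l: "l < n"
  define w0 where "w0 = map (\<lambda>j. arc n A l j) [0..<n]"
  let ?f = "hop_step n A U"
  let ?r = "E \<inter> set_of U \<times> V"
  have w0: "set_of w0 = E `` {l}" unfolding w0_def set_of_map using l by (auto simp: E_def)
  have fix_: "?f ((?f ^^ n) w0) = (?f ^^ n) w0"
  proof (rule funpow_fixpoint[where I = "\<lambda>w. length w = n" and \<mu> = "\<lambda>w. card (set_of w)"])
    fix w :: "bool list" assume w: "length w = n"
    have l: "length (?f w) = n" by (simp add: hop_step_def)
    have s: "set_of w \<subseteq> set_of (?f w)" using hop_step_set by auto
    have "?f w = w \<or> card (set_of w) < card (set_of (?f w))"
    proof (cases "set_of w = set_of (?f w)")
      case True then show ?thesis using set_of_inj[OF w l] by simp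
    next
      case False
      then have "set_of w \<subset> set_of (?f w)" using s by blast
      then show ?thesis using psubset_card_mono set_of_sub fin finite_subset by metis
    qed
    then show "length (?f w) = n \<and> (?f w = w \<or> card (set_of w) < card (set_of (?f w))) \<and> card (set_of w) \<le> n"
      using l card_set_of by simp
  qed (simp add: w0_def)
  have sub: "set_of ((?f ^^ k) w0) \<subseteq> {w. (l, w) \<in> hop}" for k
  proof (induction k)
    case 0 then show ?case using w0 by (auto simp: hop_def)
  next
    case (Suc k)
    then show ?case using hop_step_set[of "(?f ^^ k) w0"] cut_graph.hop_step[OF cut_graph_axioms] by auto
  qed
  have mono: "set_of w0 \<subseteq> set_of ((?f ^^ k) w0)" for k
    by (induction k) (use hop_step_set in auto)
  have "{w. (l, w) \<in> hop} \<subseteq> set_of ((?f ^^ n) w0)"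
  proof
    fix w assume "w \<in> {w. (l, w) \<in> hop}"
    then obtain y where y: "(l, y) \<in> E" "(y, w) \<in> ?r\<^sup>*" unfolding hop_def by blast
    from y(2) show "w \<in> set_of ((?f ^^ n) w0)"
    proof (induction rule: rtrancl_induct)
      case base then show ?case using y w0 mono by blast
    next
      case (step x z)
      then have "z \<in> set_of (?f ((?f ^^ n) w0))" using hop_step_set by blast
      then show ?case using fix_ by simp
    qed
  qed
  with sub[of n] l show ?thesis by (auto simp: hop_table_def w0_def)
qed

definition "H = hop_table n A U"
definition "M = torso_table n U H"
definition "ex = exit_list n T H"

lemma arc_H: "l < n \<Longrightarrow> arc n H l w \<longleftrightarrow> (l, w) \<in> hop"
  using hop_table[of l] by (auto simp: arc_def H_def get_False)

lemma arc_M: "l < n \<Longrightarrow> r < n \<Longrightarrow> arc n M l r \<longleftrightarrow> (l, r) \<in> torso"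
  by (simp add: M_def torso_table_def arc_def[of n "map _ _"] get_True[OF len] arc_H torso_def)
    (simp add: in_V)

lemma exits_ex: "set_of ex = exits \<inter> V"
  unfolding ex_def exit_list_def set_of_map
  using set_of_sub[of T] by (auto simp: list_ex_iff get_False arc_H exits_def in_V subset_iff)

lemma slots_iff: "length X = n \<Longrightarrow> r \<in> slots (set_of X) \<longleftrightarrow> r < n \<and> r \<notin> set_of U \<and> \<not> get n True X r"
  using get_True[of X r] by (auto simp: slots_def in_V)

end

section \<open>Search for augmenting paths\<close>

locale list_search = list_graph +
  fixes X :: "bool list" and m :: "nat list"
  assumes X: "length X = n" and m: "length m = n" and m_less: "\<And>r. r \<in> slots (set_of X) \<Longrightarrow> m ! r < n"
begin

definition found :: "(nat \<times> nat) list list list \<Rightarrow> nat set"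
  where "found P = {l. l < n \<and> P ! l \<noteq> []}"

lemma sweep_cases:
  assumes P: "length P = n" and l: "l < n"
  obtains (old) "l \<in> found P" "sweep n M X m P ! l = P ! l"
  | (none) "l \<notin> found P" "sweep n M X m P ! l = []"
      "\<And>r. r \<in> slots (set_of X) \<Longrightarrow> (l, r) \<in> torso \<Longrightarrow> m ! r \<notin> found P"
  | (new) r where "l \<notin> found P" "r \<in> slots (set_of X)" "(l, r) \<in> torso" "m ! r \<in> found P"
      "sweep n M X m P ! l = [(r, l) # hd (P ! (m ! r))]"
proof -
  define g where "g = (\<lambda>r. if arc n M l r \<and> \<not> get n True X r then
        case get n [] P (get n 0 m r) of [] \<Rightarrow> [] | q # _ \<Rightarrow> [(r, l) # q] else [])"
  have S: "sweep n M X m P ! l = foldl (\<lambda>acc r. if acc \<noteq> [] then acc else g r) (P ! l) [0..<n]"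
  proof -
    have "sweep n M X m P ! l = extend_path n M X m P l" using l by (simp add: sweep_def)
    then show ?thesis unfolding extend_path_def g_def get_nth[OF P l] .
  qed
  have g: "g r = (if r \<in> slots (set_of X) \<and> (l, r) \<in> torso \<and> m ! r \<in> found P
      then [(r, l) # hd (P ! (m ! r))] else [])" if r: "r < n" for r
  proof (cases "r \<in> slots (set_of X) \<and> (l, r) \<in> torso")
    case True
    then have "m ! r < n" using m_less by blast
    moreover have "arc n M l r" "\<not> get n True X r" using True arc_M[OF l r] slots_iff[OF X] by auto
    ultimately show ?thesis
      using True r by (simp add: g_def get_nth P m found_def split: list.split)
  next
    case False
    then have "\<not> (arc n M l r \<and> \<not> get n True X r)"
      using arc_M[OF l r] slots_iff[OF X, of r] r by (auto simp: torso_def)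
    then show ?thesis using False by (auto simp: g_def)
  qed
  show thesis
  proof (cases "P ! l = []")
    case False
    then have "sweep n M X m P ! l = P ! l" using S foldl_first_keep by simp
    then show thesis using old False l by (simp add: found_def)
  next
    case True
    then have l': "l \<notin> found P" by (simp add: found_def)
    from S True have S': "sweep n M X m P ! l = foldl (\<lambda>acc r. if acc \<noteq> [] then acc else g r) [] [0..<n]"
      by simp
    consider "\<forall>r\<in>set [0..<n]. g r = []" "sweep n M X m P ! l = []"
      | r where "r < n" "g r \<noteq> []" "sweep n M X m P ! l = g r"
      using foldl_first_cases[of "[0..<n]" g] unfolding S'[symmetric] by auto
    then show thesis
    proof cases
      case 1
      show thesis
      proof (rule none[OF l' 1(2)])
        fix r assume r: "r \<in> slots (set_of X)" "(l, r) \<in> torso"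
        then have "r < n" using slots_iff[OF X] by simp
        then have "g r = []" using 1(1) by simp
        then show "m ! r \<notin> found P" using r \<open>r < n\<close> g by auto
      qed
    next
      case 2
      then have "r \<in> slots (set_of X) \<and> (l, r) \<in> torso \<and> m ! r \<in> found P" using g[OF 2(1)] 2(2) by (auto split: if_splits)
      then show thesis using new[OF l'] 2(3) g[OF 2(1)] by simp
    qed
  qed
qed

text \<open>The last clause is what keeps paths simple: a newly found \<open>l\<close> had no entry
  before, while all later vertices of its path had one. Distinct partners \<open>m ! r\<close> also
  force distinct slots and bound the path length by \<open>n\<close>.\<close>

definition good_paths :: "(nat \<times> nat) list list list \<Rightarrow> bool"
  where "good_paths P \<longleftrightarrow> length P = n \<and> (\<forall>l<n. \<forall>q\<in>set (P ! l). aug_path (set_of X) ((!) m) l q \<and>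
    distinct (l # map (\<lambda>x. m ! fst x) q) \<and> set (map (\<lambda>x. m ! fst x) q) \<subseteq> found P)"

lemma length_sweep: "length (sweep n M X m P) = n"
  by (simp add: sweep_def)

lemma found_sweep: "length P = n \<Longrightarrow> found P \<subseteq> found (sweep n M X m P)"
proof
  fix l assume P: "length P = n" and l: "l \<in> found P"
  then have "l < n" "P ! l \<noteq> []" by (auto simp: found_def)
  with P l show "l \<in> found (sweep n M X m P)"
    by (cases rule: sweep_cases[OF P \<open>l < n\<close>]) (auto simp: found_def)
qed

lemma good_sweep:
  assumes "good_paths P"
  shows "good_paths (sweep n M X m P)"
  unfolding good_paths_def
proof (intro conjI allI impI ballI length_sweep)
  have P: "length P = n" using assms by (simp add: good_paths_def)
  fix l q assume l: "l < n" and q: "q \<in> set (sweep n M X m P ! l)"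
  have "aug_path (set_of X) ((!) m) l q \<and>
    distinct (l # map (\<lambda>x. m ! fst x) q) \<and> set (map (\<lambda>x. m ! fst x) q) \<subseteq> found P"
  proof (cases rule: sweep_cases[OF P l])
    case 1
    then show ?thesis using assms q l unfolding good_paths_def by simp
  next
    case 2
    then show ?thesis using q by simp
  next
    case (3 r)
    define q' where "q' = hd (P ! (m ! r))"
    have r: "m ! r < n" "q' \<in> set (P ! (m ! r))" using 3(4) by (auto simp: found_def q'_def)
    then have q': "aug_path (set_of X) ((!) m) (m ! r) q'"
        "distinct (m ! r # map (\<lambda>x. m ! fst x) q')" "set (map (\<lambda>x. m ! fst x) q') \<subseteq> found P"
      using assms unfolding good_paths_def by blast+
    have "q = (r, l) # q'" using q 3(5) by (simp add: q'_def)
    then show ?thesis using q' 3 by (auto intro: aug_path.intros(2))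
  qed
  then show "aug_path (set_of X) ((!) m) l q" "distinct (l # map (\<lambda>x. m ! fst x) q)"
    "set (map (\<lambda>x. m ! fst x) q) \<subseteq> found (sweep n M X m P)"
    using found_sweep[OF P] by auto
qed

definition table :: "(nat \<times> nat) list list list" where "table = paths n M ex X m"

definition table0 :: "(nat \<times> nat) list list list"
  where "table0 = map (\<lambda>l. if get n False ex l then [[]] else []) [0..<n]"

lemma table_alt: "table = (sweep n M X m ^^ n) table0"
  by (simp add: table_def table0_def paths_def)

lemma good_table0: "good_paths table0"
  by (auto simp: good_paths_def table0_def get_False exits_ex intro: aug_path.intros(1) split: if_splits)

lemma good_table: "good_paths table"
proof -
  have "good_paths ((sweep n M X m ^^ k) table0)" for k
    by (induction k) (auto intro: good_table0 good_sweep)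
  then show ?thesis by (simp add: table_alt)
qed

lemma length_table: "length table = n"
  using good_table by (simp add: good_paths_def)

lemma exits_found: "l < n \<Longrightarrow> l \<in> exits \<Longrightarrow> l \<in> found table"
proof -
  assume l: "l < n" "l \<in> exits"
  have "length ((sweep n M X m ^^ k) table0) = n \<and> found table0 \<subseteq> found ((sweep n M X m ^^ k) table0)" for k
    by (induction k) (use found_sweep length_sweep in \<open>auto simp: table0_def\<close>)
  moreover have "l \<in> ex_set" if "ex_set = set_of ex" for ex_set using l that exits_ex by (auto simp: in_V)
  then have "l \<in> found table0" using l by (auto simp: found_def table0_def get_False)
  ultimately show ?thesis by (auto simp: table_alt)
qed

text \<open>A sweep changes the table only by finding a new vertex, so the number of found vertices
  is a measure bounded by \<open>n\<close>.\<close>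

lemma sweep_table: "sweep n M X m table = table"
  unfolding table_alt
proof (rule funpow_fixpoint[where I = "\<lambda>P. length P = n" and \<mu> = "\<lambda>P. card (found P)"])
  fix P :: "(nat \<times> nat) list list list" assume P: "length P = n"
  let ?S = "sweep n M X m P"
  have fin: "finite (found Q)" for Q by (simp add: found_def)
  have "?S = P \<or> card (found P) < card (found ?S)"
  proof (cases "found ?S = found P")
    case True
    have "?S = P"
    proof (rule nth_equalityI)
      fix l assume "l < length ?S"
      then have l: "l < n" by (simp add: length_sweep)
      show "?S ! l = P ! l"
      proof (cases rule: sweep_cases[OF P l])
        case 2
        then show ?thesis using l by (simp add: found_def)
      next
        case (3 r)
        then have "l \<in> found ?S" using l by (simp add: found_def)
        then show ?thesis using True 3(1) by simp
      qed
    qed (simp add: P length_sweep)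
    then show ?thesis ..
  next
    case False
    then show ?thesis using found_sweep[OF P] psubset_card_mono[OF fin] by blast
  qed
  moreover have "card (found P) \<le> n" using card_mono[of "{..<n}" "found P"] by (auto simp: found_def)
  ultimately show "length ?S = n \<and> (?S = P \<or> card (found P) < card (found ?S)) \<and> card (found P) \<le> n"
    by (simp add: length_sweep)
qed (simp add: table0_def)

lemma found_closed:
  assumes "l < n" "r \<in> slots (set_of X)" "(l, r) \<in> torso" "m ! r \<in> found table"
  shows "l \<in> found table"
proof (rule ccontr)
  assume l: "l \<notin> found table"
  show False
  proof (cases rule: sweep_cases[OF length_table assms(1)])
    case (3 r)
    then have "table ! l \<noteq> []" by (simp add: sweep_table)
    then show False using l assms(1) by (simp add: found_def)
  qed (use l assms in auto)
qed

lemma found_path: "l \<in> found table \<Longrightarrow> \<exists>q. aug_path (set_of X) ((!) m) l q"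
  using good_table unfolding good_paths_def found_def by (metis (mono_tags, lifting) list.set_sel(1) mem_Collect_eq)

lemma source_path_cases:
  obtains (none) "source_path n X table = []" "set_of X \<inter> found table = {}"
  | (path) x where "x \<in> set_of X" "x \<in> found table" "source_path n X table = table ! x"
proof -
  define g where "g = (\<lambda>x. if get n False X x then get n [] table x else [])"
  have S: "source_path n X table = foldl (\<lambda>acc x. if acc \<noteq> [] then acc else g x) [] [0..<n]"
    unfolding source_path_def g_def ..
  have g: "x < n \<Longrightarrow> g x = (if x \<in> set_of X then table ! x else [])" for x
    by (simp add: g_def get_False get_nth length_table)
  consider "\<forall>x\<in>set [0..<n]. g x = []" "source_path n X table = []"
      | x where "x < n" "g x \<noteq> []" "source_path n X table = g x"
      using foldl_first_cases[of "[0..<n]" g] unfolding S by auto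
  then show thesis
  proof cases
    case 1
    have "set_of X \<inter> found table = {}"
    proof (rule ccontr)
      assume "set_of X \<inter> found table \<noteq> {}"
      then obtain x where "x \<in> set_of X" "x < n" "table ! x \<noteq> []" by (auto simp: found_def)
      moreover from this have "g x = []" using 1(1) by simp
      ultimately show False using g[of x] by simp
    qed
    then show thesis using none 1 by blast
  next
    case 2
    then have "x \<in> set_of X" "table ! x \<noteq> []" using g[of x] by (auto split: if_splits)
    then show thesis using path[of x] 2 g[of x] by (simp add: found_def)
  qed
qed

end

section \<open>Maximum flows and minimum cuts on lists\<close>

context list_graph
begin

definition is_flow :: "bool list \<Rightarrow> nat list \<Rightarrow> nat \<Rightarrow> bool"
  where "is_flow X m k \<longleftrightarrow> length m = n \<and> pre_flow (set_of X) {} ((!) m) \<and> flow_val (set_of X) ((!) m) = k"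

lemma is_flow_search:
  assumes "length X = n" "is_flow X m k"
  shows "list_search n U T X m"
proof unfold_locales
  fix r assume "r \<in> slots (set_of X)"
  then have "m ! r \<in> slots (set_of X) \<union> set_of X" using assms by (auto simp: is_flow_def pre_flow_def)
  then show "m ! r < n" using set_of_sub[of X] by (auto simp: slots_def in_V)
qed (use assms in \<open>auto simp: is_flow_def\<close>)

text \<open>Surplus rounds are idle on the empty path, so \<open>n\<close> rounds serve every
  augmenting path.\<close>

lemma shift_step_list:
  "length m = n \<Longrightarrow> length q \<le> k \<Longrightarrow>
    fst ((shift_step n ^^ k) (m, q)) = map (shift ((!) m) q) [0..<n]"
proof (induction q arbitrary: m k)
  case Nil
  have "(shift_step n ^^ k) (m, []) = (m, [])"
    by (induction k) (simp_all add: shift_step_def)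
  then show ?case using Nil map_nth[of m] by (simp add: shift_def)
next
  case (Cons x q)
  obtain r l where x: "x = (r, l)" by fastforce
  obtain j where k: "k = Suc j" "length q \<le> j" using Cons.prems by (cases k) auto
  have "(shift_step n ^^ k) (m, x # q) = (shift_step n ^^ j) (assign n m r l, q)"
    by (simp add: k(1) funpow_Suc_right x shift_step_def del: funpow.simps)
  then have "fst ((shift_step n ^^ k) (m, x # q)) = map (shift ((!) (assign n m r l)) q) [0..<n]"
    using Cons.IH[OF _ k(2)] by (simp add: assign_def)
  also have "\<dots> = map (shift ((!) m) (x # q)) [0..<n]"
    unfolding x shift_Cons
    by (intro map_cong refl shift_cong) (use Cons.prems in \<open>auto simp: assign_def get_nth\<close>)
  finally show ?case .
qed

lemma augment_step_flow:
  assumes X: "length X = n" and f: "is_flow X m k" and e: "set_of X \<inter> exits = {}"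
    and ne: "source_path n X (paths n M ex X m) \<noteq> []"
  shows "is_flow X (augment_step n M ex X m) (Suc k)"
proof -
  interpret list_search n A U T p X m by (rule is_flow_search[OF X f])
  obtain x where x: "x \<in> set_of X" "x \<in> found table" "source_path n X table = table ! x"
    using source_path_cases ne unfolding table_def by metis
  define q where "q = hd (table ! x)"
  have xn: "x < n" and t: "table ! x = q # tl (table ! x)"
    using x(2) by (auto simp: found_def q_def)
  have q: "aug_path (set_of X) ((!) m) x q" "distinct (x # map (\<lambda>y. m ! fst y) q)"
    "set (map (\<lambda>y. m ! fst y) q) \<subseteq> found table"
    using good_table xn t unfolding good_paths_def by (metis list.set_intros(1))+
  have "distinct (map fst q)"
    using q(2) by (auto simp: distinct_map intro: comp_inj_on_iff inj_onI) (auto simp: inj_on_def)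
  from augment_flow[OF _ e x(1) q(1) this, of] f
  have s: "pre_flow (set_of X) {} (shift ((!) m) q)" "flow_val (set_of X) (shift ((!) m) q) = Suc k"
    by (simp_all add: is_flow_def)
  have "card (set (map (\<lambda>y. m ! fst y) q)) \<le> card {..<n}"
    using q(3) by (intro card_mono) (auto simp: found_def)
  then have "length q \<le> n" using q(2) by (simp add: distinct_card del: set_map)
  have "augment_step n M ex X m = fst ((shift_step n ^^ n) (m, q))"
    unfolding augment_step_def table_def[symmetric] x(3) by (subst t) simp
  also have "\<dots> = map (shift ((!) m) q) [0..<n]"
    by (rule shift_step_list[OF m \<open>length q \<le> n\<close>])
  finally have a: "augment_step n M ex X m = map (shift ((!) m) q) [0..<n]" .
  have "augment_step n M ex X m ! r = shift ((!) m) q r" if "r \<in> slots (set_of X)" for r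
    using that unfolding a by (simp add: slots_def in_V)
  from pre_flow_cong[of "set_of X", OF this] s a show ?thesis by (simp add: is_flow_def)
qed

text \<open>Either all augmentations succeed or the search fails once, and then it keeps failing
  because the flow no longer changes.\<close>

lemma max_flow_spec:
  assumes X: "length X = n" and e: "set_of X \<inter> exits = {}"
  obtains j where "is_flow X (max_flow n M ex k X) j" "j \<le> k"
    "j = k \<or> source_path n X (paths n M ex X (max_flow n M ex k X)) = []"
proof -
  have "\<exists>j\<le>k. is_flow X (max_flow n M ex k X) j \<and>
    (j = k \<or> source_path n X (paths n M ex X (max_flow n M ex k X)) = [])"
  proof (induction k)
    case 0
    have "pre_flow (set_of X) {} ((!) [0..<n])" "flow_val (set_of X) ((!) [0..<n]) = 0"
      using pre_flow_cong[of "set_of X" "(!) [0..<n]" "\<lambda>r. r"] pre_flow_id by (auto simp: slots_def in_V)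
    then show ?case by (simp add: is_flow_def max_flow_def)
  next
    case (Suc k)
    let ?m = "max_flow n M ex k X"
    obtain j where j: "j \<le> k" "is_flow X ?m j" "j = k \<or> source_path n X (paths n M ex X ?m) = []"
      using Suc by blast
    have S: "max_flow n M ex (Suc k) X = augment_step n M ex X ?m" by (simp add: max_flow_def)
    show ?case
    proof (cases "source_path n X (paths n M ex X ?m) = []")
      case True
      then have "max_flow n M ex (Suc k) X = ?m" unfolding S by (simp add: augment_step_def)
      then show ?thesis using True j(1,2) le_SucI by metis
    next
      case False
      then show ?thesis using augment_step_flow[OF X j(2) e False] j unfolding S by auto
    qed
  qed
  then show thesis using that by blast
qed

text \<open>An exit in \<open>X\<close> rules out every valid set and puts \<open>X\<close> outside
  the scope of the augmentation lemmas. Rejection holds for any \<open>m\<close>, since the empty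
  path recorded at the exit survives all sweeps.\<close>

lemma exits_source_path:
  assumes "set_of X \<inter> exits \<noteq> {}"
  shows "source_path n X (paths n M ex X m) \<noteq> []"
proof
  let ?P = "\<lambda>k. (sweep n M X m ^^ k) (map (\<lambda>l. if get n False ex l then [[]] else []) [0..<n])"
  assume none: "source_path n X (paths n M ex X m) = []"
  obtain x where x: "x \<in> set_of X" "x \<in> exits" using assms by blast
  then have xn: "x < n" using set_of_sub in_V by blast
  note x = x xn
  have "length (?P k) = n \<and> ?P k ! x \<noteq> []" for k
  proof (induction k)
    case 0
    then show ?case using x exits_ex by (auto simp: get_False in_V)
  next
    case (Suc k)
    have "sweep n M X m (?P k) ! x = extend_path n M X m (?P k) x" using x by (simp add: sweep_def)
    also have "\<dots> = ?P k ! x"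
      unfolding extend_path_def using Suc x by (subst foldl_first_keep) (simp_all add: get_nth)
    finally have "sweep n M X m (?P k) ! x = ?P k ! x" .
    moreover have "length (sweep n M X m (?P k)) = n" by (simp add: sweep_def)
    ultimately show ?case using Suc by simp
  qed
  then have P: "get n [] (paths n M ex X m) x \<noteq> []" using x by (simp add: paths_def get_nth)
  show False
    using foldl_first_cases[of "[0..<n]" "\<lambda>x. if get n False X x then get n [] (paths n M ex X m) x else []"]
      none x P unfolding source_path_def by (auto simp: get_False split: if_splits)
qed

lemma min_cut_spec:
  assumes X: "length X = n"
  shows "fst (min_cut n U M ex p X) \<Longrightarrow> valid (set_of X) L \<Longrightarrow> p < card (bd L)"
    and "\<not> fst (min_cut n U M ex p X) \<Longrightarrow>
      \<exists>L. best (set_of X) L \<and> set_of (snd (min_cut n U M ex p X)) = bd L \<and> card (bd L) \<le> p"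
proof -
  define m where "m = max_flow n M ex p X"
  have Xs: "set_of X \<subseteq> V" "finite (set_of X)" using set_of_sub fin finite_subset by blast+
  have mc: "min_cut n U M ex p X = (source_path n X (paths n M ex X m) \<noteq> [], cut_list n U M X (paths n M ex X m))"
    unfolding min_cut_def m_def Let_def ..
  consider "set_of X \<inter> exits \<noteq> {}" | "set_of X \<inter> exits = {}" by blast
  then have "(fst (min_cut n U M ex p X) \<longrightarrow> (\<forall>L. valid (set_of X) L \<longrightarrow> p < card (bd L))) \<and>
    (\<not> fst (min_cut n U M ex p X) \<longrightarrow>
      (\<exists>L. best (set_of X) L \<and> set_of (snd (min_cut n U M ex p X)) = bd L \<and> card (bd L) \<le> p))"
  proof cases
    case 1
    then have "source_path n X (paths n M ex X m) \<noteq> []" by (rule exits_source_path)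
    moreover have "\<not> valid (set_of X) L" for L using 1 by (auto simp: valid_def)
    ultimately show ?thesis unfolding mc by simp
  next
    case 2
    obtain j where j: "is_flow X m j" "j \<le> p" "j = p \<or> source_path n X (paths n M ex X m) = []"
      using max_flow_spec[OF X 2] unfolding m_def by metis
    interpret list_search n A U T p X m by (rule is_flow_search[OF X j(1)])
    have pf: "pre_flow (set_of X) {} ((!) m)" "flow_val (set_of X) ((!) m) = j"
      using j(1) by (auto simp: is_flow_def)
    show ?thesis
    proof (cases "source_path n X table = []")
      case True
      let ?L = "slots (set_of X) \<union> set_of X - found table"
      have dis: "set_of X \<inter> found table = {}"
        by (cases rule: source_path_cases) (use True in \<open>auto simp: found_def\<close>)
      have V: "l < n" if "l \<in> slots (set_of X) \<union> set_of X" for l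
        using that Xs(1) by (auto simp: slots_def in_V)
      \<comment> \<open>\<open>flow_best\<close> with \<open>Q = found table\<close>: the table
        covers the exits, is closed because it is a fixpoint of \<open>sweep\<close>, and misses
        \<open>X\<close> because there is no source path.\<close>
      have b: "best (set_of X) ?L" "card (bd ?L) = flow_val (set_of X) ((!) m)"
        using flow_best[OF pf(1) Xs(2) dis] exits_found found_closed found_path V by blast+
      have "set_of (cut_list n U M X table) = bd ?L"
      proof -
        have g: "get n [] table r = [] \<longleftrightarrow> r \<notin> found table" if "r < n" for r
          using that by (simp add: get_nth length_table found_def)
        have "set_of (cut_list n U M X table) = {r. r < n \<and> r \<notin> set_of U \<and> r \<notin> set_of X \<and> r \<in> found table \<and>
          (\<exists>l<n. (l \<notin> set_of U \<or> l \<in> set_of X) \<and> l \<notin> found table \<and> (l, r) \<in> torso)}"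
          unfolding cut_list_def set_of_map
          using g by (auto simp: list_ex_iff get_True[OF len] get_True[OF X] get_False arc_M)
        also have "\<dots> = bd ?L"
        proof -
          have "l < n" if "l \<in> set_of X" for l using that Xs(1) in_V by blast
          then show ?thesis using dis by (auto simp: bd_def torso_def slots_def in_V)
        qed
        finally show ?thesis .
      qed
      then show ?thesis using True b pf j(2) unfolding mc table_def[symmetric] by auto
    next
      case False
      \<comment> \<open>An augmenting path is left after \<open>p\<close> augmentations. Using it
        gives a flow of value \<open>p + 1\<close>, a lower bound for every cut.\<close>
      then have "j = p" using j(3) by (simp add: table_def)
      then have "is_flow X (augment_step n M ex X m) (Suc p)"
        using augment_step_flow[OF X j(1) 2] False by (simp add: table_def)
      then have "p < card (bd L)" if "valid (set_of X) L" for L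
        using flow_le(1)[OF _ that Xs(2), of "(!) (augment_step n M ex X m)"] by (simp add: is_flow_def)
      then show ?thesis using False unfolding mc table_def[symmetric] by simp
    qed
  qed
  then show "fst (min_cut n U M ex p X) \<Longrightarrow> valid (set_of X) L \<Longrightarrow> p < card (bd L)"
    and "\<not> fst (min_cut n U M ex p X) \<Longrightarrow>
      \<exists>L. best (set_of X) L \<and> set_of (snd (min_cut n U M ex p X)) = bd L \<and> card (bd L) \<le> p"
    by blast+
qed

definition list_of :: "nat set \<Rightarrow> bool list"
  where "list_of S = map (\<lambda>i. i \<in> S) [0..<n]"

lemma length_list_of: "length (list_of S) = n"
  by (simp add: list_of_def)

lemma set_of_list_of: "S \<subseteq> V \<Longrightarrow> set_of (list_of S) = S"
  unfolding list_of_def set_of_map by (auto simp: in_V)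

definition rejects :: "nat set \<Rightarrow> bool"
  where "rejects S = fst (min_cut n U M ex p (list_of S))"

definition cut_of :: "nat set \<Rightarrow> nat set"
  where "cut_of S = set_of (snd (min_cut n U M ex p (list_of S)))"

sublocale cut_rounds V E "set_of U" "set_of T" p rejects cut_of
proof unfold_locales
  fix S L assume S: "S \<subseteq> V - set_of T"
  then have "set_of (list_of S) = S" by (intro set_of_list_of) auto
  from min_cut_spec[OF length_list_of, of S, unfolded this]
  show "rejects S \<Longrightarrow> valid S L \<Longrightarrow> p < card (bd L)"
    "\<not> rejects S \<Longrightarrow> \<exists>L. best S L \<and> cut_of S = bd L \<and> card (bd L) \<le> p"
    unfolding rejects_def cut_of_def by blast+
qed

lemma absorb_step_list_of: "S \<subseteq> V \<Longrightarrow> absorb_step n U M ex p R (list_of S) = list_of (absorb (set_of R) S)"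
proof -
  assume S: "S \<subseteq> V"
  have "get n False (list_of S) r \<longleftrightarrow> r \<in> S" for r using set_of_list_of[OF S] get_False by blast
  then show ?thesis
    by (simp add: absorb_step_def absorb_def rejects_def cut_of_def get_False Let_def) (simp add: list_of_def)
qed

lemma accept_iff:
  assumes "v < n"
  shows "accept n U M ex p R v \<longleftrightarrow> accepts (set_of R) v"
proof -
  have "(absorb_step n U M ex p R ^^ k) (map (\<lambda>j. v = j) [0..<n]) = list_of ((absorb (set_of R) ^^ k) {v}) \<and>
    (absorb (set_of R) ^^ k) {v} \<subseteq> V" for k
  proof (induction k)
    case 0
    then show ?case using assms by (auto simp: list_of_def in_V)
  next
    case (Suc k)
    moreover have "absorb (set_of R) S \<subseteq> V" if "S \<subseteq> V" for S
      using that set_of_sub by (auto simp: absorb_def cut_of_def)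
    ultimately show ?case by (simp add: absorb_step_list_of)
  qed
  from this[of "Suc p"]
  have "(absorb_step n U M ex p R ^^ Suc p) (map (\<lambda>j. v = j) [0..<n]) = list_of ((absorb (set_of R) ^^ Suc p) {v})"
    by blast
  moreover have "list_all (\<lambda>r. get n False c r \<longrightarrow> get n False R r) [0..<n] \<longleftrightarrow> set_of c \<subseteq> set_of R" for c
    using set_of_sub[of c] by (auto simp: list_all_iff get_False in_V)
  ultimately show ?thesis
    unfolding accept_def accepts_def Let_def rejects_def cut_of_def by simp
qed

end

section \<open>Coin tosses and success probability\<close>

text \<open>The accumulator mirrors the program, which adds each toss at the front: the coin tossed
  with \<open>n\<close> tosses still to come ends up at index \<open>n\<close>.\<close>

fun coins :: "nat \<Rightarrow> bool list \<Rightarrow> bool list pmf" where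
  "coins 0 acc = return_pmf acc"
| "coins (Suc n) acc = bind_pmf (bernoulli_pmf (1 / 2)) (\<lambda>b. coins n (b # acc))"

lemma set_pmf_coins: "R \<in> set_pmf (coins n acc) \<Longrightarrow> \<exists>bs. length bs = n \<and> R = bs @ acc"
proof (induction n arbitrary: acc)
  case (Suc n)
  then obtain b where "R \<in> set_pmf (coins n (b # acc))" by auto
  from Suc.IH[OF this] show ?case by (metis append.assoc append_Cons append_Nil length_append_singleton)
qed simp

lemma prob_bind_coin:
  "measure_pmf.prob (bind_pmf (bernoulli_pmf (1 / 2)) f) E
    = (measure_pmf.prob (f True) E + measure_pmf.prob (f False) E) / 2"
proof -
  have "ennreal (measure_pmf.prob (bind_pmf (bernoulli_pmf (1 / 2)) f) E)
    = emeasure (f True) E * ennreal (1 / 2) + emeasure (f False) E * ennreal (1 / 2)"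
    unfolding measure_pmf.emeasure_eq_measure[symmetric] by simp
  also have "\<dots> = ennreal (measure_pmf.prob (f True) E * (1 / 2) + measure_pmf.prob (f False) E * (1 / 2))"
    unfolding measure_pmf.emeasure_eq_measure by (simp only: ennreal_mult'' ennreal_plus zero_le_mult_iff
        measure_nonneg zero_le_divide_1_iff zero_le_numeral simp_thms)
  finally show ?thesis by (subst (asm) ennreal_inj) (simp_all add: add_divide_distrib)
qed

text \<open>Each prescribed coin costs a factor 1/2. In the induction step the current toss fixes
  index \<open>n\<close>, whatever the later tosses are.\<close>

lemma prob_coins:
  assumes "A \<inter> F = {}"
  shows "(1 / 2) ^ (card (A \<inter> {..<n}) + card (F \<inter> {..<n}))
    \<le> measure_pmf.prob (coins n acc) {R. \<forall>i<n. (i \<in> A \<longrightarrow> R ! i) \<and> (i \<in> F \<longrightarrow> \<not> R ! i)}"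
proof (induction n arbitrary: acc)
  case (Suc n)
  let ?E = "\<lambda>n. {R. \<forall>i<n. (i \<in> A \<longrightarrow> R ! i) \<and> (i \<in> F \<longrightarrow> \<not> R ! i)}"
  let ?q = "(1 / 2 :: real) ^ (card (A \<inter> {..<n}) + card (F \<inter> {..<n}))"
  have le: "?q \<le> measure_pmf.prob (coins n (b # acc)) (?E (Suc n))"
    if b: "n \<in> A \<Longrightarrow> b" "n \<in> F \<Longrightarrow> \<not> b" for b
  proof -
    have "measure_pmf.prob (coins n (b # acc)) (?E (Suc n)) = measure_pmf.prob (coins n (b # acc)) (?E n)"
    proof (rule measure_eq_AE)
      show "AE R in coins n (b # acc). R \<in> ?E (Suc n) \<longleftrightarrow> R \<in> ?E n"
        using b by (auto simp: AE_measure_pmf_iff less_Suc_eq nth_append dest!: set_pmf_coins)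
    qed simp_all
    then show ?thesis using Suc.IH[of "b # acc"] by simp
  qed
  have ins: "B \<inter> {..<Suc n} = (if n \<in> B then insert n (B \<inter> {..<n}) else B \<inter> {..<n})" for B
    by (auto simp: less_Suc_eq)
  consider "n \<in> A" "n \<notin> F" | "n \<in> F" "n \<notin> A" | "n \<notin> A" "n \<notin> F" using assms by blast
  then show ?case
  proof cases
    case 1
    then have "(1 / 2) ^ (card (A \<inter> {..<Suc n}) + card (F \<inter> {..<Suc n})) = ?q / 2" by (simp add: ins)
    also have "\<dots> \<le> measure_pmf.prob (coins n (True # acc)) (?E (Suc n)) / 2" using le[of True] 1 by simp
    also have "\<dots> \<le> measure_pmf.prob (coins (Suc n) acc) (?E (Suc n))" by (simp add: prob_bind_coin)
    finally show ?thesis .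
  next
    case 2
    then have "(1 / 2) ^ (card (A \<inter> {..<Suc n}) + card (F \<inter> {..<Suc n})) = ?q / 2" by (simp add: ins)
    also have "\<dots> \<le> measure_pmf.prob (coins n (False # acc)) (?E (Suc n)) / 2" using le[of False] 2 by simp
    also have "\<dots> \<le> measure_pmf.prob (coins (Suc n) acc) (?E (Suc n))" by (simp add: prob_bind_coin)
    finally show ?thesis .
  next
    case 3
    then have "(1 / 2) ^ (card (A \<inter> {..<Suc n}) + card (F \<inter> {..<Suc n})) = ?q" by (simp add: ins)
    also have "\<dots> \<le> measure_pmf.prob (coins (Suc n) acc) (?E (Suc n))"
      using le[of True] le[of False] 3 by (simp add: prob_bind_coin)
    finally show ?thesis .
  qed
qed simp

section \<open>The tossing loop of the machine\<close>

definition toss_body :: com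
  where "toss_body = Seq (Toss 2) (Seq (Assign 3 (BranchE (Var 2) (Var 3)))
    (Seq (Assign 2 LeafE) (Assign 1 (RightE (Var 1)))))"

text \<open>Three sequencing steps, one toss and three assignments; with the loop test this gives
  the 8 steps per coin in \<open>run_toss_loop\<close>. Clearing variable 2 leaves the outcome of
  the tosses in variable 3 only.\<close>

lemma run_toss_body:
  "run (Suc (Suc (Suc (Suc (Suc (Suc (Suc t))))))) (toss_body # cs, s)
    = bind_pmf (bernoulli_pmf (1 / 2)) (\<lambda>b. run t (cs,
        s(2 := enc_bool b, 3 := Branch (enc_bool b) (s 3), 2 := Leaf, 1 := right (s 1))))"
  by (simp add: toss_body_def bind_return_pmf bind_map_pmf)

lemma run_toss_loop:
  assumes "s 1 = enc_list ts" "s 2 = Leaf" "s 3 = tree_of acc"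
  shows "run (8 * length ts + 1 + u) (While 1 toss_body # cs, s)
    = bind_pmf (coins (length ts) acc) (\<lambda>R. run u (cs, s(1 := Leaf, 3 := tree_of R)))"
  using assms
proof (induction ts arbitrary: s acc)
  case Nil
  then have "s(1 := Leaf, 3 := tree_of acc) = s" by (auto simp: enc_list_def)
  moreover have "run (8 * length [] + 1 + u) (While 1 toss_body # cs, s) = run u (cs, s)"
    using Nil by (simp add: bind_return_pmf enc_list_def)
  ultimately show ?case by (simp only: coins.simps bind_return_pmf list.size)
next
  case (Cons t ts)
  let ?s = "\<lambda>b. s(3 := tree_of (b # acc), 1 := enc_list ts)"
  have "s 1 \<noteq> Leaf" using Cons.prems by (simp add: enc_list_def)
  then have "run (Suc k) (While 1 toss_body # cs, s) = run k (toss_body # While 1 toss_body # cs, s)" for k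
    by (simp add: bind_return_pmf)
  moreover have "8 * length (t # ts) + 1 + u = Suc (Suc (Suc (Suc (Suc (Suc (Suc (Suc (8 * length ts + 1 + u))))))))"
    by simp
  ultimately have "run (8 * length (t # ts) + 1 + u) (While 1 toss_body # cs, s)
    = run (Suc (Suc (Suc (Suc (Suc (Suc (Suc (8 * length ts + 1 + u)))))))) (toss_body # While 1 toss_body # cs, s)"
    by (simp only:)
  also have "\<dots> = bind_pmf (bernoulli_pmf (1 / 2)) (\<lambda>b. run (8 * length ts + 1 + u) (While 1 toss_body # cs, ?s b))"
  proof -
    have "s(2 := enc_bool b, 3 := Branch (enc_bool b) (s 3), 2 := Leaf, 1 := right (s 1)) = ?s b" for b
      using Cons.prems by (auto simp: fun_eq_iff tree_of_list_def tree_of_bool_def enc_list_def)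
    then show ?thesis unfolding run_toss_body by simp
  qed
  also have "\<dots> = bind_pmf (bernoulli_pmf (1 / 2)) (\<lambda>b. bind_pmf (coins (length ts) (b # acc))
      (\<lambda>R. run u (cs, s(1 := Leaf, 3 := tree_of R))))"
  proof (intro bind_pmf_cong refl)
    fix b
    have "run (8 * length ts + 1 + u) (While 1 toss_body # cs, ?s b) = bind_pmf (coins (length ts) (b # acc))
      (\<lambda>R. run u (cs, (?s b)(1 := Leaf, 3 := tree_of R)))"
      by (rule Cons.IH) (use Cons.prems in simp_all)
    moreover have "(?s b)(1 := Leaf, 3 := tree_of R) = s(1 := Leaf, 3 := tree_of R)" for R :: "bool list"
      by (auto simp: fun_eq_iff)
    ultimately show "run (8 * length ts + 1 + u) (While 1 toss_body # cs, ?s b) = bind_pmf (coins (length ts) (b # acc))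
      (\<lambda>R. run u (cs, s(1 := Leaf, 3 := tree_of R)))"
      by (simp only:)
  qed
  finally show ?case by (simp only: coins.simps length_Cons bind_assoc_pmf)
qed

text \<open>The quotient tends to 0, and convergent sequences are bounded. This is how a polynomial
  in \<open>p\<close> is absorbed by \<open>4 ^ p\<close>.\<close>

lemma power_le_exponential: "\<exists>C. \<forall>p. (p + 1) ^ d \<le> C * 4 ^ p" for d :: nat
proof -
  have "(\<lambda>p. (real p + 1) ^ d / 4 ^ p) \<longlonglongrightarrow> 0" by real_asymp
  then have "Bseq (\<lambda>p. (real p + 1) ^ d / 4 ^ p)" by (intro convergent_imp_Bseq convergentI)
  then obtain K where K: "\<And>p. norm ((real p + 1) ^ d / 4 ^ p) \<le> K" by (auto simp: Bseq_def)
  have "(p + 1) ^ d \<le> nat \<lceil>K\<rceil> * 4 ^ p" for p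
  proof -
    have "(real p + 1) ^ d \<le> K * 4 ^ p" using K[of p] by (simp add: field_simps)
    also have "\<dots> \<le> real (nat \<lceil>K\<rceil>) * 4 ^ p" by (intro mult_right_mono) (simp_all add: of_nat_ceiling)
    finally have "real ((p + 1) ^ d) \<le> real (nat \<lceil>K\<rceil> * 4 ^ p)" by (simp add: add.commute)
    then show ?thesis by (simp only: of_nat_le_iff)
  qed
  then show ?thesis by blast
qed

definition toss_com :: com
  where "toss_com = Seq (Assign 1 (LeftE (RightE (Var 0)))) (Seq (While 1 toss_body)
    (Assign 0 (BranchE (Var 3) (Var 0))))"

text \<open>The characteristic vector of the undeletable vertices serves as loop counter, having one
  entry per vertex. The 6 extra steps are three sequencings, two assignments and the last loop
  test.\<close>

lemma run_toss_com:
  fixes i :: inst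
  defines "U \<equiv> fst (snd i)"
  shows "\<exists>s. (\<forall>R. s R 0 = tree_of (R, i)) \<and> (\<forall>u. run (8 * length U + 6 + u) ([Seq toss_com c], (\<lambda>_. Leaf)(0 := tree_of i))
    = bind_pmf (coins (length U) []) (\<lambda>R. run u ([c], s R)))"
proof -
  let ?s = "(\<lambda>_. Leaf)(0 := tree_of i)"
  let ?s1 = "?s(1 := tree_of U)"
  let ?s2 = "\<lambda>R. ?s1(1 := Leaf, 3 := tree_of (R :: bool list))"
  let ?s3 = "\<lambda>R. (?s2 R)(0 := tree_of (R, i))"
  have U: "left (right (tree_of i)) = tree_of U" by (simp add: U_def tree_of_prod_def)
  have "run (8 * length U + 6 + u) ([Seq toss_com c], ?s)
    = bind_pmf (coins (length U) []) (\<lambda>R. run u ([c], ?s3 R))" for u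
  proof -
    have "8 * length U + 6 + u = Suc (Suc (Suc (Suc (8 * length U + 1 + Suc u))))" by simp
    then have "run (8 * length U + 6 + u) ([Seq toss_com c], ?s)
      = run (8 * length U + 1 + Suc u) (While 1 toss_body # [Assign 0 (BranchE (Var 3) (Var 0)), c], ?s1)"
      by (simp only:) (simp add: toss_com_def bind_return_pmf U)
    also have "\<dots> = bind_pmf (coins (length U) []) (\<lambda>R. run (Suc u) ([Assign 0 (BranchE (Var 3) (Var 0)), c], ?s2 R))"
      using run_toss_loop[of ?s1 "map tree_of U" "[]" "Suc u"] by (simp add: tree_of_list_def enc_list_def)
    also have "\<dots> = bind_pmf (coins (length U) []) (\<lambda>R. run u ([c], ?s3 R))"
      by (simp add: bind_return_pmf)
    finally show ?thesis .
  qed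
  then show ?thesis by (intro exI[of _ ?s3]) simp
qed

text \<open>All coins are tossed first, so the rest is a deterministic function of coins and
  instance. Every larger time works too, because a halted configuration idles.\<close>

lemma ptime_tosses:
  assumes "ptime (\<lambda>N. {z. length (fst (snd (snd z))) \<le> N \<and> fst (snd (snd (snd (snd z)))) \<le> N}) f"
  shows "\<exists>P K d. \<forall>(i :: inst) N. length (fst (snd i)) \<le> N \<and> fst (snd (snd (snd i))) \<le> N \<longrightarrow>
    (\<forall>t \<ge> K * (N + 1) ^ d. outputs_within P (tree_of i) t
      (map_pmf (\<lambda>R. tree_of (f (R, i))) (coins (length (fst (snd i))) [])))"
proof -
  obtain F q where F: "poly_bounded q"
    "\<forall>N. \<forall>x\<in>{z :: bool list \<times> inst. length (fst (snd (snd z))) \<le> N \<and> fst (snd (snd (snd (snd z)))) \<le> N}.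
      computes F (tree_of x) (tree_of (f x)) (q N)"
    using ptimeE[OF assms] by (elim exE conjE) (rule that)
  have "poly_bounded (\<lambda>N. 8 * Suc N + 6 + q N)" by (intro poly_bounded_intros F(1))
  then obtain K d where K: "\<And>N. 8 * Suc N + 6 + q N \<le> K * (N + 1) ^ d"
    unfolding poly_bounded_def by blast
  have "outputs_within (Seq toss_com (F 0)) (tree_of i) t
      (map_pmf (\<lambda>R. tree_of (f (R, i))) (coins (length (fst (snd i))) []))"
    if N: "length (fst (snd i)) \<le> N" "fst (snd (snd (snd i))) \<le> N" and t: "K * (N + 1) ^ d \<le> t" for i :: inst and N t
  proof -
    let ?n = "length (fst (snd i))"
    obtain s where s: "\<And>R. s R 0 = tree_of (R, i)"
      "\<And>u. run (8 * ?n + 6 + u) ([Seq toss_com (F 0)], (\<lambda>_. Leaf)(0 := tree_of i))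
        = bind_pmf (coins ?n []) (\<lambda>R. run u ([F 0], s R))"
      using run_toss_com[of i "F 0"] by blast
    define u where "u = t - (8 * ?n + 6)"
    have u: "t = 8 * ?n + 6 + u" "q N \<le> u" using t K[of N] N(1) by (auto simp: u_def)
    have "\<exists>s'. s' 0 = tree_of (f (R, i)) \<and> run u ([F 0], s R) = return_pmf ([], s')" for R
    proof -
      have "computes F (tree_of (R, i)) (tree_of (f (R, i))) (q N)"
        using F(2)[rule_format, of "(R, i)" N] N by simp
      from computesD[OF this, of "s R" 0, OF s(1)] obtain s' v where v: "v \<le> q N" "exec (F 0) (s R) v s'" "s' 0 = tree_of (f (R, i))"
        by (elim exE conjE) (rule that)
      have "run (v + (u - v)) ([F 0], s R) = run (u - v) ([], s')" using v(2) unfolding exec_def by blast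
      then show ?thesis using v(1,3) u(2) by (intro exI[of _ s']) (simp add: run_halted)
    qed
    then obtain s' where s': "\<And>R. s' R 0 = tree_of (f (R, i))" "\<And>R. run u ([F 0], s R) = return_pmf ([], s' R)"
      by metis
    have "run t (init_config (Seq toss_com (F 0)) (tree_of i)) = map_pmf (\<lambda>R. ([], s' R)) (coins ?n [])"
      unfolding init_config_def u(1) s(2) s'(2) map_pmf_def ..
    then show ?thesis unfolding outputs_within_def by (simp add: pmf.map_comp o_def s'(1))
  qed
  then show ?thesis by blast
qed

section \<open>Translation between the graph and its index set\<close>

locale indexed_graph =
  fixes G :: "nat pair_pre_digraph" and U T :: "nat set" and vs :: "nat list" and p :: nat
  assumes und_sub: "U \<subseteq> pverts G" and term_sub: "T \<subseteq> U" and dist: "distinct vs" and vs: "set vs = pverts G"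
begin

definition "n = length vs"
definition "adj = map (\<lambda>u. map (\<lambda>v. (u, v) \<in> parcs G) vs) vs"
definition "und = map (\<lambda>v. v \<in> U) vs"
definition "trm = map (\<lambda>v. v \<in> T) vs"
definition inst :: inst where "inst = (adj, und, trm, p, ())"

lemma tree_of_inst: "tree_of inst = enc_instance vs G U T p"
  by (simp add: inst_def enc_instance_def enc_graph_def enc_set_def adj_def und_def trm_def tree_of_list_def
      enc_list_def tree_of_bool_def[abs_def] tree_of_unit_def tree_of_nat_def o_def)

lemma get_und: "get n False und i \<longleftrightarrow> i < n \<and> vs ! i \<in> U"
  by (auto simp: get_def und_def n_def)

lemma get_trm: "get n False trm i \<longleftrightarrow> i < n \<and> vs ! i \<in> T"
  by (auto simp: get_def trm_def n_def)

lemma get_adj: "i < n \<Longrightarrow> j < n \<Longrightarrow> arc n adj i j \<longleftrightarrow> (vs ! i, vs ! j) \<in> parcs G"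
  by (simp add: arc_def get_def adj_def n_def)

lemma length_und: "length und = n"
  by (simp add: und_def n_def)

sublocale ig: list_graph n adj und trm p
  using term_sub by unfold_locales (auto simp: length_und get_und get_trm)

text \<open>Vertex sets travel to positions by preimage and back by image under \<open>vs\<close>;
  on sets of vertices the two are inverse to each other.\<close>

definition pre :: "nat set \<Rightarrow> nat set"
  where "pre S = {i. i < n \<and> vs ! i \<in> S}"

lemma und_pre: "ig.set_of und = pre U" and trm_pre: "ig.set_of trm = pre T"
  by (simp_all add: ig.set_of_def get_und get_trm pre_def)

lemma arc_adj: "i < n \<Longrightarrow> j < n \<Longrightarrow> (i, j) \<in> ig.E \<longleftrightarrow> (vs ! i, vs ! j) \<in> parcs G"
  by (simp add: ig.E_def get_adj)

lemma inj: "i < n \<Longrightarrow> j < n \<Longrightarrow> vs ! i = vs ! j \<longleftrightarrow> i = j"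
  unfolding n_def by (rule nth_eq_iff_index_eq[OF dist])

lemma inj_on_vs: "inj_on ((!) vs) A" if "A \<subseteq> ig.V"
proof (rule inj_onI)
  fix i j assume "i \<in> A" "j \<in> A" "vs ! i = vs ! j"
  moreover from this have "i < n" "j < n" using that ig.in_V by blast+
  ultimately show "i = j" using inj by blast
qed

lemma vs_mem: "i < n \<Longrightarrow> vs ! i \<in> pverts G"
  unfolding n_def vs[symmetric] by (rule nth_mem)

lemma index: "v \<in> pverts G \<Longrightarrow> \<exists>i<n. vs ! i = v"
  unfolding n_def vs[symmetric] in_set_conv_nth .

lemma image_pre: "S \<subseteq> pverts G \<Longrightarrow> (!) vs ` pre S = S"
  using index by (auto simp: pre_def)

lemma pre_image: "A \<subseteq> ig.V \<Longrightarrow> pre ((!) vs ` A) = A"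
proof -
  assume A: "A \<subseteq> ig.V"
  have "i \<in> pre ((!) vs ` A) \<longleftrightarrow> i \<in> A" for i
  proof
    assume "i \<in> pre ((!) vs ` A)"
    then obtain j where "i < n" "j \<in> A" "vs ! i = vs ! j" by (auto simp: pre_def)
    moreover from this have "j < n" using A ig.in_V by blast
    ultimately show "i \<in> A" using inj by blast
  next
    assume "i \<in> A"
    then show "i \<in> pre ((!) vs ` A)" using A ig.in_V by (auto simp: pre_def)
  qed
  then show ?thesis by blast
qed

lemma pre_sub: "pre S \<subseteq> ig.V"
  by (auto simp: pre_def ig.in_V)

lemma card_pre: "S \<subseteq> pverts G \<Longrightarrow> card (pre S) = card S"
  using card_image[OF inj_on_vs[OF pre_sub[of S]]] image_pre[of S] by simp

lemma reachable_reach: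
  assumes i: "i < n" "i \<notin> pre S"
  shows "vs ! i \<rightarrow>\<^sup>*\<^bsub>delete_verts (with_proj G) S\<^esub> v \<longleftrightarrow> v \<in> (!) vs ` ig.reach (pre S) i"
proof
  let ?H = "delete_verts (with_proj G) S"
  assume "vs ! i \<rightarrow>\<^sup>*\<^bsub>?H\<^esub> v"
  then show "v \<in> (!) vs ` ig.reach (pre S) i"
    unfolding reachable_def
  proof (induction rule: rtrancl_on_induct)
    case base
    then show ?case using ig.reach_refl by blast
  next
    case (step y z)
    then obtain j where j: "j \<in> ig.reach (pre S) i" "y = vs ! j" by blast
    then have "j < n" using ig.reach_sub i by (simp add: ig.in_V)
    have z: "(y, z) \<in> parcs G" "y \<notin> S" "z \<notin> S" "z \<in> pverts G"
      using step by (auto simp: delete_verts_def arcs_ends_conv)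
    obtain k where k: "k < n" "z = vs ! k" using index z(4) by blast
    have "k \<in> ig.reach (pre S) i"
      by (rule ig.reach_step[OF j(1)]) (use z j k \<open>j < n\<close> arc_adj in \<open>auto simp: pre_def\<close>)
    then show ?case using k by blast
  qed
next
  let ?H = "delete_verts (with_proj G) S"
  assume "v \<in> (!) vs ` ig.reach (pre S) i"
  then obtain j where j: "v = vs ! j" "(i, j) \<in> (Restr ig.E (ig.V - pre S))\<^sup>*" unfolding ig.reach_def by blast
  from j(2) have "vs ! i \<rightarrow>\<^sup>*\<^bsub>?H\<^esub> vs ! j"
    unfolding reachable_def
  proof (induction rule: rtrancl_induct)
    case base
    then show ?case using i vs_mem by (auto simp: delete_verts_def pre_def)
  next
    case (step y z)
    have "(vs ! y, vs ! z) \<in> arcs_ends ?H" "vs ! z \<in> verts ?H"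
      using step(2) arc_adj vs_mem by (auto simp: delete_verts_def arcs_ends_conv ig.in_V pre_def image_iff)
    then show ?case using step(3) by (rule rtrancl_on_into_rtrancl_on[rotated])
  qed
  then show "vs ! i \<rightarrow>\<^sup>*\<^bsub>?H\<^esub> v" using j by simp
qed

lemma reach_from_reach:
  "i < n \<Longrightarrow> i \<notin> pre S \<Longrightarrow> reach_from (delete_verts (with_proj G) S) {vs ! i} = (!) vs ` ig.reach (pre S) i"
  unfolding reach_from_def using reachable_reach by blast

lemma separator_sep:
  assumes i: "i < n" and S: "S \<subseteq> pverts G"
  shows "separator (with_proj G) U {vs ! i} T S \<longleftrightarrow> ig.sep i (pre S)"
proof (cases "i \<in> pre S")
  case True
  then show ?thesis by (auto simp: separator_def ig.sep_def pre_def)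
next
  case False
  have T: "T \<subseteq> pverts G" using term_sub und_sub by blast
  have reach: "(\<exists>y\<in>T. vs ! i \<rightarrow>\<^sup>*\<^bsub>delete_verts (with_proj G) S\<^esub> y) \<longleftrightarrow> ig.reach (pre S) i \<inter> pre T \<noteq> {}"
  proof -
    have "ig.reach (pre S) i \<subseteq> ig.V" using ig.reach_sub i by (auto simp: ig.in_V)
    moreover have "(\<exists>y\<in>T. y \<in> (!) vs ` W) \<longleftrightarrow> W \<inter> pre T \<noteq> {}" if "W \<subseteq> ig.V" for W
      using that by (auto simp: pre_def ig.in_V subset_iff)
    ultimately show ?thesis unfolding reachable_reach[OF i False] by blast
  qed
  have T0: "T \<noteq> {} \<longleftrightarrow> pre T \<noteq> {}" using image_pre[OF T] by blast
  have Ti: "vs ! i \<notin> T \<longleftrightarrow> i \<notin> pre T" using i by (simp add: pre_def)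
  have all: "(\<forall>v\<in>S. Q v) \<longleftrightarrow> (\<forall>j\<in>pre S. Q (vs ! j))" for Q
    using ball_simps(9)[of "(!) vs" "pre S" Q] unfolding image_pre[OF S] .
  have "S \<subseteq> pverts G - ({vs ! i} \<union> T \<union> U) \<longleftrightarrow> (\<forall>v\<in>S. v \<noteq> vs ! i \<and> v \<notin> T \<and> v \<notin> U)"
    using S by blast
  also have "\<dots> \<longleftrightarrow> (\<forall>j\<in>pre S. j \<noteq> i \<and> j \<notin> pre T \<and> j \<notin> pre U)"
    unfolding all using inj i by (intro ball_cong refl) (simp add: pre_def)
  also have "\<dots> \<longleftrightarrow> pre S \<subseteq> ig.V - ({i} \<union> pre T \<union> pre U)"
    using pre_sub[of S] by blast
  finally have sub: "S \<subseteq> pverts G - ({vs ! i} \<union> T \<union> U) \<longleftrightarrow> pre S \<subseteq> ig.V - ({i} \<union> pre T \<union> pre U)" .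
  have "separator (with_proj G) U {vs ! i} T S \<longleftrightarrow> T \<noteq> {} \<and> vs ! i \<notin> T \<and>
    S \<subseteq> pverts G - ({vs ! i} \<union> T \<union> U) \<and> \<not> (\<exists>y\<in>T. vs ! i \<rightarrow>\<^sup>*\<^bsub>delete_verts (with_proj G) S\<^esub> y)"
    unfolding separator_def using T vs_mem[OF i] by simp
  also have "\<dots> \<longleftrightarrow> ig.sep i (pre S)"
  proof -
    have "i \<in> ig.V" using i by (simp add: ig.in_V)
    then show ?thesis unfolding reach sub T0 Ti ig.sep_def unfolding und_pre trm_pre by argo
  qed
  finally show ?thesis .
qed

text \<open>A competitor on the index side is carried to the graph by \<open>vs\<close>, where
  injectivity preserves its size and the strictness of the inclusion.\<close>

lemma important_important:
  assumes i: "i < n" and imp: "important_separator (with_proj G) U {vs ! i} T S"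
  shows "ig.important i (pre S)"
  unfolding ig.important_def
proof (intro conjI notI)
  have s: "separator (with_proj G) U {vs ! i} T S"
    using imp by (simp add: important_separator_def minimal_separator_def)
  then have S: "S \<subseteq> pverts G" "vs ! i \<notin> S" by (auto simp: separator_def)
  show "ig.sep i (pre S)" using separator_sep[OF i S(1)] s by simp
  assume "\<exists>S'. ig.sep i S' \<and> card S' \<le> card (pre S) \<and> ig.reach (pre S) i \<subset> ig.reach S' i"
  then obtain A where A: "ig.sep i A" "card A \<le> card (pre S)" "ig.reach (pre S) i \<subset> ig.reach A i" by blast
  let ?S = "(!) vs ` A"
  have AV: "A \<subseteq> ig.V" "i \<notin> A" using A(1) by (auto simp: ig.sep_def)
  then have SG: "?S \<subseteq> pverts G" using vs_mem by (auto simp: ig.in_V)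
  have "separator (with_proj G) U {vs ! i} T ?S" using separator_sep[OF i SG] A(1) pre_image[OF AV(1)] by simp
  moreover have "card ?S \<le> card S" using A(2) card_pre[OF S(1)] card_image[OF inj_on_vs[OF AV(1)]] by simp
  moreover have "reach_from (delete_verts (with_proj G) S) {vs ! i} \<subset> reach_from (delete_verts (with_proj G) ?S) {vs ! i}"
  proof -
    have i1: "i \<notin> pre S" and i2: "i \<notin> pre ?S" using S(2) AV(2) pre_image[OF AV(1)] by (simp_all add: pre_def)
    have "ig.reach A i \<subseteq> ig.V" using ig.reach_sub i by (auto simp: ig.in_V)
    then have "(!) vs ` ig.reach (pre S) i \<subset> (!) vs ` ig.reach A i"
      using A(3) inj_on_vs by (intro image_strict_mono) auto
    then show ?thesis
      unfolding reach_from_reach[OF i i1] reach_from_reach[OF i i2] pre_image[OF AV(1)] .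
  qed
  ultimately show False using imp unfolding important_separator_def by blast
qed

definition sampled :: "bool list \<Rightarrow> nat set"
  where "sampled R = {vs ! i | i. i < n \<and> shadow (R, inst) ! i}"

lemma shadow_nth:
  "i < n \<Longrightarrow> shadow (R, inst) ! i \<longleftrightarrow> vs ! i \<notin> T \<and> T \<noteq> {} \<and> ig.accepts (ig.set_of R) i"
proof -
  assume i: "i < n"
  have "get n True trm i \<longleftrightarrow> vs ! i \<in> T" using i by (simp add: get_def trm_def n_def)
  moreover have "list_ex (get n False trm) [0..<n] \<longleftrightarrow> T \<noteq> {}"
  proof -
    have "T \<subseteq> pverts G" using term_sub und_sub by blast
    then have "T \<noteq> {} \<longleftrightarrow> pre T \<noteq> {}" using image_pre[of T] by blast
    then show ?thesis using ig.get_False[of trm] trm_pre by (auto simp: list_ex_iff pre_def)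
  qed
  moreover have "shadow (R, inst) = map (\<lambda>v. \<not> get n True trm v \<and> list_ex (\<lambda>b. get n False trm b) [0..<n] \<and>
      accept n und ig.M ig.ex p R v) [0..<n]"
    unfolding shadow_def inst_def Let_def fst_conv snd_conv length_und ig.H_def ig.M_def ig.ex_def ..
  ultimately show ?thesis using i ig.accept_iff[OF i, of R] by simp
qed

lemma mem_sampled: "i < n \<Longrightarrow> vs ! i \<in> sampled R \<longleftrightarrow> vs ! i \<notin> T \<and> T \<noteq> {} \<and> ig.accepts (ig.set_of R) i"
  unfolding sampled_def using inj shadow_nth by blast

lemma length_shadow: "length (shadow (R, inst)) = n"
  by (simp add: shadow_def inst_def length_und Let_def)

lemma enc_sampled: "enc_set vs (sampled R) = tree_of (shadow (R, inst))"
proof -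
  have "map (\<lambda>v. v \<in> sampled R) vs = shadow (R, inst)"
  proof (rule nth_equalityI)
    fix i assume "i < length (map (\<lambda>v. v \<in> sampled R) vs)"
    then have i: "i < n" by (simp add: n_def)
    then have "vs ! i \<in> sampled R \<longleftrightarrow> shadow (R, inst) ! i" unfolding sampled_def using inj by blast
    then show "map (\<lambda>v. v \<in> sampled R) vs ! i = shadow (R, inst) ! i" using i by (simp add: n_def)
  qed (simp add: length_shadow n_def)
  moreover have "enc_set vs (sampled R) = tree_of (map (\<lambda>v. v \<in> sampled R) vs)"
    by (simp add: enc_set_def tree_of_list_def tree_of_bool_def comp_def)
  ultimately show ?thesis by simp
qed

lemma sampled_sub: "sampled R \<subseteq> pverts G - T"
  using shadow_nth vs_mem by (auto simp: sampled_def)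

lemma sampled_prob:
  assumes thin: "thin (with_proj G) U T S" and S: "card S \<le> p"
    and Y: "\<And>v. v \<in> Y \<Longrightarrow> \<exists>S'\<subseteq>S. important_separator (with_proj G) U {v} T S'"
  shows "(1 / 2) ^ (p * (p + 1) ^ 2) \<le> measure_pmf.prob (coins n []) {R. S \<inter> sampled R = {} \<and> Y \<subseteq> sampled R}"
proof (cases "T = {}")
  case True
  then have "sampled R = {}" for R using shadow_nth unfolding sampled_def by blast
  \<comment> \<open>Separators are required to have a nonempty target.\<close>
  moreover have "Y = {}"
    using Y True by (fastforce simp: important_separator_def minimal_separator_def separator_def)
  ultimately show ?thesis by (simp add: power_le_one)
next
  case False
  have SG: "S \<subseteq> pverts G" and thinS: "\<And>v. v \<in> S \<Longrightarrow> S - {v} \<subseteq> pverts G - U"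
      "\<And>v. v \<in> S \<Longrightarrow> \<not> separator (with_proj G) U {v} T (S - {v})"
    using thin by (auto simp: thin_def reverse_shadow_def)
  \<comment> \<open>Coins in \<open>A\<close> have to show heads and coins in \<open>F\<close>
    tails. Vertices of \<open>S\<close> in \<open>T\<close> get no guard, as they never enter the
    sample.\<close>
  define A where "A = pre S - pre U"
  define F where "F = (\<Union>s\<in>pre S - pre T. ig.guard (pre S) s)"
  have sV: "s \<in> ig.V - ig.set_of trm" if "s \<in> pre S - pre T" for s
    using that pre_sub trm_pre by auto
  have fS: "finite (pre S)" "card (pre S) \<le> p"
    using finite_subset[OF pre_sub ig.fin] card_pre[OF SG] S by simp_all
  have "card F \<le> (\<Sum>s\<in>pre S - pre T. card (ig.guard (pre S) s))"
    unfolding F_def by (rule card_UN_le) (use fS in simp)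
  also have "\<dots> \<le> (\<Sum>s\<in>pre S - pre T. (p + 2) * p)"
    by (rule sum_mono) (rule ig.card_guard[OF sV])
  also have "\<dots> \<le> p * ((p + 2) * p)"
    using card_mono[OF fS(1), of "pre S - pre T"] fS(2) by (simp only: sum_constant) (intro mult_right_mono; simp)
  finally have cF: "card F \<le> p * ((p + 2) * p)" .
  have FV: "F \<subseteq> ig.V - pre S" unfolding F_def using ig.guard_sub[OF sV] by blast
  have cA: "card A \<le> p" unfolding A_def using card_mono[OF fS(1), of "pre S - pre U"] fS(2) by simp
  have ev: "S \<inter> sampled R = {} \<and> Y \<subseteq> sampled R"
    if R: "A \<subseteq> ig.set_of R" "ig.set_of R \<inter> F = {}" for R
  proof
    show "S \<inter> sampled R = {}"
    proof (rule ccontr)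
      assume "S \<inter> sampled R \<noteq> {}"
      then obtain i where "i < n" "vs ! i \<in> S" "vs ! i \<in> sampled R" unfolding sampled_def by blast
      then have i: "i < n" "vs ! i \<in> S" "vs ! i \<notin> T" "ig.accepts (ig.set_of R) i"
        using mem_sampled by blast+
      then have iS: "i \<in> pre S - pre T" by (simp add: pre_def)
      have g: "ig.set_of R \<inter> ig.guard (pre S) i = {}" using R(2) iS unfolding F_def by blast
      have u: "pre S - ig.set_of und \<subseteq> ig.set_of R" using R(1) unfolding A_def und_pre .
      have "pre T \<noteq> {}" using image_pre[of T] False term_sub und_sub by auto
      then have t: "ig.set_of trm \<noteq> {}" unfolding trm_pre .
      obtain C where C: "C \<subseteq> pre S - {i}" "ig.sep i C"
        using ig.accepts_guard[OF sV[OF iS] t u g i(4)] by (elim exE conjE) (rule that)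
      have P: "pre (S - {vs ! i}) = pre S - {i}" using inj i(1) by (auto simp: pre_def)
      \<comment> \<open>A separator stays one when enlarged by admissible vertices, so all of
        \<open>S - {vs ! i}\<close> would separate, against thinness.\<close>
      have "Restr ig.E (ig.V - (pre S - {i})) \<subseteq> Restr ig.E (ig.V - C)" using C(1) by blast
      from rtrancl_mono[OF this] have "ig.reach (pre S - {i}) i \<subseteq> ig.reach C i"
        unfolding ig.reach_def by blast
      moreover have "pre (S - {vs ! i}) \<subseteq> ig.V - ({i} \<union> pre T \<union> pre U)"
        using thinS(1)[OF i(2)] term_sub P by (auto simp: pre_def ig.in_V)
      ultimately have "ig.sep i (pre (S - {vs ! i}))"
        using C(2) unfolding P ig.sep_def unfolding und_pre trm_pre by blast
      then have "separator (with_proj G) U {vs ! i} T (S - {vs ! i})"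
        using separator_sep[OF i(1), of "S - {vs ! i}"] SG by blast
      then show False using thinS(2)[OF i(2)] by blast
    qed
    show "Y \<subseteq> sampled R"
    proof
      fix v assume "v \<in> Y"
      then obtain S' where S': "S' \<subseteq> S" "important_separator (with_proj G) U {v} T S'" using Y by blast
      then have "separator (with_proj G) U {v} T S'"
        by (simp add: important_separator_def minimal_separator_def)
      then have v: "v \<in> pverts G" "v \<notin> T" "T \<noteq> {}" "S' \<inter> U = {}" by (auto simp: separator_def)
      obtain i where i: "i < n" "vs ! i = v" using index v(1) by blast
      have "pre S' \<subseteq> ig.set_of R" using R(1) S'(1) v(4) by (auto simp: A_def pre_def)
      moreover have "card (pre S') \<le> p"
        using card_mono[OF fS(1), of "pre S'"] S'(1) fS(2) by (force simp: pre_def)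
      ultimately have "ig.accepts (ig.set_of R) i"
        using ig.accepts_important[OF important_important[OF i(1)]] S'(2) i(2) by blast
      then show "v \<in> sampled R" using mem_sampled[OF i(1)] i(2) v by simp
    qed
  qed
  have "A \<inter> F = {}" using FV by (auto simp: A_def)
  from prob_coins[OF this, of n "[]"]
  have "(1 / 2) ^ (card (A \<inter> {..<n}) + card (F \<inter> {..<n}))
    \<le> measure_pmf.prob (coins n []) {R. \<forall>i<n. (i \<in> A \<longrightarrow> R ! i) \<and> (i \<in> F \<longrightarrow> \<not> R ! i)}" .
  also have "\<dots> \<le> measure_pmf.prob (coins n []) {R. S \<inter> sampled R = {} \<and> Y \<subseteq> sampled R}"
  proof (rule measure_pmf.finite_measure_mono_AE)
    show "AE R in coins n []. R \<in> {R. \<forall>i<n. (i \<in> A \<longrightarrow> R ! i) \<and> (i \<in> F \<longrightarrow> \<not> R ! i)} \<longrightarrow>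
      R \<in> {R. S \<inter> sampled R = {} \<and> Y \<subseteq> sampled R}"
    proof (simp only: AE_measure_pmf_iff, intro ballI impI)
      fix R assume "R \<in> set_pmf (coins n [])" and
        R: "R \<in> {R. \<forall>i<n. (i \<in> A \<longrightarrow> R ! i) \<and> (i \<in> F \<longrightarrow> \<not> R ! i)}"
      then have len: "length R = n" using set_pmf_coins by fastforce
      have "A \<subseteq> ig.V" by (auto simp: A_def pre_def ig.in_V)
      then have "A \<subseteq> ig.set_of R" using R len by (auto simp: ig.in_set_of ig.in_V subset_iff)
      moreover have "ig.set_of R \<inter> F = {}"
        using R len ig.set_of_sub[of R] ig.in_set_of[OF len] by (auto simp: ig.in_V subset_iff)
      ultimately show "R \<in> {R. S \<inter> sampled R = {} \<and> Y \<subseteq> sampled R}" using ev by blast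
    qed
  qed simp
  finally have *: "(1 / 2) ^ (card (A \<inter> {..<n}) + card (F \<inter> {..<n}))
    \<le> measure_pmf.prob (coins n []) {R. S \<inter> sampled R = {} \<and> Y \<subseteq> sampled R}" .
  have "finite A" "finite F" using pre_sub FV ig.fin by (auto simp: A_def intro: finite_subset)
  then have "card (A \<inter> {..<n}) \<le> card A" "card (F \<inter> {..<n}) \<le> card F" by (auto intro: card_mono)
  then have "card (A \<inter> {..<n}) + card (F \<inter> {..<n}) \<le> p + p * ((p + 2) * p)" using cA cF by linarith
  also have "\<dots> = p * (p + 1) ^ 2" by (simp add: power2_eq_square algebra_simps)
  finally have "(1 / 2 :: real) ^ (p * (p + 1) ^ 2) \<le> (1 / 2) ^ (card (A \<inter> {..<n}) + card (F \<inter> {..<n}))"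
    by (intro power_decreasing) auto
  with * show ?thesis by linarith
qed

end

section \<open>Final bounds and assembly\<close>

lemma failure_bound: "2 powr (- (2 powr (real 3 * real p))) \<le> (1 / 2) ^ (p * (p + 1) ^ 2)" for p :: nat
proof -
  have "p + 1 \<le> 2 ^ p" by (induction p) auto
  then have "p * (p + 1) ^ 2 \<le> 2 ^ p * (2 ^ p) ^ 2" by (intro mult_mono power_mono) auto
  also have "\<dots> = 2 ^ (3 * p)" by (simp add: power_mult[symmetric] power_add[symmetric] mult.commute)
  finally have "real (p * (p + 1) ^ 2) \<le> real (2 ^ (3 * p))" by (simp only: of_nat_le_iff)
  also have "\<dots> = 2 powr (real 3 * real p)" by (simp add: powr_realpow[symmetric])
  finally have "2 powr (- (2 powr (real 3 * real p))) \<le> 2 powr (- real (p * (p + 1) ^ 2))"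
    by (intro powr_mono) auto
  also have "\<dots> = (1 / 2) ^ (p * (p + 1) ^ 2)"
    by (simp only: powr_minus powr_realpow[of 2] zero_less_numeral) (simp add: power_divide inverse_eq_divide)
  finally show ?thesis .
qed

theorem theorem2:
  shows "\<exists>(P :: com) (K :: nat) (k :: nat) (c :: nat).
    \<forall>(G :: nat pair_pre_digraph) (U :: nat set) (T :: nat set) (p :: nat) (vs :: nat list).
      pair_fin_digraph G \<and> U \<subseteq> pverts G \<and> T \<subseteq> U \<and> distinct vs \<and> set vs = pverts G \<longrightarrow>
      (\<exists>D :: nat set pmf.
        outputs_within P (enc_instance vs G U T p) (K * 4 ^ p * (card (pverts G) + 1) ^ k)
          (map_pmf (enc_set vs) D) \<and>
        (\<forall>Z \<in> set_pmf D. Z \<subseteq> pverts G - T) \<and>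
        (\<forall>S Y. thin (with_proj G) U T S \<and> card S \<le> p \<and>
               (\<forall>v\<in>Y. \<exists>S'\<subseteq>S. important_separator (with_proj G) U {v} T S') \<longrightarrow>
               measure_pmf.prob D {Z. S \<inter> Z = {} \<and> Y \<subseteq> Z} \<ge> 2 powr (- (2 powr (real c * real p)))))"
proof -
  obtain P K d where P: "\<forall>(i :: inst) N. length (fst (snd i)) \<le> N \<and> fst (snd (snd (snd i))) \<le> N \<longrightarrow>
      (\<forall>t \<ge> K * (N + 1) ^ d. outputs_within P (tree_of i) t
        (map_pmf (\<lambda>R. tree_of (shadow (R, i))) (coins (length (fst (snd i))) [])))"
    using ptime_tosses[OF ptime_shadow] by (elim exE) (rule that)
  obtain C where C: "\<And>p. (p + 1) ^ d \<le> C * 4 ^ p" using power_le_exponential by blast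
  show ?thesis
  proof (rule exI[of _ P], rule exI[of _ "K * C"], rule exI[of _ d], rule exI[of _ 3], intro allI impI, elim conjE)
    fix G :: "nat pair_pre_digraph" and U T :: "nat set" and p :: nat and vs :: "nat list"
    assume G: "U \<subseteq> pverts G" "T \<subseteq> U" "distinct vs" "set vs = pverts G"
    interpret indexed_graph G U T vs p by unfold_locales (rule G)+
    have card: "card (pverts G) = n" using distinct_card[OF dist] vs by (simp add: n_def)
    \<comment> \<open>The size parameter is \<open>n + p\<close>; bounding it by a product separates
      the polynomial in \<open>n\<close> from the one in \<open>p\<close>.\<close>
    have "(n + p + 1) ^ d \<le> ((n + 1) * (p + 1)) ^ d" by (intro power_mono) auto
    also have "\<dots> \<le> (n + 1) ^ d * (C * 4 ^ p)" unfolding power_mult_distrib by (intro mult_left_mono C) simp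
    finally have "K * (n + p + 1) ^ d \<le> K * ((n + 1) ^ d * (C * 4 ^ p))" by (rule mult_left_mono) simp
    then have t: "K * (n + p + 1) ^ d \<le> K * C * 4 ^ p * (card (pverts G) + 1) ^ d" by (simp add: card mult_ac)
    have l: "length (fst (snd inst)) = n" "fst (snd (snd (snd inst))) = p" by (simp_all add: inst_def length_und)
    let ?D = "map_pmf sampled (coins n [])"
    have "map_pmf (enc_set vs) ?D = map_pmf (\<lambda>R. tree_of (shadow (R, inst))) (coins n [])"
      unfolding map_pmf_comp enc_sampled ..
    moreover have "outputs_within P (tree_of inst) (K * C * 4 ^ p * (card (pverts G) + 1) ^ d)
        (map_pmf (\<lambda>R. tree_of (shadow (R, inst))) (coins n []))"
      using P[rule_format, of inst "n + p", OF _ t] unfolding l by simp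
    ultimately have out: "outputs_within P (enc_instance vs G U T p) (K * C * 4 ^ p * (card (pverts G) + 1) ^ d)
        (map_pmf (enc_set vs) ?D)"
      unfolding tree_of_inst by simp
    show "\<exists>D. outputs_within P (enc_instance vs G U T p) (K * C * 4 ^ p * (card (pverts G) + 1) ^ d)
          (map_pmf (enc_set vs) D) \<and>
        (\<forall>Z \<in> set_pmf D. Z \<subseteq> pverts G - T) \<and>
        (\<forall>S Y. thin (with_proj G) U T S \<and> card S \<le> p \<and>
               (\<forall>v\<in>Y. \<exists>S'\<subseteq>S. important_separator (with_proj G) U {v} T S') \<longrightarrow>
               measure_pmf.prob D {Z. S \<inter> Z = {} \<and> Y \<subseteq> Z} \<ge> 2 powr (- (2 powr (real 3 * real p))))"
    proof (rule exI[of _ ?D], intro conjI allI impI, rule out)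
      show "\<forall>Z\<in>set_pmf ?D. Z \<subseteq> pverts G - T" using sampled_sub by auto
      fix S Y
      assume "thin (with_proj G) U T S \<and> card S \<le> p \<and>
        (\<forall>v\<in>Y. \<exists>S'\<subseteq>S. important_separator (with_proj G) U {v} T S')"
      then have "(1 / 2) ^ (p * (p + 1) ^ 2)
          \<le> measure_pmf.prob (coins n []) {R. S \<inter> sampled R = {} \<and> Y \<subseteq> sampled R}"
        by (elim conjE) (rule sampled_prob, assumption+, erule bspec)
      moreover have "measure_pmf.prob ?D {Z. S \<inter> Z = {} \<and> Y \<subseteq> Z}
          = measure_pmf.prob (coins n []) {R. S \<inter> sampled R = {} \<and> Y \<subseteq> sampled R}"
        by (simp add: vimage_def)
      ultimately show "2 powr (- (2 powr (real 3 * real p))) \<le> measure_pmf.prob ?D {Z. S \<inter> Z = {} \<and> Y \<subseteq> Z}"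
        using failure_bound[of p] by linarith
    qed
  qed
qed

end
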